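(* Let $0<\alpha\leq\beta\leq 1$, let $X,\{X_{k,l},\ k,l\geq 0\}$ be i.i.d. real-valued random variables, and let $\mu\in\mathbb{R}$. Then $$\frac{1}{A_m^{\alpha}A_n^{\beta}}\sum_{k=0}^{m}\sum_{l=0}^{n}A_{m-k}^{\alpha-1}A_{n-l}^{\beta-1}X_{k,l}\to\mu\quad\text{almost surely as } m,n\to\infty$$ if and only if $E\,X=\mu$ and the following moment condition (according to the values of $\alpha,\beta$) holds: $$\begin{cases} E|X|^{1/\alpha}<\infty,&\text{for } 0<\alpha<\beta\leq 1,\\ E|X|^{1/\alpha}\log^+|X|<\infty,&\text{for } 0<\alpha=\beta\leq 1. \end{cases}$$
   Context: For $\gamma>-1$ the Cesàro numbers are $A_0^{\gamma}=1$ and $A_n^{\gamma}=\frac{(\gamma+1)(\gamma+2)\cdots(\gamma+n)}{n!}$ for $n=1,2,\dots$. In particular $A_n^0=1$ for all $n\ge 0$. Here $\log^+x=\max\{\log x,1\}$ (with value $1$ at $x=0$). "$m,n\to\infty$" means $\min(m,n)\to\infty$, i.e. both indices tend to infinity. *)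

theory Defs
  imports "HOL-Probability.Probability"
begin

(* Used for \<gamma> > -1 only. *)
definition cesaro_number :: "real \<Rightarrow> nat \<Rightarrow> real" where
  "cesaro_number \<gamma> n = (\<Prod>i=1..n. \<gamma> + real i) / fact n"

lemma cesaro_number_0 [simp]: "cesaro_number \<gamma> 0 = 1"
  by (simp add: cesaro_number_def)

lemma cesaro_number_zero_order [simp]: "cesaro_number 0 n = 1"
  by (simp add: cesaro_number_def fact_prod)

(* Truncation of the logarithm is at 1, not at 0.  Used for x \<ge> 0 only. *)
definition log_plus :: "real \<Rightarrow> real" where
  "log_plus x = (if x = 0 then 1 else max (ln x) 1)"

definition cesaro_mean ::
    "real \<Rightarrow> real \<Rightarrow> (nat \<Rightarrow> nat \<Rightarrow> real) \<Rightarrow> nat \<Rightarrow> nat \<Rightarrow> real" where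
  "cesaro_mean \<alpha> \<beta> x m n =
     1 / (cesaro_number \<alpha> m * cesaro_number \<beta> n) *
     (\<Sum>k=0..m. \<Sum>l=0..n.
        cesaro_number (\<alpha> - 1) (m - k) * cesaro_number (\<beta> - 1) (n - l) * x k l)"

(* X together with the double array Y is one i.i.d. family, so X is also independent of Y:
   the index None stands for X, and Some (k, l) for Y k l.
   Measurability of all the variables is part of indep_vars. *)
definition (in prob_space) iid_with_array ::
    "('a \<Rightarrow> real) \<Rightarrow> (nat \<Rightarrow> nat \<Rightarrow> 'a \<Rightarrow> real) \<Rightarrow> bool" where
  "iid_with_array X Y \<longleftrightarrow>
     indep_vars (\<lambda>_. borel) (case_option X (\<lambda>(k, l). Y k l)) UNIV \<and>
     (\<forall>k l. distr M borel (Y k l) = distr M borel X)"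

end

theory Submission
  imports Defs
begin

text \<open>
  The Cesaro mean is a weighted average with product weights
  \<open>a m k * b n l\<close>, where \<open>a m k = A\<^bsub>m-k\<^esub>\<^bsup>\<alpha>-1\<^esup> / A\<^bsub>m\<^esub>\<^bsup>\<alpha>\<^esup>\<close> is nonnegative and at most \<open>(m + 1)\<^bsup>-\<alpha>\<^esup>\<close>.

  Sufficiency: it is enough to treat nonnegative variables. Truncate \<open>X k l\<close> at
  \<open>(k + 1)\<^bsup>\<alpha>\<^esup> (l + 1)\<^bsup>\<beta>\<^esup>\<close>; the moment condition is exactly what makes the number of truncated
  variables integrable. High moments of the centred truncated means are bounded by Rosenthal's
  inequality and turn out to be summable over all indices if the order is below 1, and over a
  geometrically growing subsequence if it equals 1. In the latter case nonnegativity makes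
  \<open>(n + 1)\<close> times the mean monotone in \<open>n\<close>, so that the gaps of the subsequence can be filled.

  Necessity: the last summand of the mean, \<open>X m n / (A\<^bsub>m\<^esub>\<^bsup>\<alpha>\<^esup> A\<^bsub>n\<^esub>\<^bsup>\<beta>\<^esup>)\<close>, is independent of the
  rest, and the rest converges in probability. Hence exceedances of the last summand
  force deviations of the mean, so the exceedance probabilities are summable over \<open>m, n \<ge> N\<close>,
  and counting exceedances gives the moment condition. The value of the limit then follows from
  the sufficiency part.
\<close>

section \<open>Cesaro numbers and weights\<close>

text \<open>Behind the moment condition stands the number of pairs (i, j) of positive integers with
  i^\<alpha> j^\<beta> < x. For fixed j it is about x^(1/\<alpha>) j^(-\<beta>/\<alpha>); the sum
  over j converges if \<alpha> < \<beta> and is harmonic if \<alpha> = \<beta>, whence the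
  logarithm. The obstacle to sufficiency is that for order below 1 the weights pile up at k = m, so
  neighbouring means are not comparable and no sparse subsequence suffices; second moments decay too
  slowly to be summed over all indices, hence high even powers. For order 1 the weights are flat:
  their s-th powers sum to a value larger by a factor m + 1, which only a geometric subsequence can
  pay for. The tight case is \<alpha> = \<beta> = 1: no moment above the first is at hand, the
  variance has no power decay, and exponent 2 is taken, where both terms of Rosenthal's bound are
  the same sum. For necessity, Borel-Cantelli does not apply to the means, since they share
  variables. The last summands are independent of each other, but the remainders are not; this is
  why exceedances are ordered and only the last one is compared with its remainder.\<close>

lemma cesaro_number_Suc:
  "cesaro_number \<gamma> (Suc n) = cesaro_number \<gamma> n * ((\<gamma> + real (Suc n)) / real (Suc n))"
  by (simp add: cesaro_number_def field_simps)

lemma cesaro_number_pos: "\<gamma> > -1 \<Longrightarrow> cesaro_number \<gamma> n > 0"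
  by (induction n) (auto simp: cesaro_number_Suc)

lemma cesaro_number_nonneg: "\<gamma> \<ge> -1 \<Longrightarrow> cesaro_number \<gamma> n \<ge> 0"
  by (induction n) (auto simp: cesaro_number_Suc)

lemma cesaro_number_shift_order:
  "cesaro_number (\<gamma> - 1) (Suc n) = cesaro_number \<gamma> n * (\<gamma> / real (Suc n))"
  by (induction n) (simp_all add: cesaro_number_Suc[of "\<gamma> - 1"] cesaro_number_Suc[of \<gamma>] divide_simps)

lemma sum_cesaro_number: "(\<Sum>j\<le>n. cesaro_number (\<gamma> - 1) j) = cesaro_number \<gamma> n"
  by (induction n) (simp_all add: cesaro_number_shift_order cesaro_number_Suc[of \<gamma>] field_simps)

text \<open>Weighted AM-GM for the numbers 1 + x and 1 with weights \<gamma> and 1 - \<gamma>. It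
  drives \<open>cesaro_number_ge\<close> and \<open>cesaro_number_shift_le\<close>.\<close>

lemma powr_Bernoulli_upper:
  fixes x \<gamma> :: real
  assumes "0 \<le> \<gamma>" "\<gamma> \<le> 1" "0 \<le> x"
  shows "(1 + x) powr \<gamma> \<le> 1 + \<gamma> * x"
proof -
  have "(1 + x) powr \<gamma> * 1 powr (1 - \<gamma>) \<le> \<gamma> * (1 + x) + (1 - \<gamma>) * 1"
    using Youngs_inequality_0[of \<gamma> "1 - \<gamma>" "1 + x" 1] assms by simp
  then show ?thesis by (simp add: algebra_simps)
qed

text \<open>Both sides agree at n = 0, and by Bernoulli the growth factor 1 + \<gamma>/(n + 1) of
  the Cesaro numbers is at least that of the power.\<close>

lemma cesaro_number_ge:
  assumes "0 \<le> \<gamma>" "\<gamma> \<le> 1"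
  shows "real (Suc n) powr \<gamma> \<le> cesaro_number \<gamma> n"
proof (induction n)
  case (Suc n)
  have "real (Suc (Suc n)) powr \<gamma> = real (Suc n) powr \<gamma> * (1 + 1 / real (Suc n)) powr \<gamma>"
    by (subst powr_mult[symmetric]) (auto simp: distrib_left)
  also have "\<dots> \<le> cesaro_number \<gamma> n * (1 + \<gamma> * (1 / real (Suc n)))"
    using assms by (intro mult_mono Suc powr_Bernoulli_upper cesaro_number_nonneg) auto
  also have "\<dots> = cesaro_number \<gamma> (Suc n)"
    by (simp add: cesaro_number_Suc field_simps)
  finally show ?case .
qed simp

lemma cesaro_number_shift_le:
  assumes "0 < \<gamma>" "\<gamma> \<le> 1"
  shows "cesaro_number (\<gamma> - 1) n \<le> real (Suc n) powr (\<gamma> - 1)"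
proof (induction n)
  case (Suc n)
  let ?d = "1 - \<gamma>" and ?x = "1 / real (Suc n)"
  \<comment> \<open>Bernoulli covers exponents in [0, 1] only, so the negative exponent \<gamma> - 1
    is reached through its reciprocal, using (1 - dx)(1 + dx) \<le> 1.\<close>
  have "(1 - ?d * ?x) * (1 + ?x) powr ?d \<le> (1 - ?d * ?x) * (1 + ?d * ?x)"
    using assms by (intro mult_left_mono powr_Bernoulli_upper) (auto simp: field_simps)
  also have "\<dots> = 1 - (?d * ?x)\<^sup>2"
    by (simp add: algebra_simps power2_eq_square)
  also have "\<dots> \<le> 1"
    by simp
  finally have "(1 - ?d * ?x) * (1 + ?x) powr ?d \<le> 1" .
  moreover have "(1 + ?x) powr (\<gamma> - 1) = 1 / (1 + ?x) powr ?d"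
    using powr_minus_divide[of "1 + ?x" ?d] by simp
  moreover have "(1 + ?x) powr ?d > 0"
    using zero_le_divide_1_iff[of "real (Suc n)"] by (intro powr_gt_zero[THEN iffD2]) linarith
  ultimately have step: "1 - ?d * ?x \<le> (1 + ?x) powr (\<gamma> - 1)"
    by (simp only: pos_le_divide_eq)
  have "cesaro_number (\<gamma> - 1) (Suc n) = cesaro_number (\<gamma> - 1) n * (1 - ?d * ?x)"
    by (simp add: cesaro_number_Suc field_simps)
  also have "\<dots> \<le> real (Suc n) powr (\<gamma> - 1) * (1 + ?x) powr (\<gamma> - 1)"
    using assms by (intro mult_mono Suc step) (auto simp: field_simps)
  also have "\<dots> = real (Suc (Suc n)) powr (\<gamma> - 1)"
    by (subst powr_mult[symmetric]) (auto simp: distrib_left)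
  finally show ?case .
qed simp

lemma cesaro_number_le:
  assumes "0 < \<gamma>" 
  shows "cesaro_number \<gamma> n \<le> (1 + \<gamma>) * real (Suc n) powr \<gamma>"
proof (cases n)
  case (Suc k)
  \<comment> \<open>The comparison is with n^\<gamma>, n = k + 1, since the growth factor 1 +
    \<gamma>/(n + 1) is at most ((n + 1)/n)^\<gamma>. This forces the induction to start at n = 1,
    where the value 1 + \<gamma> supplies the constant.\<close>
  have "cesaro_number \<gamma> (Suc k) \<le> (1 + \<gamma>) * real (Suc k) powr \<gamma>"
  proof (induction k)
    case 0
    then show ?case by (simp add: cesaro_number_Suc)
  next
    case (Suc k)
    let ?x = "1 / real (Suc (Suc k))"
    have "exp (\<gamma> * ?x) \<le> exp (\<gamma> * ln (real (Suc (Suc k)) / real (Suc k)))"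
    proof -
      have "?x = 1 - real (Suc k) / real (Suc (Suc k))" by (simp add: field_simps)
      also have "\<dots> \<le> ln (real (Suc (Suc k)) / real (Suc k))"
        using ln_le_minus_one[of "real (Suc k) / real (Suc (Suc k))"]
        by (simp add: ln_div)
      finally have "\<gamma> * ?x \<le> \<gamma> * ln (real (Suc (Suc k)) / real (Suc k))"
        using assms by (intro mult_left_mono) auto
      then show ?thesis by (simp only: exp_le_cancel_iff)
    qed
    from order.trans[OF exp_ge_add_one_self this]
    have *: "1 + \<gamma> * ?x \<le> (real (Suc (Suc k)) / real (Suc k)) powr \<gamma>"
      by (simp add: powr_def del: of_nat_Suc)
    have "cesaro_number \<gamma> (Suc (Suc k)) = cesaro_number \<gamma> (Suc k) * (1 + \<gamma> * ?x)"
      by (simp add: cesaro_number_Suc[of _ "Suc k"] field_simps)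
    also have "\<dots> \<le> ((1 + \<gamma>) * real (Suc k) powr \<gamma>) * (real (Suc (Suc k)) / real (Suc k)) powr \<gamma>"
      using assms by (intro mult_mono Suc *) (auto intro!: add_nonneg_nonneg)
    also have "\<dots> = (1 + \<gamma>) * real (Suc (Suc k)) powr \<gamma>"
      by (simp add: powr_divide)
    finally show ?case .
  qed
  also have "\<dots> \<le> (1 + \<gamma>) * real (Suc (Suc k)) powr \<gamma>"
    using assms by (intro mult_left_mono powr_mono2) auto
  finally show ?thesis using Suc by simp
qed (use assms in simp)

text \<open>The value 0 beyond m allows means of different sizes to be compared term by term over a
  common box.\<close>

definition cesaro_weight :: "real \<Rightarrow> nat \<Rightarrow> nat \<Rightarrow> real" where
  "cesaro_weight \<gamma> m k =
     (if k \<le> m then cesaro_number (\<gamma> - 1) (m - k) / cesaro_number \<gamma> m else 0)"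

lemma cesaro_weight_nonneg: "\<gamma> \<ge> 0 \<Longrightarrow> cesaro_weight \<gamma> m k \<ge> 0"
  by (simp add: cesaro_weight_def cesaro_number_nonneg)

lemma cesaro_weight_one: "cesaro_weight 1 m k = (if k \<le> m then 1 / real (Suc m) else 0)"
proof -
  have "cesaro_number 1 m = real (Suc m)"
    using sum_cesaro_number[of 1 m] by simp
  then show ?thesis by (simp add: cesaro_weight_def)
qed

lemma cesaro_mean_eq:
  "cesaro_mean \<alpha> \<beta> x m n =
     (\<Sum>k\<le>m. \<Sum>l\<le>n. cesaro_weight \<alpha> m k * cesaro_weight \<beta> n l * x k l)"
  unfolding cesaro_mean_def sum_distrib_left atMost_atLeast0
  by (intro sum.cong refl) (simp add: cesaro_weight_def)

lemma sum_cesaro_weight: "\<gamma> > 0 \<Longrightarrow> (\<Sum>k\<le>m. cesaro_weight \<gamma> m k) = 1"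
proof -
  assume "\<gamma> > 0"
  have "(\<Sum>k\<le>m. cesaro_weight \<gamma> m k) = (\<Sum>k\<le>m. cesaro_number (\<gamma> - 1) (m - k)) / cesaro_number \<gamma> m"
    by (simp add: cesaro_weight_def sum_divide_distrib)
  also have "(\<Sum>k\<le>m. cesaro_number (\<gamma> - 1) (m - k)) = (\<Sum>j\<le>m. cesaro_number (\<gamma> - 1) j)"
    by (rule sum.reindex_bij_witness[of _ "\<lambda>k. m - k" "\<lambda>k. m - k"]) auto
  finally show ?thesis
    using cesaro_number_pos[of \<gamma> m] \<open>\<gamma> > 0\<close> by (simp add: sum_cesaro_number)
qed

lemma cesaro_weight_le:
  assumes "0 < \<gamma>" "\<gamma> \<le> 1" "k \<le> m"
  shows "cesaro_weight \<gamma> m k \<le> real (Suc (m - k)) powr (\<gamma> - 1) * real (Suc m) powr - \<gamma>"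
proof -
  have "cesaro_weight \<gamma> m k \<le> real (Suc (m - k)) powr (\<gamma> - 1) / real (Suc m) powr \<gamma>"
    unfolding cesaro_weight_def using assms
    by (auto simp del: of_nat_Suc intro!: frac_le cesaro_number_shift_le cesaro_number_ge)
  then show ?thesis by (simp add: powr_minus divide_inverse)
qed

lemma cesaro_weight_le_powr:
  assumes "0 < \<gamma>" "\<gamma> \<le> 1"
  shows "cesaro_weight \<gamma> m k \<le> real (Suc m) powr - \<gamma>"
proof (cases "k \<le> m")
  case True
  have "real (Suc (m - k)) powr (\<gamma> - 1) \<le> 1"
    using assms powr_mono[of "\<gamma> - 1" 0 "real (Suc (m - k))"] by simp
  then have "real (Suc (m - k)) powr (\<gamma> - 1) * real (Suc m) powr - \<gamma> \<le> 1 * real (Suc m) powr - \<gamma>"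
    by (intro mult_right_mono) auto
  then show ?thesis using cesaro_weight_le[OF assms True] by linarith
qed (simp add: cesaro_weight_def)

lemma cesaro_weight_tendsto_0:
  assumes "0 < \<gamma>" "\<gamma> \<le> 1"
  shows "(\<lambda>m. cesaro_weight \<gamma> m k) \<longlonglongrightarrow> 0"
proof (rule tendsto_sandwich[OF _ _ tendsto_const])
  show "(\<lambda>m. real (Suc m) powr - \<gamma>) \<longlonglongrightarrow> 0"
    using assms by (intro tendsto_neg_powr filterlim_compose[OF filterlim_real_sequentially filterlim_Suc]) auto
qed (use assms in \<open>auto simp del: of_nat_Suc intro!: always_eventually cesaro_weight_nonneg cesaro_weight_le_powr\<close>)

text \<open>Of the s factors, s - 1 are bounded by the largest weight, and the remaining weights sum
  to 1. This is the estimate for the variances, where s is at most 2.\<close>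

lemma sum_cesaro_weight_powr_le:
  assumes "0 < \<gamma>" "\<gamma> \<le> 1" "1 \<le> s"
  shows "(\<Sum>k\<le>m. cesaro_weight \<gamma> m k powr s) \<le> real (Suc m) powr (- \<gamma> * (s - 1))"
proof -
  have "cesaro_weight \<gamma> m k powr s \<le> real (Suc m) powr (- \<gamma> * (s - 1)) * cesaro_weight \<gamma> m k" for k
  proof -
    have "cesaro_weight \<gamma> m k powr s = cesaro_weight \<gamma> m k powr (s - 1) * cesaro_weight \<gamma> m k"
      using assms cesaro_weight_nonneg[of \<gamma> m k] powr_add[of "cesaro_weight \<gamma> m k" "s - 1" 1] by simp
    also have "\<dots> \<le> (real (Suc m) powr - \<gamma>) powr (s - 1) * cesaro_weight \<gamma> m k"
      using assms by (intro mult_right_mono powr_mono2 cesaro_weight_le_powr cesaro_weight_nonneg) auto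
    finally show ?thesis by (simp add: powr_powr)
  qed
  then have "(\<Sum>k\<le>m. cesaro_weight \<gamma> m k powr s) \<le>
      (\<Sum>k\<le>m. real (Suc m) powr (- \<gamma> * (s - 1)) * cesaro_weight \<gamma> m k)"
    by (intro sum_mono)
  also have "\<dots> = real (Suc m) powr (- \<gamma> * (s - 1))"
    using assms by (simp add: sum_distrib_left[symmetric] sum_cesaro_weight)
  finally show ?thesis .
qed

text \<open>For large s the sum is dominated by the indices near m: the series over j = m - k of (j
  + 1)^((\<gamma> - 1)s) converges, so the whole sum is of the order of its largest term. This gains
  a factor m^(-\<gamma>) over \<open>sum_cesaro_weight_powr_le\<close>.\<close>

lemma sum_cesaro_weight_powr_le':
  assumes "0 < \<gamma>" "\<gamma> < 1" "(1 - \<gamma>) * s > 1"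
  obtains K where "\<And>m. (\<Sum>k\<le>m. cesaro_weight \<gamma> m k powr s) \<le> K * real (Suc m) powr (- \<gamma> * s)"
proof
  have "s > 0" using assms by (smt (verit) mult_nonneg_nonpos)
  have summ: "summable (\<lambda>j. real (Suc j) powr ((\<gamma> - 1) * s))"
  proof -
    have "(\<gamma> - 1) * s < -1" using assms by (simp add: algebra_simps)
    then have "summable (\<lambda>j. real j powr ((\<gamma> - 1) * s))"
      by (simp add: summable_real_powr_iff)
    then show ?thesis by (subst summable_Suc_iff)
  qed
  fix m
  have "(\<Sum>k\<le>m. cesaro_weight \<gamma> m k powr s) \<le>
     (\<Sum>k\<le>m. real (Suc (m - k)) powr ((\<gamma> - 1) * s) * real (Suc m) powr (- \<gamma> * s))"
  proof (intro sum_mono)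
    fix k assume "k \<in> {..m}"
    then have "cesaro_weight \<gamma> m k powr s \<le> (real (Suc (m - k)) powr (\<gamma> - 1) * real (Suc m) powr - \<gamma>) powr s"
      using assms \<open>s > 0\<close> by (intro powr_mono2 cesaro_weight_le cesaro_weight_nonneg) auto
    then show "cesaro_weight \<gamma> m k powr s \<le> real (Suc (m - k)) powr ((\<gamma> - 1) * s) * real (Suc m) powr (- \<gamma> * s)"
      by (simp add: powr_mult powr_powr)
  qed
  also have "\<dots> = (\<Sum>k\<le>m. real (Suc (m - k)) powr ((\<gamma> - 1) * s)) * real (Suc m) powr (- \<gamma> * s)"
    by (simp add: sum_distrib_right)
  also have "(\<Sum>k\<le>m. real (Suc (m - k)) powr ((\<gamma> - 1) * s)) = (\<Sum>j\<le>m. real (Suc j) powr ((\<gamma> - 1) * s))"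
    by (rule sum.reindex_bij_witness[of _ "\<lambda>k. m - k" "\<lambda>k. m - k"]) auto
  also have "\<dots> \<le> (\<Sum>j. real (Suc j) powr ((\<gamma> - 1) * s))"
    by (rule sum_le_suminf[OF summ]) auto
  finally show "(\<Sum>k\<le>m. cesaro_weight \<gamma> m k powr s) \<le>
     (\<Sum>j. real (Suc j) powr ((\<gamma> - 1) * s)) * real (Suc m) powr (- \<gamma> * s)"
    by (simp add: mult_right_mono)
qed


section \<open>Sampled indices and their weights\<close>

lemma sum_geometric_le_threshold:
  fixes \<rho> z :: real
  assumes "\<rho> > 1" "z \<ge> 0"
  shows "(\<Sum>i<N. if \<rho> ^ i \<le> z then \<rho> ^ i else 0) \<le> \<rho> / (\<rho> - 1) * z"
proof (induction N)
  case (Suc N)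
  show ?case
  proof (cases "\<rho> ^ N \<le> z")
    case True
    have "(\<Sum>i<Suc N. if \<rho> ^ i \<le> z then \<rho> ^ i else 0) \<le> (\<Sum>i<Suc N. \<rho> ^ i)"
      using assms by (intro sum_mono) auto
    also have "\<dots> = (\<rho> ^ Suc N - 1) / (\<rho> - 1)"
      using assms by (subst geometric_sum) auto
    also have "\<dots> \<le> \<rho> / (\<rho> - 1) * \<rho> ^ N"
      using assms by (simp add: divide_right_mono)
    also have "\<dots> \<le> \<rho> / (\<rho> - 1) * z"
      using assms True by (intro mult_left_mono) auto
    finally show ?thesis .
  qed (use Suc in simp)
qed (use assms in simp)

lemma sum_if_Suc_le:
  fixes z :: real
  assumes "z \<ge> 0"
  shows "(\<Sum>i<N. if real (Suc i) \<le> z then 1 else 0) \<le> 1 * z"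
proof -
  have "{i. i < N \<and> real (Suc i) \<le> z} \<subseteq> {..<nat \<lfloor>z\<rfloor>}"
    by (auto simp: less_eq_Suc_le le_nat_floor simp del: of_nat_Suc)
  then have "card {i. i < N \<and> real (Suc i) \<le> z} \<le> nat \<lfloor>z\<rfloor>"
    by (metis card_lessThan card_mono finite_lessThan)
  moreover have "(\<Sum>i<N. if real (Suc i) \<le> z then 1 else 0) = real (card {i. i < N \<and> real (Suc i) \<le> z})"
    by (simp add: sum.If_cases Collect_conj_eq lessThan_def del: of_nat_Suc)
  ultimately show ?thesis using assms by (simp del: of_nat_Suc) linarith
qed

text \<open>For order below 1 every index is sampled. For order 1 the sampled indices grow
  geometrically; each carries the weight of the block that it represents, so that the
  same counting estimate holds in both cases.\<close>

definition cesaro_sampling ::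
    "real \<Rightarrow> real \<Rightarrow> (nat \<Rightarrow> nat) \<Rightarrow> (nat \<Rightarrow> real) \<Rightarrow> real \<Rightarrow> bool" where
  "cesaro_sampling \<gamma> \<theta> e \<phi> C \<longleftrightarrow>
     filterlim e at_top sequentially \<and> (\<forall>i. \<phi> i \<ge> 1) \<and>
     (\<forall>z N. z \<ge> 0 \<longrightarrow> (\<Sum>i<N. if real (Suc (e i)) \<le> z then \<phi> i else 0) \<le> C * z) \<and>
     (\<forall>s. \<gamma> = 1 \<or> (1 - \<gamma>) * s > 1 \<longrightarrow>
       (\<exists>K. \<forall>i. (\<Sum>k\<le>e i. cesaro_weight \<gamma> (e i) k powr s) \<le> K * \<phi> i * real (Suc (e i)) powr (- \<gamma> * s))) \<and>
     (\<forall>I. \<forall>\<^sub>F m in sequentially. \<exists>i\<ge>I. \<exists>j\<ge>I.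
       (\<forall>k. cesaro_weight \<gamma> (e i) k \<le> \<theta> * cesaro_weight \<gamma> m k) \<and>
       (\<forall>k. cesaro_weight \<gamma> m k \<le> \<theta> * cesaro_weight \<gamma> (e j) k))"

text \<open>Bridging a gap needs the weights at neighbouring sampled indices to dominate each other
  up to the factor \<theta>. For order 1 they are constant in k, so a ratio of lengths below
  \<theta> is enough. For smaller order the weight at k = m drops substantially as soon as m is
  increased, so every index is kept.\<close>

lemma cesaro_sampling_exists:
  assumes "0 < \<gamma>" "\<gamma> \<le> 1" "\<theta> > 1"
  obtains e \<phi> C where "cesaro_sampling \<gamma> \<theta> e \<phi> C"
proof (cases "\<gamma> = 1")
  case False
  have "cesaro_sampling \<gamma> \<theta> id (\<lambda>_. 1) 1"
    unfolding cesaro_sampling_def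
  proof (intro conjI allI impI)
    fix s assume "\<gamma> = 1 \<or> (1 - \<gamma>) * s > 1"
    then have "(1 - \<gamma>) * s > 1" using False by simp
    then obtain K where "\<And>m. (\<Sum>k\<le>m. cesaro_weight \<gamma> m k powr s) \<le> K * real (Suc m) powr (- \<gamma> * s)"
      using sum_cesaro_weight_powr_le'[of \<gamma> s] assms False by (metis less_le)
    then show "\<exists>K. \<forall>i. (\<Sum>k\<le>id i. cesaro_weight \<gamma> (id i) k powr s) \<le> K * 1 * real (Suc (id i)) powr (- \<gamma> * s)"
      by (metis id_apply mult_1_right)
  next
    fix I
    have dominated: "cesaro_weight \<gamma> m k \<le> \<theta> * cesaro_weight \<gamma> m k" for m k
      using mult_right_mono[of 1 \<theta> "cesaro_weight \<gamma> m k"] assms cesaro_weight_nonneg[of \<gamma> m k] by simp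
    show "\<forall>\<^sub>F m in sequentially. \<exists>i\<ge>I. \<exists>j\<ge>I.
       (\<forall>k. cesaro_weight \<gamma> (id i) k \<le> \<theta> * cesaro_weight \<gamma> m k) \<and>
       (\<forall>k. cesaro_weight \<gamma> m k \<le> \<theta> * cesaro_weight \<gamma> (id j) k)"
    proof (rule eventually_mono[OF eventually_ge_at_top[of I]])
      fix m assume "I \<le> m"
      then show "\<exists>i\<ge>I. \<exists>j\<ge>I. (\<forall>k. cesaro_weight \<gamma> (id i) k \<le> \<theta> * cesaro_weight \<gamma> m k) \<and>
          (\<forall>k. cesaro_weight \<gamma> m k \<le> \<theta> * cesaro_weight \<gamma> (id j) k)"
        unfolding id_apply using dominated by blast
    qed
  next
    fix z :: real and N assume "z \<ge> 0"
    then show "(\<Sum>i<N. if real (Suc (id i)) \<le> z then 1 else 0) \<le> 1 * z"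
      unfolding id_apply by (rule sum_if_Suc_le)
  qed (simp_all add: id_def filterlim_ident)
  then show ?thesis using that by blast
next
  case True
  \<comment> \<open>A ratio strictly between 1 and \<theta>: rounding up adds at most 1 to a length,
    and the slack \<theta> - \<rho> absorbs this once m \<ge> 1/(\<theta> - \<rho>).\<close>
  define \<rho> where "\<rho> = (1 + \<theta>) / 2"
  have \<rho>: "\<rho> > 1" "\<rho> < \<theta>" using assms by (auto simp: \<rho>_def)
  \<comment> \<open>Shifted so that \<open>Suc (e i)\<close>, the number of terms in the mean, is
    the rounded power; the natural subtraction is exact because the ceiling is at least 1.\<close>
  define e where "e i = nat \<lceil>\<rho> ^ i\<rceil> - 1" for i
  have pow1: "\<rho> ^ i \<ge> 1" for i using \<rho> by simp
  have Suc_e: "real (Suc (e i)) = of_int \<lceil>\<rho> ^ i\<rceil>" for i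
  proof -
    have "\<lceil>\<rho> ^ i\<rceil> \<ge> 1" using pow1[of i] by linarith
    then show ?thesis by (simp add: e_def)
  qed
  have e_ge: "\<rho> ^ i \<le> real (Suc (e i))" and e_le: "real (Suc (e i)) \<le> \<rho> ^ i + 1" for i
    unfolding Suc_e by linarith+
  have e_iff: "e i \<le> m \<longleftrightarrow> \<rho> ^ i \<le> real (Suc m)" for i m
  proof -
    have "e i \<le> m \<longleftrightarrow> real (Suc (e i)) \<le> real (Suc m)" by simp
    also have "\<dots> \<longleftrightarrow> \<rho> ^ i \<le> real (Suc m)" unfolding Suc_e
      by (metis ceiling_le_iff of_int_le_iff of_int_of_nat_eq)
    finally show ?thesis .
  qed
  have "cesaro_sampling \<gamma> \<theta> e (\<lambda>i. real (Suc (e i))) (2 * (\<rho> / (\<rho> - 1)))"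
    unfolding cesaro_sampling_def
  proof (intro conjI allI impI)
    fix z :: real and N assume "z \<ge> 0"
    \<comment> \<open>The factor 2 pays for the rounding, as \<rho>^i + 1 \<le> 2 \<rho>^i.\<close>
    have "(\<Sum>i<N. if real (Suc (e i)) \<le> z then real (Suc (e i)) else 0) \<le>
          (\<Sum>i<N. 2 * (if \<rho> ^ i \<le> z then \<rho> ^ i else 0))"
    proof (intro sum_mono)
      fix i
      show "(if real (Suc (e i)) \<le> z then real (Suc (e i)) else 0) \<le> 2 * (if \<rho> ^ i \<le> z then \<rho> ^ i else 0)"
        using e_ge[of i] e_le[of i] pow1[of i] by (auto simp del: of_nat_Suc)
    qed
    also have "\<dots> \<le> 2 * (\<rho> / (\<rho> - 1) * z)"
      unfolding sum_distrib_left[symmetric]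
      using sum_geometric_le_threshold[OF \<rho>(1) \<open>z \<ge> 0\<close>, of N] by simp
    finally show "(\<Sum>i<N. if real (Suc (e i)) \<le> z then real (Suc (e i)) else 0) \<le> 2 * (\<rho> / (\<rho> - 1)) * z"
      by simp
  next
    fix s
    \<comment> \<open>With flat weights the sum is exactly (m + 1)^(1 - s); the surplus factor m + 1
      is what the choice of \<phi> as block length accounts for.\<close>
    have "(\<Sum>k\<le>m. cesaro_weight 1 m k powr s) = 1 * real (Suc m) * real (Suc m) powr (- 1 * s)" for m
    proof -
      have "(\<Sum>k\<le>m. cesaro_weight 1 m k powr s) = (\<Sum>k\<le>m. real (Suc m) powr - s)"
        by (intro sum.cong) (auto simp: cesaro_weight_one powr_divide powr_minus_divide)
      then show ?thesis by simp
    qed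
    then show "\<exists>K. \<forall>i. (\<Sum>k\<le>e i. cesaro_weight \<gamma> (e i) k powr s) \<le>
        K * real (Suc (e i)) * real (Suc (e i)) powr (- \<gamma> * s)"
      unfolding True by (metis order_refl)
  next
    fix I
    have "\<forall>\<^sub>F m in sequentially. \<rho> ^ I \<le> real m \<and> 1 / (\<theta> - \<rho>) \<le> real m"
      by (intro eventually_conj filterlim_at_top[THEN iffD1, OF filterlim_real_sequentially, rule_format])
    then show "\<forall>\<^sub>F m in sequentially. \<exists>i\<ge>I. \<exists>j\<ge>I.
       (\<forall>k. cesaro_weight \<gamma> (e i) k \<le> \<theta> * cesaro_weight \<gamma> m k) \<and>
       (\<forall>k. cesaro_weight \<gamma> m k \<le> \<theta> * cesaro_weight \<gamma> (e j) k)"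
    proof eventually_elim
      case (elim m)
      obtain n where n: "real (Suc m) < \<rho> ^ n" using real_arch_pow[OF \<rho>(1)] by blast
      \<comment> \<open>The least power exceeding m + 1 and its predecessor enclose m between two
        consecutive sampled indices.\<close>
      define j where "j = (LEAST j. real (Suc m) < \<rho> ^ j)"
      have j: "real (Suc m) < \<rho> ^ j" unfolding j_def by (rule LeastI[of _ n]) (rule n)
      then have "j \<noteq> 0" by (intro notI) simp
      then obtain i where i: "j = Suc i" using not0_implies_Suc by blast
      have "\<not> real (Suc m) < \<rho> ^ i" using not_less_Least[of i "\<lambda>j. real (Suc m) < \<rho> ^ j"] i
        by (simp add: j_def)
      then have i_le: "\<rho> ^ i \<le> real (Suc m)" by simp
      have "\<rho> ^ I < \<rho> ^ j" using elim j by simp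
      then have "I < j" using \<rho> by simp
      have "e i \<le> m" using i_le e_iff by simp
      moreover have "m \<le> e j" using e_iff[of j m] j by linarith
      moreover have "real (Suc m) \<le> \<theta> * real (Suc (e i))"
      proof -
        have "real (Suc m) \<le> \<rho> * \<rho> ^ i" using j i by simp
        also have "\<dots> \<le> \<theta> * real (Suc (e i))" using \<rho> e_ge[of i] by (intro mult_mono) auto
        finally show ?thesis .
      qed
      moreover have "real (Suc (e j)) \<le> \<theta> * real (Suc m)"
      proof -
        have "real (Suc (e j)) \<le> \<rho> * \<rho> ^ i + 1" using e_le[of j] i by simp
        also have "\<dots> \<le> \<rho> * real (Suc m) + (\<theta> - \<rho>) * real (Suc m)"
        proof (intro add_mono mult_left_mono i_le)
          have "1 / (\<theta> - \<rho>) \<le> real (Suc m)" using elim by simp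
          then show "1 \<le> (\<theta> - \<rho>) * real (Suc m)" using \<rho> by (simp add: divide_le_eq mult.commute)
        qed (use \<rho> in auto)
        finally show ?thesis by (simp add: algebra_simps)
      qed
      ultimately have "(\<forall>k. cesaro_weight \<gamma> (e i) k \<le> \<theta> * cesaro_weight \<gamma> m k) \<and>
          (\<forall>k. cesaro_weight \<gamma> m k \<le> \<theta> * cesaro_weight \<gamma> (e j) k)"
        unfolding True cesaro_weight_one using assms(3)
        by (auto simp: field_simps simp del: of_nat_Suc)
      moreover have "i \<ge> I" "j \<ge> I" using \<open>I < j\<close> i by auto
      ultimately show ?case by blast
    qed
  next
    show "filterlim e at_top sequentially"
      unfolding filterlim_at_top eventually_sequentially
    proof
      fix Z
      obtain n where n: "real (Suc Z) < \<rho> ^ n" using real_arch_pow[OF \<rho>(1)] by blast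
      have "Z \<le> e i" if "n \<le> i" for i
      proof -
        have "real (Suc Z) < real (Suc (e i))"
          using n power_increasing[OF that, of \<rho>] \<rho> e_ge[of i] by linarith
        then show ?thesis by simp
      qed
      then show "\<exists>N. \<forall>i\<ge>N. Z \<le> e i" by blast
    qed
  qed auto
  then show ?thesis using that by blast
qed

section \<open>Counting sums over growing sequences\<close>

abbreviation counting :: "'i measure" where "counting \<equiv> count_space UNIV"

text \<open>A single term of the series suffices, that of the least s with u \<le> 2^(s+1) z: for s
  > 0 minimality gives z/u < 2^(-s), for s = 0 the minimum is at most 1. Power decay is thereby
  reduced to counting below dyadic thresholds.\<close>

lemma min_powr_le_dyadic_suminf:
  fixes u z \<kappa> :: real
  assumes "u > 0" "z > 0" "\<kappa> > 0"
  shows "ennreal (min 1 ((z / u) powr \<kappa>)) \<le>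
    (\<Sum>s. ennreal ((1 / 2 ^ s) powr \<kappa>) * indicator {..z * 2 ^ Suc s} u)"
    (is "_ \<le> (\<Sum>s. ?f s)")
proof -
  obtain n where "u / z < 2 ^ n" using real_arch_pow[of 2 "u / z"] by auto
  also have "\<dots> \<le> (2 :: real) ^ Suc n" by simp
  finally have n: "u \<le> z * 2 ^ Suc n" using assms by (simp add: field_simps)
  define s where "s = (LEAST s. u \<le> z * 2 ^ Suc s)"
  have s: "u \<le> z * 2 ^ Suc s" unfolding s_def by (rule LeastI[of _ n]) (rule n)
  have "min 1 ((z / u) powr \<kappa>) \<le> (1 / 2 ^ s) powr \<kappa>"
  proof (cases s)
    case (Suc t)
    then have "\<not> u \<le> z * 2 ^ Suc t"
      using not_less_Least[of t "\<lambda>s. u \<le> z * 2 ^ Suc s"] by (simp add: s_def)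
    then have "z / u \<le> 1 / 2 ^ s" using assms Suc by (simp add: field_simps)
    then have "(z / u) powr \<kappa> \<le> (1 / 2 ^ s) powr \<kappa>"
      using assms by (intro powr_mono2) auto
    then show ?thesis by simp
  qed simp
  then have "ennreal (min 1 ((z / u) powr \<kappa>)) \<le> ?f s"
    using s by (simp add: ennreal_leI)
  also have "g s \<le> suminf g" for g :: "nat \<Rightarrow> ennreal"
    using sum_le_suminf[of g "{s}"] by simp
  finally show ?thesis .
qed

text \<open>Masses \<phi> i placed at the points u i have a distribution function of at most linear
  growth, like the counting measure of the positive integers. Full and geometric sampling are two
  instances, so each counting sum is estimated once for both.\<close>

locale linear_growth =
  fixes u \<phi> :: "nat \<Rightarrow> real" and C :: real
  assumes u_ge_1: "u i \<ge> 1"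
    and \<phi>_nonneg: "\<phi> i \<ge> 0"
    and count: "z \<ge> 0 \<Longrightarrow> (\<Sum>i<N. if u i \<le> z then \<phi> i else 0) \<le> C * z"
begin

lemma C_nonneg: "C \<ge> 0"
  using count[of 1 0] by simp

lemma nn_integral_count:
  assumes "z \<ge> 0"
  shows "(\<integral>\<^sup>+i. ennreal (\<phi> i) * indicator {..z} (u i) \<partial>counting) \<le> ennreal (C * z)"
proof -
  have "(\<Sum>i<N. ennreal (\<phi> i) * indicator {..z} (u i)) \<le> ennreal (C * z)" for N
  proof -
    have "(\<Sum>i<N. ennreal (\<phi> i) * indicator {..z} (u i)) = (\<Sum>i<N. ennreal (if u i \<le> z then \<phi> i else 0))"
      by (intro sum.cong) auto
    also have "\<dots> = ennreal (\<Sum>i<N. if u i \<le> z then \<phi> i else 0)"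
      by (rule sum_ennreal) (simp add: \<phi>_nonneg)
    also have "\<dots> \<le> ennreal (C * z)"
      by (intro ennreal_leI count assms)
    finally show ?thesis .
  qed
  then show ?thesis
    by (simp add: nn_integral_count_space_nat suminf_eq_SUP SUP_least)
qed

text \<open>The mass below 2^(s+1) z is at most C 2^(s+1) z and is met with the factor
  2^(-s\<kappa>); the resulting geometric series has ratio 2^(1-\<kappa>) < 1.\<close>

lemma nn_integral_min_powr:
  assumes "\<kappa> > 1"
  obtains K where "K \<ge> 0"
    "\<And>z. z \<ge> 0 \<Longrightarrow> (\<integral>\<^sup>+i. ennreal (\<phi> i * min 1 ((z / u i) powr \<kappa>)) \<partial>counting) \<le> ennreal (K * z)"
proof
  let ?q = "2 powr (1 - \<kappa>) :: real"
  have q: "0 < ?q" "?q < 1" using assms by (auto simp: powr_less_one)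
  show "2 * C * (1 / (1 - ?q)) \<ge> 0" using q C_nonneg by simp
  fix z :: real assume "z \<ge> 0"
  show "(\<integral>\<^sup>+i. ennreal (\<phi> i * min 1 ((z / u i) powr \<kappa>)) \<partial>counting) \<le>
      ennreal (2 * C * (1 / (1 - ?q)) * z)"
  proof (cases "z = 0")
    case True
    then show ?thesis by simp
  next
    case False
    then have z: "z > 0" using \<open>z \<ge> 0\<close> by simp
    have "(\<integral>\<^sup>+i. ennreal (\<phi> i * min 1 ((z / u i) powr \<kappa>)) \<partial>counting) \<le>
      (\<integral>\<^sup>+i. (\<Sum>s. ennreal ((1 / 2 ^ s) powr \<kappa>) * (ennreal (\<phi> i) * indicator {..z * 2 ^ Suc s} (u i))) \<partial>counting)"
    proof (intro nn_integral_mono)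
      fix i
      have "ennreal (\<phi> i * min 1 ((z / u i) powr \<kappa>)) = ennreal (\<phi> i) * ennreal (min 1 ((z / u i) powr \<kappa>))"
        by (simp add: ennreal_mult' \<phi>_nonneg)
      also have "\<dots> \<le> ennreal (\<phi> i) * (\<Sum>s. ennreal ((1 / 2 ^ s) powr \<kappa>) * indicator {..z * 2 ^ Suc s} (u i))"
        using z assms less_le_trans[OF zero_less_one u_ge_1[of i]]
        by (intro mult_left_mono min_powr_le_dyadic_suminf) auto
      also have "\<dots> = (\<Sum>s. ennreal (\<phi> i) * (ennreal ((1 / 2 ^ s) powr \<kappa>) * indicator {..z * 2 ^ Suc s} (u i)))"
        by simp
      also have "\<dots> = (\<Sum>s. ennreal ((1 / 2 ^ s) powr \<kappa>) * (ennreal (\<phi> i) * indicator {..z * 2 ^ Suc s} (u i)))"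
        by (simp add: mult_ac)
      finally show "ennreal (\<phi> i * min 1 ((z / u i) powr \<kappa>)) \<le>
        (\<Sum>s. ennreal ((1 / 2 ^ s) powr \<kappa>) * (ennreal (\<phi> i) * indicator {..z * 2 ^ Suc s} (u i)))" .
    qed
    also have "\<dots> = (\<Sum>s. ennreal ((1 / 2 ^ s) powr \<kappa>) *
        (\<integral>\<^sup>+i. ennreal (\<phi> i) * indicator {..z * 2 ^ Suc s} (u i) \<partial>counting))"
      by (subst nn_integral_suminf) (auto simp: nn_integral_cmult)
    also have "\<dots> \<le> (\<Sum>s. ennreal (2 * C * z * ?q ^ s))"
    proof (intro suminf_le allI)
      fix s :: nat
      have "ennreal ((1 / 2 ^ s) powr \<kappa>) *
          (\<integral>\<^sup>+i. ennreal (\<phi> i) * indicator {..z * 2 ^ Suc s} (u i) \<partial>counting) \<le>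
          ennreal ((1 / 2 ^ s) powr \<kappa>) * ennreal (C * (z * 2 ^ Suc s))"
        using z by (intro mult_left_mono nn_integral_count) auto
      also have "\<dots> = ennreal ((1 / 2 ^ s) powr \<kappa> * (C * (z * 2 ^ Suc s)))"
        using z C_nonneg by (intro ennreal_mult[symmetric]) auto
      also have "(1 / 2 ^ s) powr \<kappa> * (C * (z * 2 ^ Suc s)) = 2 * C * z * ?q ^ s"
      proof -
        have "(1 / 2 ^ s) powr \<kappa> * 2 ^ s = ?q ^ s"
          by (simp add: powr_divide powr_realpow[symmetric] powr_powr powr_add[symmetric]
              powr_minus_divide[symmetric] powr_diff algebra_simps)
        then show ?thesis by (simp add: algebra_simps)
      qed
      finally show "ennreal ((1 / 2 ^ s) powr \<kappa>) *
          (\<integral>\<^sup>+i. ennreal (\<phi> i) * indicator {..z * 2 ^ Suc s} (u i) \<partial>counting) \<le> ennreal (2 * C * z * ?q ^ s)" .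
    qed auto
    also have "\<dots> = ennreal (\<Sum>s. 2 * C * z * ?q ^ s)"
      using z C_nonneg q by (intro suminf_ennreal2) auto
    also have "(\<Sum>s. 2 * C * z * ?q ^ s) = 2 * C * (1 / (1 - ?q)) * z"
      using q by (subst suminf_mult) (auto simp: suminf_geometric)
    finally show ?thesis .
  qed
qed

lemma nn_integral_powr:
  assumes "\<kappa> > 1"
  obtains K where "K \<ge> 0"
    "(\<integral>\<^sup>+i. ennreal (\<phi> i * u i powr - \<kappa>) \<partial>counting) \<le> ennreal K"
proof -
  obtain K where K: "K \<ge> 0"
    "\<And>z. z \<ge> 0 \<Longrightarrow> (\<integral>\<^sup>+i. ennreal (\<phi> i * min 1 ((z / u i) powr \<kappa>)) \<partial>counting) \<le> ennreal (K * z)"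
    using nn_integral_min_powr[OF assms] by blast
  have "min 1 ((1 / u i) powr \<kappa>) = u i powr - \<kappa>" for i
  proof -
    have "(1 / u i) powr \<kappa> \<le> 1" using assms u_ge_1[of i] by (intro powr_le1) auto
    moreover have "(1 / u i) powr \<kappa> = u i powr - \<kappa>"
      by (simp add: powr_divide powr_minus_divide)
    ultimately show ?thesis by simp
  qed
  then show ?thesis using that[OF K(1)] K(2)[of 1] by simp
qed

text \<open>The analogue of the harmonic sum and the source of the logarithm: each dyadic shell
  contributes at most 2C, and about log_2 z shells lie below z.\<close>

lemma nn_integral_reciprocal:
  assumes "z \<ge> 1"
  shows "(\<integral>\<^sup>+i. ennreal (\<phi> i / u i) * indicator {..z} (u i) \<partial>counting) \<le> ennreal (2 * C * (1 + log 2 z))"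
proof -
  define S where "S = Suc (nat \<lfloor>log 2 z\<rfloor>)"
  have "(\<integral>\<^sup>+i. ennreal (\<phi> i / u i) * indicator {..z} (u i) \<partial>counting) \<le>
    (\<integral>\<^sup>+i. (\<Sum>s<S. ennreal (1 / 2 ^ s) * (ennreal (\<phi> i) * indicator {..2 ^ Suc s} (u i))) \<partial>counting)"
  proof (intro nn_integral_mono)
    fix i
    let ?f = "\<lambda>s. ennreal (1 / 2 ^ s) * (ennreal (\<phi> i) * indicator {..2 ^ Suc s} (u i))"
    show "ennreal (\<phi> i / u i) * indicator {..z} (u i) \<le> sum ?f {..<S}"
    proof (cases "u i \<le> z")
      case True
      define s where "s = nat \<lfloor>log 2 (u i)\<rfloor>"
      have u: "u i \<ge> 1" by (rule u_ge_1)
      have "real s \<le> log 2 (u i)" "log 2 (u i) \<le> real (Suc s)"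
        using u unfolding s_def by (simp_all, linarith?)
      then have "2 powr real s \<le> u i" "u i \<le> 2 powr real (Suc s)"
        using u by (auto simp: le_log_iff log_le_iff simp del: of_nat_Suc)
      then have s: "2 ^ s \<le> u i" "u i \<le> 2 ^ Suc s"
        by (auto simp: powr_realpow simp del: of_nat_Suc power_Suc)
      have "s \<in> {..<S}" using True u assms by (auto simp: s_def S_def less_Suc_eq_le intro!: nat_mono floor_mono)
      have "\<phi> i / u i \<le> 1 / 2 ^ s * \<phi> i"
        using s u \<phi>_nonneg[of i] by (simp add: frac_le)
      then have "ennreal (\<phi> i / u i) * indicator {..z} (u i) \<le> ?f s"
        using s True \<phi>_nonneg[of i] by (simp add: ennreal_leI flip: ennreal_mult)
      also have "\<dots> \<le> sum ?f {..<S}"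
        by (rule member_le_sum[OF \<open>s \<in> {..<S}\<close>]) auto
      finally show ?thesis .
    qed simp
  qed
  also have "\<dots> = (\<Sum>s<S. ennreal (1 / 2 ^ s) *
      (\<integral>\<^sup>+i. ennreal (\<phi> i) * indicator {..2 ^ Suc s} (u i) \<partial>counting))"
    by (subst nn_integral_sum) (auto simp: nn_integral_cmult)
  also have "\<dots> \<le> (\<Sum>s<S. ennreal (2 * C))"
  proof (intro sum_mono)
    fix s :: nat
    have "ennreal (1 / 2 ^ s) * (\<integral>\<^sup>+i. ennreal (\<phi> i) * indicator {..2 ^ Suc s} (u i) \<partial>counting) \<le>
      ennreal (1 / 2 ^ s) * ennreal (C * 2 ^ Suc s)"
      by (intro mult_left_mono nn_integral_count) auto
    also have "\<dots> = ennreal (2 * C)"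
      using C_nonneg by (simp flip: ennreal_mult)
    finally show "ennreal (1 / 2 ^ s) * (\<integral>\<^sup>+i. ennreal (\<phi> i) * indicator {..2 ^ Suc s} (u i) \<partial>counting) \<le>
      ennreal (2 * C)" .
  qed
  also have "\<dots> = ennreal (2 * C * real S)"
    using C_nonneg by (simp add: ennreal_of_nat_eq_real_of_nat ennreal_mult mult.commute)
  also have "\<dots> \<le> ennreal (2 * C * (1 + log 2 z))"
  proof (intro ennreal_leI mult_left_mono)
    have "log 2 z \<ge> 0" using assms by simp
    then show "real S \<le> 1 + log 2 z" unfolding S_def by simp
  qed (use C_nonneg in auto)
  finally show ?thesis .
qed

end

text \<open>For fixed j the sum over i is a counting sum with threshold w = (x /
  v^\<beta>)^(1/\<alpha>), hence at most K w = K x^(1/\<alpha>) v^(-\<beta>/\<alpha>). If \<alpha> <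
  \<beta> this is summable over j. If \<alpha> = \<beta> it is of order 1/v and is used only for v
  \<le> x^(1/\<alpha>), giving the logarithm; beyond that point w < 1, and the faster decay in
  \<open>tail\<close> takes over.\<close>

lemma double_count_bound:
  assumes U: "linear_growth u \<phi> C" and V: "linear_growth v \<psi> D"
    and "0 < \<alpha>" "\<alpha> \<le> \<beta>" "\<alpha> * r > 1"
  obtains K where "K \<ge> 0"
    "\<And>x. x \<ge> 0 \<Longrightarrow>
      (\<integral>\<^sup>+j. \<integral>\<^sup>+i. ennreal (\<phi> i * \<psi> j * min 1 ((x / (u i powr \<alpha> * v j powr \<beta>)) powr r)) \<partial>counting \<partial>counting)
      \<le> ennreal (K * (x powr (1 / \<alpha>) * (if \<alpha> = \<beta> then log_plus x else 1)))"
proof -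
  interpret U: linear_growth u \<phi> C by (rule U)
  interpret V: linear_growth v \<psi> D by (rule V)
  define \<kappa> where "\<kappa> = \<alpha> * r"
  have \<kappa>: "\<kappa> > 1" using assms by (simp add: \<kappa>_def)
  obtain K where K: "K \<ge> 0"
    "\<And>z. z \<ge> 0 \<Longrightarrow> (\<integral>\<^sup>+i. ennreal (\<phi> i * min 1 ((z / u i) powr \<kappa>)) \<partial>counting) \<le> ennreal (K * z)"
    using U.nn_integral_min_powr[OF \<kappa>] by blast
  have u: "u i > 0" and v: "v i > 0" for i
    using U.u_ge_1[of i] V.u_ge_1[of i] by linarith+
  define w where "w j x = (x / v j powr \<beta>) powr (1 / \<alpha>)" for j x
  have w_eq: "w j x = x powr (1 / \<alpha>) * v j powr - (\<beta> / \<alpha>)" if "x \<ge> 0" for j x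
    using that assms v[of j] by (simp add: w_def powr_divide powr_powr powr_minus_divide)
  have pow_eq: "(x / (u i powr \<alpha> * v j powr \<beta>)) powr r = (w j x / u i) powr \<kappa>" if "x \<ge> 0" for x i j
    using that assms u[of i] v[of j]
    by (simp add: w_def \<kappa>_def powr_divide powr_powr powr_mult field_simps)
  have inner: "(\<integral>\<^sup>+i. ennreal (\<phi> i * \<psi> j * min 1 ((x / (u i powr \<alpha> * v j powr \<beta>)) powr r)) \<partial>counting)
     = ennreal (\<psi> j) * (\<integral>\<^sup>+i. ennreal (\<phi> i * min 1 ((w j x / u i) powr \<kappa>)) \<partial>counting)"
    if "x \<ge> 0" for x j
  proof -
    have "(\<integral>\<^sup>+i. ennreal (\<phi> i * \<psi> j * min 1 ((x / (u i powr \<alpha> * v j powr \<beta>)) powr r)) \<partial>counting)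
      = (\<integral>\<^sup>+i. ennreal (\<psi> j) * ennreal (\<phi> i * min 1 ((w j x / u i) powr \<kappa>)) \<partial>counting)"
      using that by (intro nn_integral_cong)
        (simp add: pow_eq V.\<phi>_nonneg mult_ac flip: ennreal_mult')
    then show ?thesis by (simp add: nn_integral_cmult)
  qed
  show ?thesis
  proof (cases "\<alpha> = \<beta>")
    case False
    then have "\<beta> / \<alpha> > 1" using assms by simp
    then obtain L where L: "L \<ge> 0"
      "(\<integral>\<^sup>+j. ennreal (\<psi> j * v j powr - (\<beta> / \<alpha>)) \<partial>counting) \<le> ennreal L"
      using V.nn_integral_powr by blast
    show ?thesis
    proof (rule that[of "K * L"])
      show "K * L \<ge> 0" using K L by simp
      fix x :: real assume x: "x \<ge> 0"
      have "(\<integral>\<^sup>+j. \<integral>\<^sup>+i. ennreal (\<phi> i * \<psi> j * min 1 ((x / (u i powr \<alpha> * v j powr \<beta>)) powr r)) \<partial>counting \<partial>counting)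
        \<le> (\<integral>\<^sup>+j. ennreal (\<psi> j) * ennreal (K * w j x) \<partial>counting)"
        unfolding inner[OF x] by (intro nn_integral_mono mult_left_mono K(2)) (auto simp: w_def)
      also have "\<dots> = (\<integral>\<^sup>+j. ennreal (K * x powr (1 / \<alpha>)) * ennreal (\<psi> j * v j powr - (\<beta> / \<alpha>)) \<partial>counting)"
        using K x by (intro nn_integral_cong) (simp add: w_eq V.\<phi>_nonneg mult_ac flip: ennreal_mult)
      also have "\<dots> = ennreal (K * x powr (1 / \<alpha>)) * (\<integral>\<^sup>+j. ennreal (\<psi> j * v j powr - (\<beta> / \<alpha>)) \<partial>counting)"
        by (simp add: nn_integral_cmult)
      also have "\<dots> \<le> ennreal (K * x powr (1 / \<alpha>)) * ennreal L"
        by (intro mult_left_mono L) auto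
      also have "\<dots> = ennreal (K * L * (x powr (1 / \<alpha>) * (if \<alpha> = \<beta> then log_plus x else 1)))"
        using K L False by (simp add: mult_ac flip: ennreal_mult)
      finally show "(\<integral>\<^sup>+j. \<integral>\<^sup>+i. ennreal (\<phi> i * \<psi> j * min 1 ((x / (u i powr \<alpha> * v j powr \<beta>)) powr r)) \<partial>counting \<partial>counting)
        \<le> ennreal (K * L * (x powr (1 / \<alpha>) * (if \<alpha> = \<beta> then log_plus x else 1)))" .
    qed
  next
    case True
    obtain L where L: "L \<ge> 0"
      "\<And>z. z \<ge> 0 \<Longrightarrow> (\<integral>\<^sup>+j. ennreal (\<psi> j * min 1 ((z / v j) powr \<kappa>)) \<partial>counting) \<le> ennreal (L * z)"
      using V.nn_integral_min_powr[OF \<kappa>] by blast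
    obtain K' where K': "K' \<ge> 0" "(\<integral>\<^sup>+i. ennreal (\<phi> i * u i powr - \<kappa>) \<partial>counting) \<le> ennreal K'"
      using U.nn_integral_powr[OF \<kappa>] by blast
    \<comment> \<open>A bound for thresholds below all points u i: there the linear estimate is
      wasteful, since every summand is already a multiple of z^\<kappa>.\<close>
    have tail: "(\<integral>\<^sup>+i. ennreal (\<phi> i * min 1 ((z / u i) powr \<kappa>)) \<partial>counting) \<le> ennreal (K' * z powr \<kappa>)"
      if "z \<ge> 0" for z
    proof -
      have "(\<integral>\<^sup>+i. ennreal (\<phi> i * min 1 ((z / u i) powr \<kappa>)) \<partial>counting) \<le>
        (\<integral>\<^sup>+i. ennreal (z powr \<kappa>) * ennreal (\<phi> i * u i powr - \<kappa>) \<partial>counting)"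
      proof (intro nn_integral_mono)
        fix i
        have "\<phi> i * min 1 ((z / u i) powr \<kappa>) \<le> \<phi> i * (z / u i) powr \<kappa>"
          by (intro mult_left_mono U.\<phi>_nonneg) auto
        also have "\<dots> = z powr \<kappa> * (\<phi> i * u i powr - \<kappa>)"
          using that u[of i] by (simp add: powr_divide powr_minus_divide)
        finally show "ennreal (\<phi> i * min 1 ((z / u i) powr \<kappa>)) \<le> ennreal (z powr \<kappa>) * ennreal (\<phi> i * u i powr - \<kappa>)"
          by (simp add: U.\<phi>_nonneg ennreal_leI flip: ennreal_mult)
      qed
      also have "\<dots> = ennreal (z powr \<kappa>) * (\<integral>\<^sup>+i. ennreal (\<phi> i * u i powr - \<kappa>) \<partial>counting)"
        by (simp add: nn_integral_cmult)
      also have "\<dots> \<le> ennreal (z powr \<kappa>) * ennreal K'"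
        by (intro mult_left_mono K') auto
      finally show ?thesis using K' by (simp add: mult.commute ennreal_mult)
    qed
    define A where "A = K * (2 * D * (1 + 1 / (\<alpha> * ln 2))) + K' * L"
    show ?thesis
    proof (rule that[of A])
      show "A \<ge> 0" using K K' L V.C_nonneg assms by (auto simp: A_def intro!: add_nonneg_nonneg mult_nonneg_nonneg)
      fix x :: real assume x: "x \<ge> 0"
      define z where "z = x powr (1 / \<alpha>)"
      have z: "z \<ge> 0" by (simp add: z_def)
      have w: "w j x = z / v j" for j
        using w_eq[OF x, of j] True assms v[of j] by (simp add: z_def powr_minus_divide)
      have "(\<integral>\<^sup>+j. \<integral>\<^sup>+i. ennreal (\<phi> i * \<psi> j * min 1 ((x / (u i powr \<alpha> * v j powr \<beta>)) powr r)) \<partial>counting \<partial>counting)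
        \<le> (\<integral>\<^sup>+j. ennreal (K * z) * (ennreal (\<psi> j / v j) * indicator {..z} (v j)) +
              ennreal K' * ennreal (\<psi> j * min 1 ((z / v j) powr \<kappa>)) \<partial>counting)"
        unfolding inner[OF x] w
      proof (intro nn_integral_mono)
        fix j
        show "ennreal (\<psi> j) * (\<integral>\<^sup>+i. ennreal (\<phi> i * min 1 ((z / v j / u i) powr \<kappa>)) \<partial>counting)
          \<le> ennreal (K * z) * (ennreal (\<psi> j / v j) * indicator {..z} (v j)) +
              ennreal K' * ennreal (\<psi> j * min 1 ((z / v j) powr \<kappa>))" (is "_ \<le> ?a + ?b")
        proof (cases "v j \<le> z")
          case True
          have "ennreal (\<psi> j) * (\<integral>\<^sup>+i. ennreal (\<phi> i * min 1 ((z / v j / u i) powr \<kappa>)) \<partial>counting)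
            \<le> ennreal (\<psi> j) * ennreal (K * (z / v j))"
            using z v[of j] by (intro mult_left_mono K(2)) auto
          also have "\<dots> = ?a"
            using True K z v[of j] by (simp add: V.\<phi>_nonneg mult_ac flip: ennreal_mult)
          also have "\<dots> \<le> ?a + ?b" by simp
          finally show ?thesis .
        next
          case False
          have le1: "(z / v j) powr \<kappa> \<le> 1" using False z v[of j] \<kappa> by (intro powr_le1) auto
          have "ennreal (\<psi> j) * (\<integral>\<^sup>+i. ennreal (\<phi> i * min 1 ((z / v j / u i) powr \<kappa>)) \<partial>counting)
            \<le> ennreal (\<psi> j) * ennreal (K' * (z / v j) powr \<kappa>)"
            using z v[of j] by (intro mult_left_mono tail) auto
          also have "\<dots> = ?b"
            using K' le1 by (simp add: V.\<phi>_nonneg mult_ac flip: ennreal_mult)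
          also have "\<dots> \<le> ?a + ?b" by simp
          finally show ?thesis .
        qed
      qed
      also have "\<dots> = ennreal (K * z) * (\<integral>\<^sup>+j. ennreal (\<psi> j / v j) * indicator {..z} (v j) \<partial>counting) +
          ennreal K' * (\<integral>\<^sup>+j. ennreal (\<psi> j * min 1 ((z / v j) powr \<kappa>)) \<partial>counting)"
        by (simp add: nn_integral_add nn_integral_cmult)
      \<comment> \<open>Since z = x^(1/\<alpha>), log_2 z = ln x / (\<alpha> ln 2); the additional 1
        is absorbed by \<open>log_plus x \<ge> 1\<close>.\<close>
      also have "\<dots> \<le> ennreal (K * z) * ennreal (2 * D * (1 + 1 / (\<alpha> * ln 2)) * log_plus x) +
          ennreal K' * ennreal (L * z)"
      proof (intro add_mono mult_left_mono L(2) z)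
        show "(\<integral>\<^sup>+j. ennreal (\<psi> j / v j) * indicator {..z} (v j) \<partial>counting) \<le>
          ennreal (2 * D * (1 + 1 / (\<alpha> * ln 2)) * log_plus x)"
        proof (cases "z \<ge> 1")
          case True
          then have "x > 0" using x assms by (cases "x = 0") (auto simp: z_def)
          have "ln x \<ge> 0" using True assms \<open>x > 0\<close> by (auto simp: z_def ge_one_powr_ge_zero powr_def split: if_splits simp: divide_nonneg_pos zero_le_divide_iff)
          then have "1 + log 2 z \<le> (1 + 1 / (\<alpha> * ln 2)) * log_plus x"
          proof -
            have "log 2 z = 1 / (\<alpha> * ln 2) * ln x"
              using \<open>x > 0\<close> assms by (simp add: z_def log_def ln_powr)
            also have "\<dots> \<le> 1 / (\<alpha> * ln 2) * log_plus x"
              using assms \<open>x > 0\<close> by (intro mult_left_mono) (auto simp: log_plus_def)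
            finally have "log 2 z \<le> 1 / (\<alpha> * ln 2) * log_plus x" .
            moreover have "1 \<le> log_plus x" by (simp add: log_plus_def)
            ultimately show ?thesis by (simp add: distrib_right)
          qed
          then have "2 * D * (1 + log 2 z) \<le> 2 * D * ((1 + 1 / (\<alpha> * ln 2)) * log_plus x)"
            using V.C_nonneg by (intro mult_left_mono) auto
          from order_trans[OF V.nn_integral_reciprocal[OF True] ennreal_leI[OF this]]
          show ?thesis by (simp add: mult.assoc)
        next
          case False
          then have "indicator {..z} (v j) = (0 :: ennreal)" for j
            using V.u_ge_1[of j] by (auto simp: indicator_def)
          then show ?thesis by simp
        qed
      qed auto
      also have "\<dots> = ennreal (K * z * (2 * D * (1 + 1 / (\<alpha> * ln 2)) * log_plus x) + K' * (L * z))"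
      proof -
        have "log_plus x \<ge> 0" by (simp add: log_plus_def le_max_iff_disj)
        then have "2 * D * (1 + 1 / (\<alpha> * ln 2)) * log_plus x \<ge> 0"
          using V.C_nonneg assms by (intro mult_nonneg_nonneg add_nonneg_nonneg) auto
        then show ?thesis using K K' L z by (simp flip: ennreal_mult ennreal_plus)
      qed
      also have "\<dots> \<le> ennreal (A * (x powr (1 / \<alpha>) * (if \<alpha> = \<beta> then log_plus x else 1)))"
      proof (intro ennreal_leI)
        have "1 \<le> log_plus x" by (simp add: log_plus_def)
        then have "K' * (L * z) * 1 \<le> K' * (L * z) * log_plus x"
          using K' L z by (intro mult_left_mono) auto
        then show "K * z * (2 * D * (1 + 1 / (\<alpha> * ln 2)) * log_plus x) + K' * (L * z) \<le>
          A * (x powr (1 / \<alpha>) * (if \<alpha> = \<beta> then log_plus x else 1))"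
          unfolding if_P[OF True] z_def[symmetric] A_def by (simp add: algebra_simps)
      qed
      finally show "(\<integral>\<^sup>+j. \<integral>\<^sup>+i. ennreal (\<phi> i * \<psi> j * min 1 ((x / (u i powr \<alpha> * v j powr \<beta>)) powr r)) \<partial>counting \<partial>counting)
        \<le> ennreal (A * (x powr (1 / \<alpha>) * (if \<alpha> = \<beta> then log_plus x else 1)))" .
    qed
  qed
qed

lemma linear_growth_Suc: "linear_growth (\<lambda>i. real (Suc i)) (\<lambda>_. 1) 1"
  using sum_if_Suc_le by unfold_locales auto

lemma linear_growth_cesaro_sampling:
  "cesaro_sampling \<gamma> \<theta> e \<phi> C \<Longrightarrow> linear_growth (\<lambda>i. real (Suc (e i))) \<phi> C"
  unfolding cesaro_sampling_def by unfold_locales (auto intro: order_trans[OF zero_le_one])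

section \<open>Rosenthal's inequality for bounded variables\<close>

text \<open>The difference of powers has the factor y, and the cofactor consists of 2q + 1 products
  of degree 2q, each at most (|a| + |y|)^(2q) \<le> 4^q (a^(2q) + y^(2q)). It will be integrated
  with y one summand and a the sum of the others.\<close>

lemma mult_power_diff_le:
  fixes a y :: real
  shows "y * ((a + y) ^ (2 * q + 1) - a ^ (2 * q + 1)) \<le>
    real (2 * q + 1) * 4 ^ q * (y\<^sup>2 * a ^ (2 * q) + y ^ (2 * Suc q))"
proof -
  define m where "m = \<bar>a\<bar> + \<bar>y\<bar>"
  have m: "\<bar>a + y\<bar> \<le> m" "\<bar>a\<bar> \<le> m" "0 \<le> m" by (auto simp: m_def)
  have eq: "(a + y) ^ (2 * q + 1) - a ^ (2 * q + 1) = y * (\<Sum>p<2 * q + 1. (a + y) ^ p * a ^ (2 * q - p))"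
    using power_diff_sumr2[of "a + y" "2 * q + 1" a] by (simp add: mult.commute)
  have "y * ((a + y) ^ (2 * q + 1) - a ^ (2 * q + 1)) = y\<^sup>2 * (\<Sum>p<2 * q + 1. (a + y) ^ p * a ^ (2 * q - p))"
    unfolding eq by (simp add: power2_eq_square)
  also have "\<dots> \<le> y\<^sup>2 * (\<Sum>p<2 * q + 1. m ^ (2 * q))"
  proof (intro mult_left_mono sum_mono)
    fix p assume "p \<in> {..<2 * q + 1}"
    have "(a + y) ^ p * a ^ (2 * q - p) \<le> \<bar>a + y\<bar> ^ p * \<bar>a\<bar> ^ (2 * q - p)"
      using abs_ge_self[of "(a + y) ^ p * a ^ (2 * q - p)"] by (simp only: abs_mult power_abs)
    also have "\<dots> \<le> m ^ p * m ^ (2 * q - p)"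
      using m by (intro mult_mono power_mono) auto
    also have "\<dots> = m ^ (2 * q)" using \<open>p \<in> _\<close> by (simp flip: power_add)
    finally show "(a + y) ^ p * a ^ (2 * q - p) \<le> m ^ (2 * q)" .
  qed simp
  also have "\<dots> = real (2 * q + 1) * (y\<^sup>2 * m ^ (2 * q))" by simp
  also have "\<dots> \<le> real (2 * q + 1) * (y\<^sup>2 * (4 ^ q * (a ^ (2 * q) + y ^ (2 * q))))"
  proof (intro mult_left_mono)
    have "m ^ (2 * q) \<le> (2 * max \<bar>a\<bar> \<bar>y\<bar>) ^ (2 * q)" by (intro power_mono) (auto simp: m_def)
    also have "\<dots> = 4 ^ q * (max \<bar>a\<bar> \<bar>y\<bar>) ^ (2 * q)"
      by (simp add: power_mult_distrib power_mult)
    also have "\<dots> \<le> 4 ^ q * (a ^ (2 * q) + y ^ (2 * q))"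
    proof (intro mult_left_mono)
      have "\<bar>a\<bar> ^ (2 * q) = a ^ (2 * q)" "\<bar>y\<bar> ^ (2 * q) = y ^ (2 * q)"
        by (simp_all add: power_even_abs)
      moreover have "a ^ (2 * q) \<ge> 0" "y ^ (2 * q) \<ge> 0"
        by (simp_all add: zero_le_even_power)
      ultimately show "(max \<bar>a\<bar> \<bar>y\<bar>) ^ (2 * q) \<le> a ^ (2 * q) + y ^ (2 * q)"
        by (simp add: max_def)
    qed simp
    finally show "m ^ (2 * q) \<le> 4 ^ q * (a ^ (2 * q) + y ^ (2 * q))" .
  qed auto
  also have "y\<^sup>2 * (4 ^ q * (a ^ (2 * q) + y ^ (2 * q))) = 4 ^ q * (y\<^sup>2 * a ^ (2 * q) + y ^ (2 * Suc q))"
  proof -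
    have "y\<^sup>2 * y ^ (2 * q) = y ^ (2 * Suc q)" by (simp only: power_add[symmetric] mult_Suc_right)
    then show ?thesis by (simp only: mult.left_commute[of "y\<^sup>2"] distrib_left)
  qed
  finally show ?thesis unfolding mult.assoc .
qed

text \<open>If V \<le> y^2, the last term alone dominates; otherwise the first one does. This
  interpolation removes the intermediate moments that the induction for Rosenthal's inequality
  produces.\<close>

lemma mult_power_even_le:
  fixes V y :: real
  assumes "V \<ge> 0" "q \<ge> 1"
  shows "V * y ^ (2 * q) \<le> V ^ q * y\<^sup>2 + y ^ (2 * Suc q)"
proof -
  obtain k where k: "q = Suc k" using assms by (cases q) auto
  define w where "w = y\<^sup>2"
  have w: "w \<ge> 0" by (simp add: w_def)
  have "V * w ^ q \<le> V ^ q * w + w ^ Suc q"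
  proof (cases "V \<le> w")
    case True
    then have "V * w ^ q \<le> w * w ^ q" using w by (intro mult_right_mono) auto
    moreover have "0 \<le> V ^ q * w" using w assms by simp
    ultimately show ?thesis by simp
  next
    case False
    then have "w ^ k \<le> V ^ k" using w by (intro power_mono) auto
    then have "(V * w) * w ^ k \<le> (V * w) * V ^ k" using w assms by (intro mult_left_mono) auto
    moreover have "0 \<le> w ^ Suc q" using w by simp
    ultimately show ?thesis by (simp add: k mult_ac)
  qed
  then show ?thesis by (simp only: w_def power_mult)
qed

context prob_space
begin

text \<open>Bounded variables are closed under sums, products and powers, so one set of rules
  settles every integrability condition for polynomial expressions.\<close>

definition bounded_rv :: "('a \<Rightarrow> real) \<Rightarrow> bool" where
  "bounded_rv f \<longleftrightarrow> f \<in> borel_measurable M \<and> (\<exists>B. \<forall>\<omega>\<in>space M. \<bar>f \<omega>\<bar> \<le> B)"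

lemma bounded_rvI: "f \<in> borel_measurable M \<Longrightarrow> (\<And>\<omega>. \<omega> \<in> space M \<Longrightarrow> \<bar>f \<omega>\<bar> \<le> B) \<Longrightarrow> bounded_rv f"
  by (auto simp: bounded_rv_def)

lemma bounded_rv_measurable: "bounded_rv f \<Longrightarrow> f \<in> borel_measurable M"
  by (simp add: bounded_rv_def)

lemma bounded_rv_integrable: "bounded_rv f \<Longrightarrow> integrable M f"
  unfolding bounded_rv_def by (auto intro!: integrable_const_bound AE_I2)

lemma bounded_rv_mult: "bounded_rv f \<Longrightarrow> bounded_rv g \<Longrightarrow> bounded_rv (\<lambda>\<omega>. f \<omega> * g \<omega>)"
proof -
  assume "bounded_rv f" "bounded_rv g"
  then obtain A B where AB: "\<forall>\<omega>\<in>space M. \<bar>f \<omega>\<bar> \<le> A" "\<forall>\<omega>\<in>space M. \<bar>g \<omega>\<bar> \<le> B"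
    and [measurable]: "f \<in> borel_measurable M" "g \<in> borel_measurable M"
    by (auto simp: bounded_rv_def)
  show ?thesis
  proof (rule bounded_rvI)
    fix \<omega> assume "\<omega> \<in> space M"
    with AB have "\<bar>f \<omega>\<bar> \<le> A" "\<bar>g \<omega>\<bar> \<le> B" by auto
    then show "\<bar>f \<omega> * g \<omega>\<bar> \<le> A * B" unfolding abs_mult by (intro mult_mono) auto
  qed measurable
qed

lemma bounded_rv_const: "bounded_rv (\<lambda>_. c)"
  by (rule bounded_rvI[of _ "\<bar>c\<bar>"]) auto

lemma bounded_rv_power: "bounded_rv f \<Longrightarrow> bounded_rv (\<lambda>\<omega>. f \<omega> ^ n)"
  by (induction n) (auto intro: bounded_rv_const bounded_rv_mult)

lemma bounded_rv_add: "bounded_rv f \<Longrightarrow> bounded_rv g \<Longrightarrow> bounded_rv (\<lambda>\<omega>. f \<omega> + g \<omega>)"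
proof -
  assume "bounded_rv f" "bounded_rv g"
  then obtain A B where AB: "\<forall>\<omega>\<in>space M. \<bar>f \<omega>\<bar> \<le> A" "\<forall>\<omega>\<in>space M. \<bar>g \<omega>\<bar> \<le> B"
    and [measurable]: "f \<in> borel_measurable M" "g \<in> borel_measurable M"
    by (auto simp: bounded_rv_def)
  show ?thesis
    by (rule bounded_rvI[of _ "A + B"]) (use AB in \<open>auto intro: order_trans[OF abs_triangle_ineq] add_mono\<close>)
qed

lemma bounded_rv_diff: "bounded_rv f \<Longrightarrow> bounded_rv g \<Longrightarrow> bounded_rv (\<lambda>\<omega>. f \<omega> - g \<omega>)"
  using bounded_rv_add[of f "\<lambda>\<omega>. (-1) * g \<omega>"] bounded_rv_mult[OF bounded_rv_const[of "-1"], of g] by simp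

lemma bounded_rv_sum: "(\<And>i. i \<in> I \<Longrightarrow> bounded_rv (f i)) \<Longrightarrow> bounded_rv (\<lambda>\<omega>. \<Sum>i\<in>I. f i \<omega>)"
  by (induction I rule: infinite_finite_induct) (auto intro: bounded_rv_const bounded_rv_add)

lemmas bounded_rv_intros = bounded_rv_const bounded_rv_mult bounded_rv_power bounded_rv_add
  bounded_rv_diff bounded_rv_sum

text \<open>Write the power as the sum over i of Y_i S^(2q+1). With R_i = S - Y_i, the product Y_i
  R_i^(2q+1) has mean 0 by independence and centring, so it may be subtracted;
  \<open>mult_power_diff_le\<close> then bounds the difference by terms in which Y_i and R_i
  factor.\<close>

lemma expectation_sum_power_le:
  fixes Y :: "'i \<Rightarrow> 'a \<Rightarrow> real"
  assumes fin: "finite I" and ind: "indep_vars (\<lambda>_. borel) Y I"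
    and bdd: "\<And>i. i \<in> I \<Longrightarrow> bounded_rv (Y i)"
    and cent: "\<And>i. i \<in> I \<Longrightarrow> expectation (Y i) = 0"
  shows "expectation (\<lambda>\<omega>. (\<Sum>i\<in>I. Y i \<omega>) ^ (2 * Suc q)) \<le> real (2 * q + 1) * 4 ^ q *
    (\<Sum>i\<in>I. expectation (\<lambda>\<omega>. (Y i \<omega>)\<^sup>2) * expectation (\<lambda>\<omega>. (\<Sum>j\<in>I - {i}. Y j \<omega>) ^ (2 * q))
        + expectation (\<lambda>\<omega>. Y i \<omega> ^ (2 * Suc q)))"
proof -
  define D where "D = real (2 * q + 1) * 4 ^ q"
  define S where "S \<omega> = (\<Sum>i\<in>I. Y i \<omega>)" for \<omega>
  define R where "R i \<omega> = (\<Sum>j\<in>I - {i}. Y j \<omega>)" for i \<omega>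
  have S: "S \<omega> = R i \<omega> + Y i \<omega>" if "i \<in> I" for i \<omega>
    using fin that by (simp add: S_def R_def sum.remove)
  have bS: "bounded_rv S" unfolding S_def by (intro bounded_rv_sum bdd)
  have bR: "bounded_rv (R i)" for i unfolding R_def by (intro bounded_rv_sum bdd) auto
  have indR: "indep_var borel (Y i) borel (R i)" if "i \<in> I" for i
    unfolding R_def by (rule indep_vars_sum) (use fin ind that in \<open>auto simp: insert_absorb\<close>)
  have "expectation (\<lambda>\<omega>. S \<omega> ^ (2 * Suc q)) = expectation (\<lambda>\<omega>. \<Sum>i\<in>I. Y i \<omega> * S \<omega> ^ (2 * q + 1))"
    unfolding sum_distrib_right[symmetric] S_def[symmetric] by simp
  also have "\<dots> = (\<Sum>i\<in>I. expectation (\<lambda>\<omega>. Y i \<omega> * S \<omega> ^ (2 * q + 1)))"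
    by (intro Bochner_Integration.integral_sum bounded_rv_integrable bounded_rv_intros bdd bS)
  also have "\<dots> \<le> (\<Sum>i\<in>I. D * (expectation (\<lambda>\<omega>. (Y i \<omega>)\<^sup>2) * expectation (\<lambda>\<omega>. R i \<omega> ^ (2 * q))
        + expectation (\<lambda>\<omega>. Y i \<omega> ^ (2 * Suc q))))"
  proof (intro sum_mono)
    fix i assume i: "i \<in> I"
    have pow1: "expectation (\<lambda>\<omega>. Y i \<omega> * R i \<omega> ^ (2 * q + 1)) = 0"
    proof -
      have "indep_var borel ((\<lambda>x. x) \<circ> Y i) borel ((\<lambda>x. x ^ (2 * q + 1)) \<circ> R i)"
        by (rule indep_var_compose[OF indR[OF i]]) auto
      then have "indep_var borel (Y i) borel (\<lambda>\<omega>. R i \<omega> ^ (2 * q + 1))" by (simp add: comp_def)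
      from indep_var_lebesgue_integral[OF this bounded_rv_integrable[OF bdd[OF i]]
          bounded_rv_integrable[OF bounded_rv_power[OF bR]]]
      show ?thesis unfolding cent[OF i] mult_zero_left .
    qed
    have pow2: "expectation (\<lambda>\<omega>. (Y i \<omega>)\<^sup>2 * R i \<omega> ^ (2 * q)) =
        expectation (\<lambda>\<omega>. (Y i \<omega>)\<^sup>2) * expectation (\<lambda>\<omega>. R i \<omega> ^ (2 * q))"
    proof -
      have "indep_var borel ((\<lambda>x. x\<^sup>2) \<circ> Y i) borel ((\<lambda>x. x ^ (2 * q)) \<circ> R i)"
        by (rule indep_var_compose[OF indR[OF i]]) auto
      then have "indep_var borel (\<lambda>\<omega>. (Y i \<omega>)\<^sup>2) borel (\<lambda>\<omega>. R i \<omega> ^ (2 * q))" by (simp add: comp_def)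
      from indep_var_lebesgue_integral[OF this bounded_rv_integrable[OF bounded_rv_power[OF bdd[OF i]]]
          bounded_rv_integrable[OF bounded_rv_power[OF bR]]]
      show ?thesis .
    qed
    have "expectation (\<lambda>\<omega>. Y i \<omega> * S \<omega> ^ (2 * q + 1)) =
        expectation (\<lambda>\<omega>. Y i \<omega> * S \<omega> ^ (2 * q + 1)) - expectation (\<lambda>\<omega>. Y i \<omega> * R i \<omega> ^ (2 * q + 1))"
      unfolding pow1 by simp
    also have "\<dots> = expectation (\<lambda>\<omega>. Y i \<omega> * S \<omega> ^ (2 * q + 1) - Y i \<omega> * R i \<omega> ^ (2 * q + 1))"
      by (intro Bochner_Integration.integral_diff[symmetric] bounded_rv_integrable bounded_rv_intros bdd bS bR i)
    also have "\<dots> \<le> expectation (\<lambda>\<omega>. D * ((Y i \<omega>)\<^sup>2 * R i \<omega> ^ (2 * q) + Y i \<omega> ^ (2 * Suc q)))"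
    proof (intro integral_mono bounded_rv_integrable bounded_rv_intros bdd bS bR i)
      fix \<omega>
      show "Y i \<omega> * S \<omega> ^ (2 * q + 1) - Y i \<omega> * R i \<omega> ^ (2 * q + 1) \<le>
          D * ((Y i \<omega>)\<^sup>2 * R i \<omega> ^ (2 * q) + Y i \<omega> ^ (2 * Suc q))"
        using mult_power_diff_le[of "Y i \<omega>" "R i \<omega>" q] unfolding S[OF i] D_def right_diff_distrib .
    qed
    also have "\<dots> = D * (expectation (\<lambda>\<omega>. (Y i \<omega>)\<^sup>2 * R i \<omega> ^ (2 * q)) + expectation (\<lambda>\<omega>. Y i \<omega> ^ (2 * Suc q)))"
      by (subst Bochner_Integration.integral_add[symmetric])
        (intro bounded_rv_integrable bounded_rv_intros bdd bR i | rule integral_mult_right_zero)+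
    finally show "expectation (\<lambda>\<omega>. Y i \<omega> * S \<omega> ^ (2 * q + 1)) \<le>
        D * (expectation (\<lambda>\<omega>. (Y i \<omega>)\<^sup>2) * expectation (\<lambda>\<omega>. R i \<omega> ^ (2 * q))
        + expectation (\<lambda>\<omega>. Y i \<omega> ^ (2 * Suc q)))"
      unfolding pow2 .
  qed
  finally show ?thesis
    unfolding sum_distrib_left[symmetric] S_def R_def D_def .
qed

text \<open>Induction on q through \<open>expectation_sum_power_le\<close>. The constant is chosen
  before the index set and the variables, because the hypothesis is applied to all sets I - {i}; the
  sums there are enlarged to I, being sums of nonnegative terms.\<close>

lemma rosenthal_even:
  fixes q :: nat
  assumes "q \<ge> 1"
  obtains C where "C \<ge> 0"
    "\<And>(I :: 'i set) Y. finite I \<Longrightarrow> indep_vars (\<lambda>_. borel) Y I \<Longrightarrow>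
       (\<And>i. i \<in> I \<Longrightarrow> bounded_rv (Y i)) \<Longrightarrow> (\<And>i. i \<in> I \<Longrightarrow> expectation (Y i) = 0) \<Longrightarrow>
       expectation (\<lambda>\<omega>. (\<Sum>i\<in>I. Y i \<omega>) ^ (2 * q)) \<le>
       C * ((\<Sum>i\<in>I. expectation (\<lambda>\<omega>. Y i \<omega> ^ (2 * q))) + (\<Sum>i\<in>I. expectation (\<lambda>\<omega>. (Y i \<omega>)\<^sup>2)) ^ q)"
proof -
  have "\<exists>C\<ge>0. \<forall>(I :: 'i set) Y. finite I \<longrightarrow> indep_vars (\<lambda>_. borel) Y I \<longrightarrow>
       (\<forall>i\<in>I. bounded_rv (Y i)) \<longrightarrow> (\<forall>i\<in>I. expectation (Y i) = 0) \<longrightarrow>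
       expectation (\<lambda>\<omega>. (\<Sum>i\<in>I. Y i \<omega>) ^ (2 * q)) \<le>
       C * ((\<Sum>i\<in>I. expectation (\<lambda>\<omega>. Y i \<omega> ^ (2 * q))) + (\<Sum>i\<in>I. expectation (\<lambda>\<omega>. (Y i \<omega>)\<^sup>2)) ^ q)"
    using assms
  proof (induction q rule: nat_induct_at_least)
    case base
    show ?case
    proof (intro exI[of _ 1] conjI allI impI)
      fix I :: "'i set" and Y
      assume "finite I" "indep_vars (\<lambda>_. borel) Y I" "\<forall>i\<in>I. bounded_rv (Y i)" "\<forall>i\<in>I. expectation (Y i) = 0"
      then have "expectation (\<lambda>\<omega>. (\<Sum>i\<in>I. Y i \<omega>) ^ (2 * Suc 0)) \<le> real (2 * 0 + 1) * 4 ^ 0 *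
          (\<Sum>i\<in>I. expectation (\<lambda>\<omega>. (Y i \<omega>)\<^sup>2) * expectation (\<lambda>\<omega>. (\<Sum>j\<in>I - {i}. Y j \<omega>) ^ (2 * 0))
          + expectation (\<lambda>\<omega>. Y i \<omega> ^ (2 * Suc 0)))"
        by (intro expectation_sum_power_le) auto
      then show "expectation (\<lambda>\<omega>. (\<Sum>i\<in>I. Y i \<omega>) ^ (2 * 1)) \<le>
       1 * ((\<Sum>i\<in>I. expectation (\<lambda>\<omega>. Y i \<omega> ^ (2 * 1))) + (\<Sum>i\<in>I. expectation (\<lambda>\<omega>. (Y i \<omega>)\<^sup>2)) ^ 1)"
        unfolding sum.distrib by (simp add: prob_space)
    qed simp
  next
    case (Suc q)
    from Suc.IH obtain C where C: "C \<ge> 0" and IH0: "\<forall>(I :: 'i set) Y. finite I \<longrightarrow> indep_vars (\<lambda>_. borel) Y I \<longrightarrow>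
       (\<forall>i\<in>I. bounded_rv (Y i)) \<longrightarrow> (\<forall>i\<in>I. expectation (Y i) = 0) \<longrightarrow>
       expectation (\<lambda>\<omega>. (\<Sum>i\<in>I. Y i \<omega>) ^ (2 * q)) \<le>
       C * ((\<Sum>i\<in>I. expectation (\<lambda>\<omega>. Y i \<omega> ^ (2 * q))) + (\<Sum>i\<in>I. expectation (\<lambda>\<omega>. (Y i \<omega>)\<^sup>2)) ^ q)"
      by (elim exE conjE)
    note IH = IH0[rule_format]
    define D where "D = real (2 * q + 1) * 4 ^ q"
    show ?case
    proof (intro exI[of _ "D * (2 * C + 1)"] conjI allI impI)
      show "0 \<le> D * (2 * C + 1)" using C by (simp add: D_def)
      fix I :: "'i set" and Y
      assume fin: "finite I" and ind: "indep_vars (\<lambda>_. borel) Y I"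
        and bdd: "\<forall>i\<in>I. bounded_rv (Y i)" and cent: "\<forall>i\<in>I. expectation (Y i) = 0"
      define V where "V = (\<Sum>i\<in>I. expectation (\<lambda>\<omega>. (Y i \<omega>)\<^sup>2))"
      define Q where "Q n = (\<Sum>i\<in>I. expectation (\<lambda>\<omega>. Y i \<omega> ^ (2 * n)))" for n
      have V: "V \<ge> 0" by (simp add: V_def sum_nonneg)
      have Q: "Q n \<ge> 0" for n by (simp add: Q_def sum_nonneg)
      have rest: "expectation (\<lambda>\<omega>. (\<Sum>j\<in>I - {i}. Y j \<omega>) ^ (2 * q)) \<le> C * (Q q + V ^ q)" for i
      proof -
        have "expectation (\<lambda>\<omega>. (\<Sum>j\<in>I - {i}. Y j \<omega>) ^ (2 * q)) \<le>
          C * ((\<Sum>j\<in>I - {i}. expectation (\<lambda>\<omega>. Y j \<omega> ^ (2 * q))) + (\<Sum>j\<in>I - {i}. expectation (\<lambda>\<omega>. (Y j \<omega>)\<^sup>2)) ^ q)"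
          using fin bdd cent by (intro IH indep_vars_subset[OF ind]) auto
        also have "\<dots> \<le> C * (Q q + V ^ q)"
          unfolding Q_def V_def using fin C
          by (intro mult_left_mono add_mono power_mono sum_mono2 sum_nonneg) auto
        finally show ?thesis .
      qed
      have VQ: "V * Q q \<le> V ^ q * V + Q (Suc q)"
      proof -
        have "V * expectation (\<lambda>\<omega>. Y i \<omega> ^ (2 * q)) \<le>
          V ^ q * expectation (\<lambda>\<omega>. (Y i \<omega>)\<^sup>2) + expectation (\<lambda>\<omega>. Y i \<omega> ^ (2 * Suc q))" if "i \<in> I" for i
        proof -
          have b: "bounded_rv (Y i)" using bdd that by simp
          have "V * expectation (\<lambda>\<omega>. Y i \<omega> ^ (2 * q)) = expectation (\<lambda>\<omega>. V * Y i \<omega> ^ (2 * q))" by simp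
          also have "\<dots> \<le> expectation (\<lambda>\<omega>. V ^ q * (Y i \<omega>)\<^sup>2 + Y i \<omega> ^ (2 * Suc q))"
            using V Suc.hyps by (intro integral_mono bounded_rv_integrable bounded_rv_intros b mult_power_even_le) auto
          also have "\<dots> = expectation (\<lambda>\<omega>. V ^ q * (Y i \<omega>)\<^sup>2) + expectation (\<lambda>\<omega>. Y i \<omega> ^ (2 * Suc q))"
            by (intro Bochner_Integration.integral_add bounded_rv_integrable bounded_rv_intros b)
          finally show ?thesis by simp
        qed
        then have "(\<Sum>i\<in>I. V * expectation (\<lambda>\<omega>. Y i \<omega> ^ (2 * q))) \<le>
          (\<Sum>i\<in>I. V ^ q * expectation (\<lambda>\<omega>. (Y i \<omega>)\<^sup>2) + expectation (\<lambda>\<omega>. Y i \<omega> ^ (2 * Suc q)))"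
          by (intro sum_mono)
        then show ?thesis
          unfolding sum.distrib sum_distrib_left[symmetric] by (simp only: Q_def V_def)
      qed
      have "expectation (\<lambda>\<omega>. (\<Sum>i\<in>I. Y i \<omega>) ^ (2 * Suc q)) \<le> D *
        (\<Sum>i\<in>I. expectation (\<lambda>\<omega>. (Y i \<omega>)\<^sup>2) * expectation (\<lambda>\<omega>. (\<Sum>j\<in>I - {i}. Y j \<omega>) ^ (2 * q))
        + expectation (\<lambda>\<omega>. Y i \<omega> ^ (2 * Suc q)))"
        unfolding D_def using bdd cent by (intro expectation_sum_power_le fin ind) auto
      also have "\<dots> \<le> D * (\<Sum>i\<in>I. expectation (\<lambda>\<omega>. (Y i \<omega>)\<^sup>2) * (C * (Q q + V ^ q))
        + expectation (\<lambda>\<omega>. Y i \<omega> ^ (2 * Suc q)))"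
        by (intro mult_left_mono sum_mono add_mono rest order_refl) (auto simp: D_def)
      also have "\<dots> = D * (C * (V * Q q) + C * V ^ Suc q + Q (Suc q))"
        unfolding sum.distrib sum_distrib_right[symmetric] V_def[symmetric] Q_def[symmetric]
        by (simp add: algebra_simps)
      also have "\<dots> \<le> D * (C * (V ^ q * V + Q (Suc q)) + C * V ^ Suc q + Q (Suc q))"
        using C by (intro mult_left_mono add_mono VQ order_refl) (auto simp: D_def)
      also have "\<dots> \<le> D * ((2 * C + 1) * (Q (Suc q) + V ^ Suc q))"
        using C V Q[of "Suc q"] by (intro mult_left_mono) (auto simp: D_def algebra_simps)
      finally show "expectation (\<lambda>\<omega>. (\<Sum>i\<in>I. Y i \<omega>) ^ (2 * Suc q)) \<le> D * (2 * C + 1) *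
        ((\<Sum>i\<in>I. expectation (\<lambda>\<omega>. Y i \<omega> ^ (2 * Suc q))) + (\<Sum>i\<in>I. expectation (\<lambda>\<omega>. (Y i \<omega>)\<^sup>2)) ^ Suc q)"
        by (simp only: V_def Q_def mult.assoc)
    qed
  qed
  then obtain C where C: "C \<ge> 0" "\<forall>(I :: 'i set) Y. finite I \<longrightarrow> indep_vars (\<lambda>_. borel) Y I \<longrightarrow>
       (\<forall>i\<in>I. bounded_rv (Y i)) \<longrightarrow> (\<forall>i\<in>I. expectation (Y i) = 0) \<longrightarrow>
       expectation (\<lambda>\<omega>. (\<Sum>i\<in>I. Y i \<omega>) ^ (2 * q)) \<le>
       C * ((\<Sum>i\<in>I. expectation (\<lambda>\<omega>. Y i \<omega> ^ (2 * q))) + (\<Sum>i\<in>I. expectation (\<lambda>\<omega>. (Y i \<omega>)\<^sup>2)) ^ q)"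
    by (elim exE conjE)
  show ?thesis by (rule that[OF C(1) C(2)[rule_format]])
qed

end

section \<open>Deterministic limits of double means\<close>

lemma cesaro_mean_eq_ge:
  assumes "m \<le> K" "n \<le> L"
  shows "cesaro_mean \<alpha> \<beta> x m n =
     (\<Sum>p\<in>{..K} \<times> {..L}. cesaro_weight \<alpha> m (fst p) * cesaro_weight \<beta> n (snd p) * x (fst p) (snd p))"
proof -
  have "cesaro_mean \<alpha> \<beta> x m n =
     (\<Sum>p\<in>{..m} \<times> {..n}. cesaro_weight \<alpha> m (fst p) * cesaro_weight \<beta> n (snd p) * x (fst p) (snd p))"
    by (simp add: cesaro_mean_eq sum.cartesian_product case_prod_unfold)
  also have "\<dots> = (\<Sum>p\<in>{..K} \<times> {..L}. cesaro_weight \<alpha> m (fst p) * cesaro_weight \<beta> n (snd p) * x (fst p) (snd p))"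
    using assms by (intro sum.mono_neutral_left) (auto simp: cesaro_weight_def split: if_splits)
  finally show ?thesis .
qed

lemmas cesaro_mean_eq_pairs = cesaro_mean_eq_ge[OF order_refl order_refl]

lemma cesaro_mean_diff:
  "cesaro_mean \<alpha> \<beta> (\<lambda>k l. x k l - y k l) m n = cesaro_mean \<alpha> \<beta> x m n - cesaro_mean \<alpha> \<beta> y m n"
  by (simp add: cesaro_mean_eq_pairs right_diff_distrib sum_subtractf)

lemma cesaro_mean_dominated:
  assumes "\<And>k l. x k l \<ge> 0" "0 \<le> \<alpha>" "0 \<le> \<beta>" "\<theta> \<ge> 0"
    and "\<And>k. cesaro_weight \<alpha> m k \<le> \<theta> * cesaro_weight \<alpha> m' k"
    and "\<And>l. cesaro_weight \<beta> n l \<le> \<theta> * cesaro_weight \<beta> n' l"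
  shows "cesaro_mean \<alpha> \<beta> x m n \<le> \<theta>\<^sup>2 * cesaro_mean \<alpha> \<beta> x m' n'"
proof -
  let ?K = "max m m'" and ?L = "max n n'"
  have "cesaro_mean \<alpha> \<beta> x m n =
     (\<Sum>p\<in>{..?K} \<times> {..?L}. cesaro_weight \<alpha> m (fst p) * cesaro_weight \<beta> n (snd p) * x (fst p) (snd p))"
    by (rule cesaro_mean_eq_ge) auto
  also have "\<dots> \<le> (\<Sum>p\<in>{..?K} \<times> {..?L}. (\<theta> * cesaro_weight \<alpha> m' (fst p)) * (\<theta> * cesaro_weight \<beta> n' (snd p)) * x (fst p) (snd p))"
    using assms cesaro_weight_nonneg by (intro sum_mono mult_mono) auto
  also have "\<dots> = \<theta>\<^sup>2 * cesaro_mean \<alpha> \<beta> x m' n'"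
    by (subst cesaro_mean_eq_ge[of m' ?K n' ?L]) (auto simp: sum_distrib_left power2_eq_square mult_ac)
  finally show ?thesis .
qed

text \<open>Nonnegativity squeezes every mean between sampled means up to the factor \<theta>^2. No
  single \<theta> > 1 is enough, but the values 1 + 1/(N + 1) tend to 1, and restricting to these
  keeps the number of exceptional null sets countable in the application.\<close>

lemma cesaro_mean_tendsto_sampling:
  assumes \<gamma>: "0 \<le> \<alpha>" "0 \<le> \<beta>" and x: "\<And>k l. x k l \<ge> 0"
    and lim: "\<And>N. \<exists>e \<phi> C f \<psi> D. cesaro_sampling \<alpha> (1 + 1 / real (Suc N)) e \<phi> C \<and>
        cesaro_sampling \<beta> (1 + 1 / real (Suc N)) f \<psi> D \<and>
        ((\<lambda>(i, j). cesaro_mean \<alpha> \<beta> x (e i) (f j)) \<longlongrightarrow> c) (sequentially \<times>\<^sub>F sequentially)"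
  shows "((\<lambda>(m, n). cesaro_mean \<alpha> \<beta> x m n) \<longlongrightarrow> c) (sequentially \<times>\<^sub>F sequentially)"
proof -
  let ?\<theta> = "\<lambda>N. 1 + 1 / real (Suc N)" and ?d = "\<lambda>N. 1 / real (Suc N)"
  have bounds: "\<forall>\<^sub>F (m, n) in sequentially \<times>\<^sub>F sequentially.
      (c - ?d N) / (?\<theta> N)\<^sup>2 \<le> cesaro_mean \<alpha> \<beta> x m n \<and> cesaro_mean \<alpha> \<beta> x m n \<le> (?\<theta> N)\<^sup>2 * (c + ?d N)" for N
  proof -
    obtain e \<phi> C f \<psi> D where S: "cesaro_sampling \<alpha> (?\<theta> N) e \<phi> C" "cesaro_sampling \<beta> (?\<theta> N) f \<psi> D"
      and L: "((\<lambda>(i, j). cesaro_mean \<alpha> \<beta> x (e i) (f j)) \<longlongrightarrow> c) (sequentially \<times>\<^sub>F sequentially)"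
      using lim by blast
    have "?d N > 0" by simp
    from tendstoD[OF L this] obtain I where I:
      "\<And>i j. i \<ge> I \<Longrightarrow> j \<ge> I \<Longrightarrow> \<bar>cesaro_mean \<alpha> \<beta> x (e i) (f j) - c\<bar> < ?d N"
      unfolding eventually_prod_sequentially by (auto simp: dist_real_def)
    have ev1: "\<forall>\<^sub>F m in sequentially. \<exists>i\<ge>I. \<exists>j\<ge>I.
       (\<forall>k. cesaro_weight \<alpha> (e i) k \<le> ?\<theta> N * cesaro_weight \<alpha> m k) \<and>
       (\<forall>k. cesaro_weight \<alpha> m k \<le> ?\<theta> N * cesaro_weight \<alpha> (e j) k)"
      using S(1) unfolding cesaro_sampling_def by blast
    have ev2: "\<forall>\<^sub>F m in sequentially. \<exists>i\<ge>I. \<exists>j\<ge>I.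
       (\<forall>k. cesaro_weight \<beta> (f i) k \<le> ?\<theta> N * cesaro_weight \<beta> m k) \<and>
       (\<forall>k. cesaro_weight \<beta> m k \<le> ?\<theta> N * cesaro_weight \<beta> (f j) k)"
      using S(2) unfolding cesaro_sampling_def by blast
    have "?\<theta> N > 0" by (intro add_pos_nonneg) auto
    then have \<theta>: "?\<theta> N \<ge> 0" "(?\<theta> N)\<^sup>2 > 0" by (auto simp only: less_imp_le zero_less_power)
    show ?thesis
      using eventually_prodI[OF ev1 ev2]
    proof eventually_elim
      case (elim p)
      define m n where "m = fst p" and "n = snd p"
      from elim obtain i i' j j' where ge: "i \<ge> I" "i' \<ge> I" "j \<ge> I" "j' \<ge> I"
        and dom: "\<And>k. cesaro_weight \<alpha> (e i) k \<le> ?\<theta> N * cesaro_weight \<alpha> m k"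
          "\<And>k. cesaro_weight \<alpha> m k \<le> ?\<theta> N * cesaro_weight \<alpha> (e i') k"
          "\<And>k. cesaro_weight \<beta> (f j) k \<le> ?\<theta> N * cesaro_weight \<beta> n k"
          "\<And>k. cesaro_weight \<beta> n k \<le> ?\<theta> N * cesaro_weight \<beta> (f j') k"
        unfolding m_def n_def by blast
      have "c - ?d N \<le> cesaro_mean \<alpha> \<beta> x (e i) (f j)" using I[OF ge(1,3)] by linarith
      also have "\<dots> \<le> (?\<theta> N)\<^sup>2 * cesaro_mean \<alpha> \<beta> x m n"
        by (intro cesaro_mean_dominated x \<gamma> \<theta> dom)
      finally have lower: "(c - ?d N) / (?\<theta> N)\<^sup>2 \<le> cesaro_mean \<alpha> \<beta> x m n"
        using \<theta> by (simp only: pos_divide_le_eq mult.commute)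
      have "cesaro_mean \<alpha> \<beta> x m n \<le> (?\<theta> N)\<^sup>2 * cesaro_mean \<alpha> \<beta> x (e i') (f j')"
        by (intro cesaro_mean_dominated x \<gamma> \<theta> dom)
      also have "\<dots> \<le> (?\<theta> N)\<^sup>2 * (c + ?d N)"
        using I[OF ge(2,4)] by (intro mult_left_mono) auto
      finally show ?case
        using lower by (simp only: case_prod_unfold m_def n_def)
    qed
  qed
  have d: "?d \<longlonglongrightarrow> 0"
    using LIMSEQ_inverse_real_of_nat by (simp add: inverse_eq_divide)
  have up: "(\<lambda>N. (?\<theta> N)\<^sup>2 * (c + ?d N)) \<longlonglongrightarrow> (1 + 0)\<^sup>2 * (c + 0)"
    by (intro tendsto_intros d)
  have low: "(\<lambda>N. (c - ?d N) / (?\<theta> N)\<^sup>2) \<longlonglongrightarrow> (c - 0) / (1 + 0)\<^sup>2"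
    by (intro tendsto_intros d) auto
  show ?thesis
  proof (rule order_tendstoI)
    fix a assume "a < c"
    then have "\<forall>\<^sub>F N in sequentially. a < (c - ?d N) / (?\<theta> N)\<^sup>2"
      using order_tendstoD(1)[OF low, of a] by simp
    then obtain N where "a < (c - ?d N) / (?\<theta> N)\<^sup>2"
      using eventually_happens'[OF sequentially_bot] by blast
    with bounds[of N] show "\<forall>\<^sub>F p in sequentially \<times>\<^sub>F sequentially. a < (case p of (m, n) \<Rightarrow> cesaro_mean \<alpha> \<beta> x m n)"
      by (auto elim!: eventually_mono)
  next
    fix a assume "c < a"
    then have "\<forall>\<^sub>F N in sequentially. (?\<theta> N)\<^sup>2 * (c + ?d N) < a"
      using order_tendstoD(2)[OF up, of a] by simp
    then obtain N where "(?\<theta> N)\<^sup>2 * (c + ?d N) < a"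
      using eventually_happens'[OF sequentially_bot] by blast
    with bounds[of N] show "\<forall>\<^sub>F p in sequentially \<times>\<^sub>F sequentially. (case p of (m, n) \<Rightarrow> cesaro_mean \<alpha> \<beta> x m n) < a"
      by (auto elim!: eventually_mono)
  qed
qed

lemma tendsto_case_prod_cong_diff:
  fixes f g :: "nat \<Rightarrow> nat \<Rightarrow> real"
  assumes "((\<lambda>(m, n). f m n - g m n) \<longlongrightarrow> 0) F" "((\<lambda>(m, n). g m n) \<longlongrightarrow> c) F"
  shows "((\<lambda>(m, n). f m n) \<longlongrightarrow> c) F"
  using tendsto_add[OF assms] by (simp add: case_prod_unfold)

lemma cesaro_mean_finite_support_tendsto_0:
  assumes "0 < \<alpha>" "\<alpha> \<le> 1" "0 < \<beta>" "\<beta> \<le> 1" and fin: "finite {p. x (fst p) (snd p) \<noteq> 0}"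
  shows "((\<lambda>(m, n). cesaro_mean \<alpha> \<beta> x m n) \<longlongrightarrow> 0) (sequentially \<times>\<^sub>F sequentially)"
proof -
  let ?F = "{p. x (fst p) (snd p) \<noteq> 0}"
  let ?t = "\<lambda>m n p. cesaro_weight \<alpha> m (fst p) * cesaro_weight \<beta> n (snd p) * x (fst p) (snd p)"
  have "cesaro_mean \<alpha> \<beta> x m n = (\<Sum>p\<in>?F. ?t m n p)" for m n
  proof -
    have "cesaro_mean \<alpha> \<beta> x m n = (\<Sum>p\<in>({..m} \<times> {..n}) \<union> ?F. ?t m n p)"
      unfolding cesaro_mean_eq_pairs using fin
      by (intro sum.mono_neutral_left) (auto simp: cesaro_weight_def)
    also have "\<dots> = (\<Sum>p\<in>?F. ?t m n p)"
      using fin by (intro sum.mono_neutral_right) auto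
    finally show ?thesis .
  qed
  moreover have "((\<lambda>p. \<Sum>q\<in>?F. ?t (fst p) (snd p) q) \<longlongrightarrow> (\<Sum>q\<in>?F. 0 * 0 * x (fst q) (snd q))) (sequentially \<times>\<^sub>F sequentially)"
    using assms by (intro tendsto_intros
        filterlim_compose[OF cesaro_weight_tendsto_0 filterlim_fst]
        filterlim_compose[OF cesaro_weight_tendsto_0 filterlim_snd]) auto
  ultimately show ?thesis by (simp add: case_prod_unfold)
qed

text \<open>Each of the first K weights tends to 0, and the others have total mass at most 1 against
  values below \<epsilon>/2.\<close>

lemma Toeplitz_cesaro_weight:
  assumes "0 < \<gamma>" "\<gamma> \<le> 1" and g: "g \<longlonglongrightarrow> 0"
  shows "(\<lambda>m. \<Sum>k\<le>m. cesaro_weight \<gamma> m k * g k) \<longlonglongrightarrow> 0"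
proof (rule tendstoI)
  fix \<epsilon> :: real assume "\<epsilon> > 0"
  then have "\<epsilon> / 2 > 0" by simp
  from tendstoD[OF g this] obtain K where K: "\<And>k. k \<ge> K \<Longrightarrow> \<bar>g k\<bar> < \<epsilon> / 2"
    by (auto simp: eventually_sequentially)
  have "(\<lambda>m. \<Sum>k<K. cesaro_weight \<gamma> m k * \<bar>g k\<bar>) \<longlonglongrightarrow> (\<Sum>k<K. 0 * \<bar>g k\<bar>)"
    using assms by (intro tendsto_intros cesaro_weight_tendsto_0)
  then have "(\<lambda>m. \<Sum>k<K. cesaro_weight \<gamma> m k * \<bar>g k\<bar>) \<longlonglongrightarrow> 0" by simp
  from order_tendstoD(2)[OF this \<open>\<epsilon> / 2 > 0\<close>]
  show "\<forall>\<^sub>F m in sequentially. dist (\<Sum>k\<le>m. cesaro_weight \<gamma> m k * g k) 0 < \<epsilon>"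
  proof eventually_elim
    case (elim m)
    have w: "cesaro_weight \<gamma> m k \<ge> 0" for k using assms by (simp add: cesaro_weight_nonneg)
    have "\<bar>\<Sum>k\<le>m. cesaro_weight \<gamma> m k * g k\<bar> \<le> (\<Sum>k\<le>m. cesaro_weight \<gamma> m k * \<bar>g k\<bar>)"
      by (rule order_trans[OF sum_abs]) (simp add: abs_mult w)
    also have "\<dots> \<le> (\<Sum>k\<le>m. (if k < K then cesaro_weight \<gamma> m k * \<bar>g k\<bar> else 0) + cesaro_weight \<gamma> m k * (\<epsilon> / 2))"
    proof (intro sum_mono)
      fix k
      show "cesaro_weight \<gamma> m k * \<bar>g k\<bar> \<le> (if k < K then cesaro_weight \<gamma> m k * \<bar>g k\<bar> else 0) + cesaro_weight \<gamma> m k * (\<epsilon> / 2)"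
        using w[of k] \<open>\<epsilon> > 0\<close> K[of k] mult_left_mono[of "\<bar>g k\<bar>" "\<epsilon> / 2" "cesaro_weight \<gamma> m k"] by auto
    qed
    also have "\<dots> = (\<Sum>k\<le>m. if k < K then cesaro_weight \<gamma> m k * \<bar>g k\<bar> else 0) + \<epsilon> / 2"
      using sum_cesaro_weight[of \<gamma> m] assms
      by (simp only: sum.distrib sum_distrib_right[symmetric] mult_1_left)
    also have "\<dots> \<le> (\<Sum>k<K. cesaro_weight \<gamma> m k * \<bar>g k\<bar>) + \<epsilon> / 2"
    proof (rule add_right_mono)
      have "(\<Sum>k\<le>m. if k < K then cesaro_weight \<gamma> m k * \<bar>g k\<bar> else 0) =
          (\<Sum>k\<in>{..m} \<inter> {..<K}. cesaro_weight \<gamma> m k * \<bar>g k\<bar>)"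
        by (simp add: sum.If_cases lessThan_def)
      also have "\<dots> \<le> (\<Sum>k<K. cesaro_weight \<gamma> m k * \<bar>g k\<bar>)"
        using w by (intro sum_mono2) auto
      finally show "(\<Sum>k\<le>m. if k < K then cesaro_weight \<gamma> m k * \<bar>g k\<bar> else 0) \<le>
          (\<Sum>k<K. cesaro_weight \<gamma> m k * \<bar>g k\<bar>)" .
    qed
    also have "\<dots> < \<epsilon> / 2 + \<epsilon> / 2" using elim by (rule add_strict_right_mono)
    also have "\<dots> = \<epsilon>" by simp
    finally show ?case by (simp add: dist_real_def)
  qed
qed

text \<open>The column sums are the terms of a convergent series and tend to 0, and each entry is
  controlled by its own column sum. So the limit is reached as j grows, uniformly in i.\<close>

lemma nn_integral_double_tendsto_0:
  fixes g :: "nat \<Rightarrow> nat \<Rightarrow> real"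
  assumes fin: "(\<integral>\<^sup>+j. \<integral>\<^sup>+i. ennreal (g i j ^ (2 * q)) \<partial>counting \<partial>counting) < \<infinity>"
  shows "((\<lambda>(i, j). g i j) \<longlongrightarrow> 0) (sequentially \<times>\<^sub>F sequentially)"
proof (rule tendstoI)
  fix \<epsilon> :: real assume \<epsilon>: "\<epsilon> > 0"
  define h where "h j = (\<integral>\<^sup>+i. ennreal (g i j ^ (2 * q)) \<partial>counting)" for j
  have h_sum: "(\<Sum>j. h j) < \<infinity>"
    using fin by (simp add: h_def[symmetric] nn_integral_count_space_nat)
  have h_fin: "h j < \<infinity>" for j
    using sum_le_suminf[of h "{j}"] h_sum by (auto intro: le_less_trans)
  have h_eq: "ennreal (enn2real (h j)) = h j" for j
    using h_fin[of j] by simp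
  have "summable (\<lambda>j. enn2real (h j))"
    using h_sum by (intro summable_suminf_not_top) (auto simp: h_eq)
  then have "\<forall>\<^sub>F j in sequentially. enn2real (h j) < \<epsilon> ^ (2 * q)"
    using \<epsilon> by (intro order_tendstoD(2)[OF summable_LIMSEQ_zero]) auto
  then have "\<forall>\<^sub>F j in sequentially. h j < ennreal (\<epsilon> ^ (2 * q))"
    by eventually_elim (metis h_eq enn2real_nonneg ennreal_less_iff)
  then obtain N where N: "\<And>j. j \<ge> N \<Longrightarrow> h j < ennreal (\<epsilon> ^ (2 * q))"
    by (auto simp: eventually_sequentially)
  have "\<bar>g i j\<bar> < \<epsilon>" if "j \<ge> N" for i j
  proof -
    have "ennreal (g i j ^ (2 * q)) \<le> h j"
      unfolding h_def by (rule nn_integral_ge_point) auto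
    also have "\<dots> < ennreal (\<epsilon> ^ (2 * q))" by (rule N[OF that])
    finally have "\<bar>g i j\<bar> ^ (2 * q) < \<epsilon> ^ (2 * q)"
      by (subst (asm) ennreal_less_iff) (auto simp: power_even_abs zero_le_even_power)
    then show ?thesis by (rule power_less_imp_less_base) (use \<epsilon> in simp)
  qed
  then show "\<forall>\<^sub>F p in sequentially \<times>\<^sub>F sequentially. dist (case p of (i, j) \<Rightarrow> g i j) 0 < \<epsilon>"
    unfolding eventually_prod_sequentially by (auto intro!: exI[of _ N])
qed

section \<open>Truncation of nonnegative arrays\<close>

lemma finite_double_nn_integral_ge_1:
  fixes f :: "nat \<Rightarrow> nat \<Rightarrow> ennreal"
  assumes fin: "(\<integral>\<^sup>+j. \<integral>\<^sup>+i. f i j \<partial>counting \<partial>counting) < \<infinity>"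
  shows "finite {p. 1 \<le> f (fst p) (snd p)}"
proof -
  let ?A = "{p. 1 \<le> f (fst p) (snd p)}"
  have "emeasure (count_space UNIV) ?A = (\<integral>\<^sup>+p. indicator ?A p \<partial>counting)"
    by simp
  also have "\<dots> \<le> (\<integral>\<^sup>+p. f (fst p) (snd p) \<partial>counting)"
    by (intro nn_integral_mono) (auto simp: indicator_def)
  also have "\<dots> = (\<integral>\<^sup>+j. \<integral>\<^sup>+i. f i j \<partial>counting \<partial>counting)"
    using nn_integral_snd_count_space[of "\<lambda>p. f (fst p) (snd p)"] by simp
  finally have "emeasure (count_space UNIV) ?A < \<infinity>" using fin by (rule le_less_trans)
  then show ?thesis by (simp add: emeasure_count_space split: if_splits)
qed

lemma nn_integral_double_count_swap:
  fixes f :: "nat \<Rightarrow> nat \<Rightarrow> 'a \<Rightarrow> ennreal"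
  assumes [measurable]: "\<And>i j. f i j \<in> borel_measurable M"
  shows "(\<integral>\<^sup>+\<omega>. \<integral>\<^sup>+j. \<integral>\<^sup>+i. f i j \<omega> \<partial>counting \<partial>counting \<partial>M) =
    (\<integral>\<^sup>+j. \<integral>\<^sup>+i. \<integral>\<^sup>+\<omega>. f i j \<omega> \<partial>M \<partial>counting \<partial>counting)"
  by (simp add: nn_integral_count_space_nat nn_integral_suminf)

lemma nn_integral_double_count_measurable:
  fixes f :: "nat \<Rightarrow> nat \<Rightarrow> 'a \<Rightarrow> ennreal"
  assumes [measurable]: "\<And>i j. f i j \<in> borel_measurable M"
  shows "(\<lambda>\<omega>. \<integral>\<^sup>+j. \<integral>\<^sup>+i. f i j \<omega> \<partial>counting \<partial>counting) \<in> borel_measurable M"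
  by (simp add: nn_integral_count_space_nat)

lemma AE_double_count_finite:
  fixes f :: "nat \<Rightarrow> nat \<Rightarrow> 'a \<Rightarrow> ennreal"
  assumes "\<And>i j. f i j \<in> borel_measurable M"
    and "(\<integral>\<^sup>+j. \<integral>\<^sup>+i. \<integral>\<^sup>+\<omega>. f i j \<omega> \<partial>M \<partial>counting \<partial>counting) < \<infinity>"
  shows "AE \<omega> in M. (\<integral>\<^sup>+j. \<integral>\<^sup>+i. f i j \<omega> \<partial>counting \<partial>counting) < \<infinity>"
  using nn_integral_PInf_AE[OF nn_integral_double_count_measurable[of f M]] assms
  by (auto simp: nn_integral_double_count_swap top.not_eq_extremum)

lemma log_plus_ge_1: "log_plus x \<ge> 1"
  by (simp add: log_plus_def)

lemma log_plus_measurable [measurable]: "log_plus \<in> borel_measurable borel"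
  unfolding log_plus_def[abs_def] by measurable

text \<open>W carries the common distribution. The conditional factor encodes both regimes of
  \<alpha> and \<beta> in one integrand, the very one that \<open>double_count_bound\<close>
  delivers.\<close>

locale nonneg_iid_array = prob_space M for M :: "'a measure" +
  fixes Z :: "nat \<times> nat \<Rightarrow> 'a \<Rightarrow> real" and W :: "'a \<Rightarrow> real" and \<alpha> \<beta> :: real
  assumes \<alpha>_pos: "0 < \<alpha>" and \<alpha>_le_\<beta>: "\<alpha> \<le> \<beta>" and \<beta>_le_1: "\<beta> \<le> 1"
    and indep: "indep_vars (\<lambda>_. borel) Z UNIV"
    and W_measurable [measurable]: "W \<in> borel_measurable M"
    and distr_eq: "\<And>p. distr M borel (Z p) = distr M borel W"
    and Z_nonneg: "\<And>p \<omega>. Z p \<omega> \<ge> 0" and W_nonneg: "\<And>\<omega>. W \<omega> \<ge> 0"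
    and W_integrable: "integrable M W"
    and moment: "integrable M (\<lambda>\<omega>. W \<omega> powr (1 / \<alpha>) * (if \<alpha> = \<beta> then log_plus (W \<omega>) else 1))"
begin

lemma \<beta>_pos: "0 < \<beta>" and \<alpha>_le_1: "\<alpha> \<le> 1"
  using \<alpha>_pos \<alpha>_le_\<beta> \<beta>_le_1 by auto

lemma Z_measurable [measurable]: "Z p \<in> borel_measurable M"
  using indep unfolding indep_vars_def by blast

lemma expectation_Z:
  fixes g :: "real \<Rightarrow> real"
  assumes [measurable]: "g \<in> borel_measurable borel"
  shows "expectation (\<lambda>\<omega>. g (Z p \<omega>)) = expectation (\<lambda>\<omega>. g (W \<omega>))"
proof -
  have "expectation (\<lambda>\<omega>. g (Z p \<omega>)) = integral\<^sup>L (distr M borel (Z p)) g"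
    by (rule integral_distr[symmetric]) auto
  also have "\<dots> = expectation (\<lambda>\<omega>. g (W \<omega>))"
    unfolding distr_eq by (rule integral_distr) auto
  finally show ?thesis .
qed

definition level :: "nat \<times> nat \<Rightarrow> real" where
  "level p = real (Suc (fst p)) powr \<alpha> * real (Suc (snd p)) powr \<beta>"

lemma level_pos: "level p > 0"
  by (simp add: level_def)

lemma level_mono: "k \<le> m \<Longrightarrow> l \<le> n \<Longrightarrow> level (k, l) \<le> level (m, n)"
  using \<alpha>_pos \<beta>_pos unfolding level_def by (intro mult_mono powr_mono2) auto

definition trunc :: "nat \<times> nat \<Rightarrow> real \<Rightarrow> real" where
  "trunc p x = (if x \<le> level p then x else 0)"

lemma trunc_measurable [measurable]: "trunc p \<in> borel_measurable borel"
  unfolding trunc_def[abs_def] by measurable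

lemma trunc_nonneg: "x \<ge> 0 \<Longrightarrow> trunc p x \<ge> 0"
  and trunc_le: "x \<ge> 0 \<Longrightarrow> trunc p x \<le> x"
  and trunc_le_level: "trunc p x \<le> level p"
  using level_pos[of p] by (auto simp: trunc_def)

lemma bounded_trunc_Z: "bounded_rv (\<lambda>\<omega>. trunc p (Z p \<omega>))"
  by (rule bounded_rvI[of _ "level p"]) (auto simp: trunc_nonneg trunc_le_level Z_nonneg abs_of_nonneg)

lemma bounded_trunc_W: "bounded_rv (\<lambda>\<omega>. trunc p (W \<omega>))"
  by (rule bounded_rvI[of _ "level p"]) (auto simp: trunc_nonneg trunc_le_level W_nonneg abs_of_nonneg)

text \<open>For r > 0 this is P(W > c) plus c^(-r) times the r-th moment of W restricted to W \<le>
  c. One counting estimate therefore serves both the number of truncated variables and the high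
  moments of those that remain.\<close>

definition tail_moment :: "real \<Rightarrow> real \<Rightarrow> real" where
  "tail_moment r c = expectation (\<lambda>\<omega>. min 1 ((W \<omega> / c) powr r))"

lemma nn_integral_tail_moment:
  "ennreal (tail_moment r c) = (\<integral>\<^sup>+\<omega>. ennreal (min 1 ((W \<omega> / c) powr r)) \<partial>M)"
  unfolding tail_moment_def
  by (rule nn_integral_eq_integral[symmetric])
    (auto intro!: bounded_rv_integrable bounded_rvI[of _ 1])

lemma tail_moment_nonneg: "tail_moment r c \<ge> 0"
  unfolding tail_moment_def by (rule Bochner_Integration.integral_nonneg) auto

text \<open>The double count is evaluated at x = W and integrated; exchanging sums and expectation
  turns it into the moment condition.\<close>

lemma tail_moment_sum_finite:
  assumes U: "linear_growth u \<phi> C" and V: "linear_growth v \<psi> D" and r: "\<alpha> * r > 1"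
  shows "(\<integral>\<^sup>+j. \<integral>\<^sup>+i. ennreal (\<phi> i * \<psi> j * tail_moment r (u i powr \<alpha> * v j powr \<beta>))
      \<partial>counting \<partial>counting) < \<infinity>"
proof -
  obtain K where K: "K \<ge> 0"
    "\<And>x. x \<ge> 0 \<Longrightarrow>
      (\<integral>\<^sup>+j. \<integral>\<^sup>+i. ennreal (\<phi> i * \<psi> j * min 1 ((x / (u i powr \<alpha> * v j powr \<beta>)) powr r)) \<partial>counting \<partial>counting)
      \<le> ennreal (K * (x powr (1 / \<alpha>) * (if \<alpha> = \<beta> then log_plus x else 1)))"
    using double_count_bound[OF U V \<alpha>_pos \<alpha>_le_\<beta> r] by blast
  have nonneg: "\<phi> i * \<psi> j \<ge> 0" for i j
    using linear_growth.\<phi>_nonneg[OF U] linear_growth.\<phi>_nonneg[OF V] by simp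
  have "(\<integral>\<^sup>+j. \<integral>\<^sup>+i. ennreal (\<phi> i * \<psi> j * tail_moment r (u i powr \<alpha> * v j powr \<beta>)) \<partial>counting \<partial>counting)
    = (\<integral>\<^sup>+j. \<integral>\<^sup>+i. \<integral>\<^sup>+\<omega>. ennreal (\<phi> i * \<psi> j * min 1 ((W \<omega> / (u i powr \<alpha> * v j powr \<beta>)) powr r)) \<partial>M \<partial>counting \<partial>counting)"
    by (intro nn_integral_cong)
      (simp add: ennreal_mult'[OF nonneg] nn_integral_tail_moment nn_integral_cmult)
  also have "\<dots> = (\<integral>\<^sup>+\<omega>. \<integral>\<^sup>+j. \<integral>\<^sup>+i. ennreal (\<phi> i * \<psi> j * min 1 ((W \<omega> / (u i powr \<alpha> * v j powr \<beta>)) powr r)) \<partial>counting \<partial>counting \<partial>M)"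
    by (rule nn_integral_double_count_swap[symmetric]) measurable
  also have "\<dots> \<le> (\<integral>\<^sup>+\<omega>. ennreal (K * (W \<omega> powr (1 / \<alpha>) * (if \<alpha> = \<beta> then log_plus (W \<omega>) else 1))) \<partial>M)"
    by (intro nn_integral_mono K W_nonneg)
  also have "\<dots> < \<infinity>"
    using integrable_mult_right[OF moment, of K]
    by (subst nn_integral_eq_integral) (auto simp: K W_nonneg intro!: mult_nonneg_nonneg order_trans[OF zero_le_one log_plus_ge_1])
  finally show ?thesis .
qed

lemma AE_finite_truncated: "AE \<omega> in M. finite {p. Z p \<omega> > level p}"
proof -
  \<comment> \<open>Any r with \<alpha> r > 1 would do; the minimum serves only to dominate the
    indicator of an exceedance.\<close>
  define r where "r = 2 / \<alpha>"
  have r: "r > 0" "\<alpha> * r > 1" using \<alpha>_pos by (auto simp: r_def)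
  let ?f = "\<lambda>i j \<omega>. ennreal (min 1 ((Z (i, j) \<omega> / level (i, j)) powr r))"
  have "(\<integral>\<^sup>+\<omega>. ?f i j \<omega> \<partial>M) = ennreal (1 * 1 * tail_moment r (real (Suc i) powr \<alpha> * real (Suc j) powr \<beta>))" for i j
  proof -
    have "(\<integral>\<^sup>+\<omega>. ?f i j \<omega> \<partial>M) = ennreal (expectation (\<lambda>\<omega>. min 1 ((Z (i, j) \<omega> / level (i, j)) powr r)))"
      by (rule nn_integral_eq_integral) (auto intro!: bounded_rv_integrable bounded_rvI[of _ 1])
    also have "\<dots> = ennreal (tail_moment r (level (i, j)))"
      unfolding tail_moment_def by (subst expectation_Z) auto
    finally show ?thesis by (simp add: level_def)
  qed
  then have "(\<integral>\<^sup>+j. \<integral>\<^sup>+i. \<integral>\<^sup>+\<omega>. ?f i j \<omega> \<partial>M \<partial>counting \<partial>counting) < \<infinity>"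
    using tail_moment_sum_finite[OF linear_growth_Suc linear_growth_Suc r(2)] by simp
  then have "AE \<omega> in M. (\<integral>\<^sup>+j. \<integral>\<^sup>+i. ?f i j \<omega> \<partial>counting \<partial>counting) < \<infinity>"
    by (intro AE_double_count_finite) auto
  then show ?thesis
  proof eventually_elim
    case (elim \<omega>)
    have "{p. Z p \<omega> > level p} \<subseteq> {p. 1 \<le> ?f (fst p) (snd p) \<omega>}"
    proof clarify
      fix a b assume "level (a, b) < Z (a, b) \<omega>"
      then have "1 \<le> (Z (a, b) \<omega> / level (a, b)) powr r"
        using level_pos[of "(a, b)"] r by (intro ge_one_powr_ge_zero) auto
      then show "1 \<le> ?f (fst (a, b)) (snd (a, b)) \<omega>" by simp
    qed
    then show ?case
      using finite_double_nn_integral_ge_1[OF elim] by (rule finite_subset)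
  qed
qed

text \<open>Since the level is at least (k + 1)^\<alpha> whatever l is, the expectation lost by
  truncation is at most g k. This tends to 0 by dominated convergence, and a Toeplitz argument in k
  alone completes the proof.\<close>

lemma expectation_trunc_tendsto:
  "((\<lambda>(m, n). cesaro_mean \<alpha> \<beta> (\<lambda>k l. expectation (\<lambda>\<omega>. trunc (k, l) (Z (k, l) \<omega>))) m n)
     \<longlongrightarrow> expectation W) (sequentially \<times>\<^sub>F sequentially)"
proof -
  define g where "g k = expectation (\<lambda>\<omega>. W \<omega> * indicator {real (Suc k) powr \<alpha><..} (W \<omega>))" for k
  have g_int: "integrable M (\<lambda>\<omega>. W \<omega> * indicator {c<..} (W \<omega>))" for c
    by (rule Bochner_Integration.integrable_bound[OF W_integrable]) (auto simp: indicator_def)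
  have g_lim: "g \<longlonglongrightarrow> 0"
  proof -
    have "(\<lambda>k. expectation (\<lambda>\<omega>. W \<omega> * indicator {real (Suc k) powr \<alpha><..} (W \<omega>))) \<longlonglongrightarrow> expectation (\<lambda>\<omega>. 0)"
    proof (rule integral_dominated_convergence[where w = W])
      show "AE \<omega> in M. (\<lambda>k. W \<omega> * indicator {real (Suc k) powr \<alpha><..} (W \<omega>)) \<longlonglongrightarrow> 0"
      proof (rule AE_I2)
        fix \<omega>
        have "filterlim (\<lambda>k. real (Suc k) powr \<alpha>) at_top sequentially"
          by (rule filterlim_compose[OF real_powr_at_top[OF \<alpha>_pos]
                filterlim_compose[OF filterlim_real_sequentially filterlim_Suc]])
        then have "\<forall>\<^sub>F k in sequentially. W \<omega> \<le> real (Suc k) powr \<alpha>"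
          by (simp add: filterlim_at_top)
        then have "\<forall>\<^sub>F k in sequentially. W \<omega> * indicator {real (Suc k) powr \<alpha><..} (W \<omega>) = 0"
          by eventually_elim (simp add: indicator_def)
        then show "(\<lambda>k. W \<omega> * indicator {real (Suc k) powr \<alpha><..} (W \<omega>)) \<longlonglongrightarrow> 0"
          by (rule tendsto_eventually)
      qed
      show "AE \<omega> in M. norm (W \<omega> * indicator {real (Suc k) powr \<alpha><..} (W \<omega>)) \<le> W \<omega>" for k
        by (auto simp: indicator_def W_nonneg)
    qed (auto intro: W_integrable)
    then show ?thesis unfolding g_def[abs_def] by simp
  qed
  define d where "d p = expectation W - expectation (\<lambda>\<omega>. trunc p (Z p \<omega>))" for p
  have d: "0 \<le> d (k, l)" "d (k, l) \<le> g k" for k l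
  proof -
    have d_eq: "d (k, l) = expectation (\<lambda>\<omega>. W \<omega> - trunc (k, l) (W \<omega>))"
      unfolding d_def by (subst expectation_Z)
        (auto intro!: Bochner_Integration.integral_diff[symmetric] W_integrable bounded_rv_integrable bounded_trunc_W)
    show "0 \<le> d (k, l)" unfolding d_eq
      by (intro Bochner_Integration.integral_nonneg) (simp add: trunc_le W_nonneg)
    have lev: "real (Suc k) powr \<alpha> \<le> level (k, l)"
      using ge_one_powr_ge_zero[of "real (Suc l)" \<beta>] \<beta>_pos
        mult_left_mono[of 1 "real (Suc l) powr \<beta>" "real (Suc k) powr \<alpha>"]
      by (simp add: level_def)
    show "d (k, l) \<le> g k" unfolding d_eq g_def
      using lev by (intro integral_mono g_int Bochner_Integration.integrable_diff W_integrable
          bounded_rv_integrable bounded_trunc_W)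
        (auto simp: trunc_def indicator_def W_nonneg)
  qed
  have eq: "cesaro_mean \<alpha> \<beta> (\<lambda>k l. expectation (\<lambda>\<omega>. trunc (k, l) (Z (k, l) \<omega>))) m n =
      expectation W - (\<Sum>k\<le>m. \<Sum>l\<le>n. cesaro_weight \<alpha> m k * cesaro_weight \<beta> n l * d (k, l))" for m n
  proof -
    have "(\<Sum>k\<le>m. \<Sum>l\<le>n. cesaro_weight \<alpha> m k * cesaro_weight \<beta> n l * expectation W) = expectation W"
      using sum_cesaro_weight[OF \<alpha>_pos, of m] sum_cesaro_weight[OF \<beta>_pos, of n]
      by (simp only: sum_distrib_right[symmetric] sum_distrib_left[symmetric] mult_1_left mult_1_right)
    then show ?thesis
      by (simp add: cesaro_mean_eq d_def right_diff_distrib sum_subtractf)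
  qed
  have bound: "norm (\<Sum>k\<le>m. \<Sum>l\<le>n. cesaro_weight \<alpha> m k * cesaro_weight \<beta> n l * d (k, l)) \<le>
      (\<Sum>k\<le>m. cesaro_weight \<alpha> m k * g k)" for m n
  proof -
    have a: "cesaro_weight \<alpha> m k \<ge> 0" and b: "cesaro_weight \<beta> n l \<ge> 0" for k l
      using cesaro_weight_nonneg \<alpha>_pos \<beta>_pos by auto
    have "norm (\<Sum>k\<le>m. \<Sum>l\<le>n. cesaro_weight \<alpha> m k * cesaro_weight \<beta> n l * d (k, l)) =
      (\<Sum>k\<le>m. \<Sum>l\<le>n. cesaro_weight \<alpha> m k * cesaro_weight \<beta> n l * d (k, l))"
      unfolding real_norm_def by (intro abs_of_nonneg sum_nonneg mult_nonneg_nonneg a b d)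
    also have "\<dots> \<le> (\<Sum>k\<le>m. \<Sum>l\<le>n. cesaro_weight \<alpha> m k * cesaro_weight \<beta> n l * g k)"
      by (intro sum_mono mult_left_mono d mult_nonneg_nonneg a b)
    also have "\<dots> = (\<Sum>k\<le>m. cesaro_weight \<alpha> m k * (\<Sum>l\<le>n. cesaro_weight \<beta> n l) * g k)"
      by (simp only: sum_distrib_right[symmetric] sum_distrib_left[symmetric])
    finally show ?thesis using sum_cesaro_weight[OF \<beta>_pos, of n] by simp
  qed
  have "((\<lambda>p. \<Sum>k\<le>fst p. \<Sum>l\<le>snd p. cesaro_weight \<alpha> (fst p) k * cesaro_weight \<beta> (snd p) l * d (k, l)) \<longlongrightarrow> 0)
      (sequentially \<times>\<^sub>F sequentially)"
    by (rule Lim_null_comparison[OF _ filterlim_compose[OF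
          Toeplitz_cesaro_weight[OF \<alpha>_pos \<alpha>_le_1 g_lim] filterlim_fst]])
      (intro always_eventually allI bound)
  from tendsto_diff[OF tendsto_const[of "expectation W"] this]
  show ?thesis by (simp add: eq case_prod_unfold)
qed

end

section \<open>Moments of the centred truncated means\<close>

lemma power_diff_even_le:
  fixes x y :: real
  assumes "x \<ge> 0" "y \<ge> 0"
  shows "(x - y) ^ (2 * q) \<le> x ^ (2 * q) + y ^ (2 * q)"
proof -
  have "(x - y) ^ (2 * q) = \<bar>x - y\<bar> ^ (2 * q)" by (simp add: power_even_abs)
  also have "\<dots> \<le> (max x y) ^ (2 * q)" using assms by (intro power_mono) auto
  also have "\<dots> \<le> x ^ (2 * q) + y ^ (2 * q)" using assms by (auto simp: max_def)
  finally show ?thesis .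
qed

lemma nn_integral_double_product:
  fixes f g :: "nat \<Rightarrow> real"
  assumes "\<And>i. f i \<ge> 0" "\<And>i. g i \<ge> 0"
    and "(\<integral>\<^sup>+i. ennreal (f i) \<partial>counting) < \<infinity>" "(\<integral>\<^sup>+j. ennreal (g j) \<partial>counting) < \<infinity>"
  shows "(\<integral>\<^sup>+j. \<integral>\<^sup>+i. ennreal (f i * g j) \<partial>counting \<partial>counting) < \<infinity>"
proof -
  have "(\<integral>\<^sup>+j. \<integral>\<^sup>+i. ennreal (f i * g j) \<partial>counting \<partial>counting) =
    (\<integral>\<^sup>+i. ennreal (f i) \<partial>counting) * (\<integral>\<^sup>+j. ennreal (g j) \<partial>counting)"
    using assms(1,2) by (simp add: ennreal_mult nn_integral_cmult nn_integral_multc)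
  then show ?thesis using assms(3,4) by (simp add: ennreal_mult_less_top)
qed

context nonneg_iid_array
begin

definition centred :: "nat \<times> nat \<Rightarrow> 'a \<Rightarrow> real" where
  "centred p \<omega> = trunc p (Z p \<omega>) - expectation (\<lambda>\<omega>. trunc p (Z p \<omega>))"

definition fluct :: "nat \<Rightarrow> nat \<Rightarrow> 'a \<Rightarrow> real" where
  "fluct m n \<omega> = cesaro_mean \<alpha> \<beta> (\<lambda>k l. centred (k, l) \<omega>) m n"

definition wt :: "nat \<Rightarrow> nat \<Rightarrow> nat \<times> nat \<Rightarrow> real" where
  "wt m n p = cesaro_weight \<alpha> m (fst p) * cesaro_weight \<beta> n (snd p)"

lemma wt_nonneg: "wt m n p \<ge> 0"
  using cesaro_weight_nonneg \<alpha>_pos \<beta>_pos by (simp add: wt_def)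

lemma fluct_eq: "fluct m n \<omega> = (\<Sum>p\<in>{..m} \<times> {..n}. wt m n p * centred p \<omega>)"
  by (simp add: fluct_def cesaro_mean_eq_pairs wt_def)

lemma bounded_centred: "bounded_rv (centred p)"
  unfolding centred_def[abs_def] by (intro bounded_rv_intros bounded_trunc_Z)

lemma expectation_centred: "expectation (centred p) = 0"
  unfolding centred_def[abs_def]
  by (subst Bochner_Integration.integral_diff) (auto intro: bounded_rv_integrable bounded_trunc_Z simp: prob_space)

lemma fluct_measurable [measurable]: "fluct m n \<in> borel_measurable M"
  unfolding fluct_eq[abs_def]
  by (intro bounded_rv_measurable bounded_rv_intros bounded_centred)

lemma sum_wt_powr:
  "(\<Sum>p\<in>{..m} \<times> {..n}. wt m n p powr s) =
     (\<Sum>k\<le>m. cesaro_weight \<alpha> m k powr s) * (\<Sum>l\<le>n. cesaro_weight \<beta> n l powr s)"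
  using cesaro_weight_nonneg[of \<alpha>] cesaro_weight_nonneg[of \<beta>] \<alpha>_pos \<beta>_pos
  by (simp add: wt_def powr_mult sum_product sum.cartesian_product case_prod_unfold)

lemma fluct_moment_le:
  assumes "q \<ge> 1"
  obtains C where "C \<ge> 0"
    "\<And>m n. expectation (\<lambda>\<omega>. fluct m n \<omega> ^ (2 * q)) \<le>
      C * ((\<Sum>p\<in>{..m} \<times> {..n}. expectation (\<lambda>\<omega>. (wt m n p * centred p \<omega>) ^ (2 * q))) +
           (\<Sum>p\<in>{..m} \<times> {..n}. expectation (\<lambda>\<omega>. (wt m n p * centred p \<omega>)\<^sup>2)) ^ q)"
proof -
  show ?thesis
  proof (rule rosenthal_even[OF assms])
    fix C assume C: "C \<ge> 0"
    "\<And>(I :: (nat \<times> nat) set) Y. finite I \<Longrightarrow> indep_vars (\<lambda>_. borel) Y I \<Longrightarrow>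
       (\<And>i. i \<in> I \<Longrightarrow> bounded_rv (Y i)) \<Longrightarrow> (\<And>i. i \<in> I \<Longrightarrow> expectation (Y i) = 0) \<Longrightarrow>
       expectation (\<lambda>\<omega>. (\<Sum>i\<in>I. Y i \<omega>) ^ (2 * q)) \<le>
       C * ((\<Sum>i\<in>I. expectation (\<lambda>\<omega>. Y i \<omega> ^ (2 * q))) + (\<Sum>i\<in>I. expectation (\<lambda>\<omega>. (Y i \<omega>)\<^sup>2)) ^ q)"
    show ?thesis
  proof (rule that[OF C(1)])
    fix m n
    have "indep_vars (\<lambda>_. borel) (\<lambda>p \<omega>. (\<lambda>x. wt m n p * (trunc p x - expectation (\<lambda>\<omega>. trunc p (Z p \<omega>)))) (Z p \<omega>)) ({..m} \<times> {..n})"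
      by (rule indep_vars_compose2[OF indep_vars_subset[OF indep]]) auto
    then have ind: "indep_vars (\<lambda>_. borel) (\<lambda>p \<omega>. wt m n p * centred p \<omega>) ({..m} \<times> {..n})"
      by (simp add: centred_def)
    show "expectation (\<lambda>\<omega>. fluct m n \<omega> ^ (2 * q)) \<le>
      C * ((\<Sum>p\<in>{..m} \<times> {..n}. expectation (\<lambda>\<omega>. (wt m n p * centred p \<omega>) ^ (2 * q))) +
           (\<Sum>p\<in>{..m} \<times> {..n}. expectation (\<lambda>\<omega>. (wt m n p * centred p \<omega>)\<^sup>2)) ^ q)"
      unfolding fluct_eq
      by (rule C(2)) (auto intro: ind bounded_rv_intros bounded_centred simp: expectation_centred)
    qed
  qed
qed

text \<open>All levels inside the box are at most \<open>level (m, n)\<close>, so a value that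
  survives truncation has ratio at most 1 to it and the minimum in \<open>tail_moment\<close> is
  inactive. The power of the level is split between the two weight sums, whose decay it cancels up
  to the sampling weights.\<close>

lemma sum_high_moments_le:
  assumes "q \<ge> 1"
  shows "(\<Sum>p\<in>{..m} \<times> {..n}. expectation (\<lambda>\<omega>. (wt m n p * centred p \<omega>) ^ (2 * q))) \<le>
    2 * ((\<Sum>k\<le>m. cesaro_weight \<alpha> m k powr real (2 * q)) * real (Suc m) powr (\<alpha> * real (2 * q))) *
      ((\<Sum>l\<le>n. cesaro_weight \<beta> n l powr real (2 * q)) * real (Suc n) powr (\<beta> * real (2 * q))) *
      tail_moment (real (2 * q)) (level (m, n))"
proof -
  let ?r = "real (2 * q)" and ?c = "level (m, n)"
  have powr_r: "x powr ?r = x ^ (2 * q)" if "x \<ge> 0" for x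
    using that assms by (cases "x = 0") (auto simp: powr_realpow simp del: of_nat_mult)
  have term_le: "expectation (\<lambda>\<omega>. (wt m n p * centred p \<omega>) ^ (2 * q)) \<le>
      wt m n p powr ?r * (2 * (?c powr ?r * tail_moment ?r ?c))"
    if "p \<in> {..m} \<times> {..n}" for p
  proof -
    let ?T = "\<lambda>\<omega>. trunc p (Z p \<omega>)"
    have int: "integrable M ?T" "integrable M (\<lambda>\<omega>. ?T \<omega> ^ (2 * q))"
      by (intro bounded_rv_integrable bounded_rv_intros bounded_trunc_Z)+
    have T: "?T \<omega> \<ge> 0" for \<omega> by (simp add: trunc_nonneg Z_nonneg)
    have jensen: "(expectation ?T) ^ (2 * q) \<le> expectation (\<lambda>\<omega>. ?T \<omega> ^ (2 * q))"
      by (rule jensens_inequality[where I = UNIV and q = "\<lambda>x. x ^ (2 * q)"])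
        (auto intro: int convex_power_even)
    \<comment> \<open>Centring costs a factor 2: the power of a difference of nonnegative numbers is
      at most the sum of the powers, and Jensen's inequality bounds the second of them by the first
      in expectation.\<close>
    have "expectation (\<lambda>\<omega>. centred p \<omega> ^ (2 * q)) \<le>
        expectation (\<lambda>\<omega>. ?T \<omega> ^ (2 * q) + (expectation ?T) ^ (2 * q))"
      unfolding centred_def
      by (intro integral_mono bounded_rv_integrable bounded_rv_intros bounded_trunc_Z power_diff_even_le
          T Bochner_Integration.integral_nonneg)
    also have "\<dots> = expectation (\<lambda>\<omega>. ?T \<omega> ^ (2 * q)) + (expectation ?T) ^ (2 * q)"
      using int by (subst Bochner_Integration.integral_add) (auto simp: prob_space)
    also have "\<dots> \<le> 2 * expectation (\<lambda>\<omega>. ?T \<omega> ^ (2 * q))"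
      using jensen by simp
    also have "expectation (\<lambda>\<omega>. ?T \<omega> ^ (2 * q)) = expectation (\<lambda>\<omega>. trunc p (W \<omega>) ^ (2 * q))"
      by (rule expectation_Z) measurable
    also have "2 * expectation (\<lambda>\<omega>. trunc p (W \<omega>) ^ (2 * q)) \<le> 2 * (?c powr ?r * tail_moment ?r ?c)"
    proof -
      have "expectation (\<lambda>\<omega>. trunc p (W \<omega>) ^ (2 * q)) \<le> expectation (\<lambda>\<omega>. ?c powr ?r * min 1 ((W \<omega> / ?c) powr ?r))"
      proof (intro integral_mono bounded_rv_integrable bounded_rv_intros bounded_trunc_W)
        show "bounded_rv (\<lambda>\<omega>. min 1 ((W \<omega> / ?c) powr ?r))"
          by (rule bounded_rvI[of _ 1]) auto
        fix \<omega>
        show "trunc p (W \<omega>) ^ (2 * q) \<le> ?c powr ?r * min 1 ((W \<omega> / ?c) powr ?r)"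
        proof (cases "W \<omega> \<le> level p")
          case True
          also have "level p \<le> ?c" using that level_mono[of "fst p" m "snd p" n] by auto
          finally have le: "W \<omega> / ?c \<le> 1" using level_pos[of "(m, n)"] by simp
          then have "(W \<omega> / ?c) powr ?r \<le> 1" using W_nonneg[of \<omega>] level_pos[of "(m, n)"]
            by (intro powr_le1) auto
          then have "?c powr ?r * min 1 ((W \<omega> / ?c) powr ?r) = (?c * (W \<omega> / ?c)) powr ?r"
            using W_nonneg[of \<omega>] level_pos[of "(m, n)"] by (subst powr_mult) (auto simp: min_def)
          also have "\<dots> = W \<omega> ^ (2 * q)"
            using W_nonneg[of \<omega>] level_pos[of "(m, n)"] by (simp add: powr_r del: of_nat_mult)
          finally show ?thesis using True by (simp add: trunc_def)
        next
          case False
          then have "trunc p (W \<omega>) ^ (2 * q) = 0" using assms by (simp add: trunc_def)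
          moreover have "0 \<le> ?c powr ?r * min 1 ((W \<omega> / ?c) powr ?r)" by simp
          ultimately show ?thesis by (simp only:)
        qed
      qed
      then show ?thesis by (simp add: tail_moment_def)
    qed
    finally have "expectation (\<lambda>\<omega>. centred p \<omega> ^ (2 * q)) \<le> 2 * (?c powr ?r * tail_moment ?r ?c)" .
    then have "wt m n p ^ (2 * q) * expectation (\<lambda>\<omega>. centred p \<omega> ^ (2 * q)) \<le>
        wt m n p ^ (2 * q) * (2 * (?c powr ?r * tail_moment ?r ?c))"
      by (intro mult_left_mono) (auto simp: wt_nonneg)
    then show ?thesis
      by (simp add: power_mult_distrib powr_r wt_nonneg del: of_nat_mult)
  qed
  have "(\<Sum>p\<in>{..m} \<times> {..n}. expectation (\<lambda>\<omega>. (wt m n p * centred p \<omega>) ^ (2 * q))) \<le>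
    (\<Sum>p\<in>{..m} \<times> {..n}. wt m n p powr ?r * (2 * (?c powr ?r * tail_moment ?r ?c)))"
    by (intro sum_mono term_le)
  also have "\<dots> = (\<Sum>k\<le>m. cesaro_weight \<alpha> m k powr ?r) * (\<Sum>l\<le>n. cesaro_weight \<beta> n l powr ?r) *
      (2 * (?c powr ?r * tail_moment ?r ?c))"
    unfolding sum_distrib_right[symmetric] sum_wt_powr by simp
  also have "?c powr ?r = real (Suc m) powr (\<alpha> * ?r) * real (Suc n) powr (\<beta> * ?r)"
    by (simp add: level_def powr_mult powr_powr del: of_nat_mult of_nat_Suc)
  finally show ?thesis by (simp add: mult_ac del: of_nat_mult of_nat_Suc)
qed

lemma sum_variances_le:
  assumes s: "1 \<le> s" "s \<le> 2" and int: "integrable M (\<lambda>\<omega>. W \<omega> powr s)"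
  shows "(\<Sum>p\<in>{..m} \<times> {..n}. expectation (\<lambda>\<omega>. (wt m n p * centred p \<omega>)\<^sup>2)) \<le>
    expectation (\<lambda>\<omega>. W \<omega> powr s) * (real (Suc m) powr (- \<alpha> * (s - 1)) * real (Suc n) powr (- \<beta> * (s - 1)))"
proof -
  have term_le: "expectation (\<lambda>\<omega>. (wt m n p * centred p \<omega>)\<^sup>2) \<le> wt m n p powr s * expectation (\<lambda>\<omega>. W \<omega> powr s)"
    if "p \<in> {..m} \<times> {..n}" for p
  proof -
    let ?T = "\<lambda>\<omega>. trunc p (Z p \<omega>)"
    have int2: "integrable M ?T" "integrable M (\<lambda>\<omega>. (?T \<omega>)\<^sup>2)"
      by (intro bounded_rv_integrable bounded_rv_intros bounded_trunc_Z)+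
    have "expectation (\<lambda>\<omega>. (centred p \<omega>)\<^sup>2) = expectation (\<lambda>\<omega>. (?T \<omega>)\<^sup>2) - (expectation ?T)\<^sup>2"
      unfolding centred_def by (rule variance_eq[OF int2])
    also have "\<dots> \<le> expectation (\<lambda>\<omega>. (?T \<omega>)\<^sup>2)" by simp
    also have "\<dots> = expectation (\<lambda>\<omega>. (trunc p (W \<omega>))\<^sup>2)"
      by (rule expectation_Z) measurable
    finally have "(wt m n p)\<^sup>2 * expectation (\<lambda>\<omega>. (centred p \<omega>)\<^sup>2) \<le> (wt m n p)\<^sup>2 * expectation (\<lambda>\<omega>. (trunc p (W \<omega>))\<^sup>2)"
      by (intro mult_left_mono) auto
    then have "expectation (\<lambda>\<omega>. (wt m n p * centred p \<omega>)\<^sup>2) \<le> expectation (\<lambda>\<omega>. (wt m n p * trunc p (W \<omega>))\<^sup>2)"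
      by (simp add: power_mult_distrib)
    also have "\<dots> \<le> expectation (\<lambda>\<omega>. wt m n p powr s * W \<omega> powr s)"
    proof (rule integral_mono)
      show "integrable M (\<lambda>\<omega>. (wt m n p * trunc p (W \<omega>))\<^sup>2)"
        by (intro bounded_rv_integrable bounded_rv_intros bounded_trunc_W)
      show "integrable M (\<lambda>\<omega>. wt m n p powr s * W \<omega> powr s)"
        using int by simp
      fix \<omega>
      \<comment> \<open>The weight is at most the reciprocal of \<open>level (m, n)\<close>, so 0
        \<le> y \<le> 1 and y^2 \<le> y^s: the second moment, possibly infinite for W itself, is
        traded for the s-th.\<close>
      define y where "y = wt m n p * trunc p (W \<omega>)"
      have y0: "y \<ge> 0" by (simp add: y_def wt_nonneg trunc_nonneg W_nonneg)
      have "wt m n p \<le> real (Suc m) powr - \<alpha> * real (Suc n) powr - \<beta>"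
        unfolding wt_def using \<alpha>_pos \<alpha>_le_1 \<beta>_pos \<beta>_le_1
        by (intro mult_mono cesaro_weight_le_powr) (auto simp: cesaro_weight_nonneg)
      moreover have "trunc p (W \<omega>) \<le> level (m, n)"
        using that level_mono[of "fst p" m "snd p" n] by (intro order_trans[OF trunc_le_level]) auto
      ultimately have "y \<le> (real (Suc m) powr - \<alpha> * real (Suc n) powr - \<beta>) * level (m, n)"
        unfolding y_def by (intro mult_mono) (auto simp: trunc_nonneg W_nonneg)
      also have "\<dots> = 1" by (simp add: level_def powr_minus field_simps)
      finally have y1: "y \<le> 1" .
      have "y\<^sup>2 = y powr 2" using y0 by simp
      also have "\<dots> \<le> y powr s" using y0 y1 s by (intro powr_mono') auto
      also have "\<dots> \<le> (wt m n p * W \<omega>) powr s"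
        using s y0 unfolding y_def by (intro powr_mono2 mult_left_mono trunc_le W_nonneg wt_nonneg) auto
      also have "\<dots> = wt m n p powr s * W \<omega> powr s"
        by (simp add: powr_mult wt_nonneg W_nonneg)
      finally show "(wt m n p * trunc p (W \<omega>))\<^sup>2 \<le> wt m n p powr s * W \<omega> powr s"
        by (simp add: y_def)
    qed
    finally show ?thesis by simp
  qed
  have "(\<Sum>p\<in>{..m} \<times> {..n}. expectation (\<lambda>\<omega>. (wt m n p * centred p \<omega>)\<^sup>2)) \<le>
      (\<Sum>p\<in>{..m} \<times> {..n}. wt m n p powr s * expectation (\<lambda>\<omega>. W \<omega> powr s))"
    by (intro sum_mono term_le)
  also have "\<dots> = expectation (\<lambda>\<omega>. W \<omega> powr s) *
      ((\<Sum>k\<le>m. cesaro_weight \<alpha> m k powr s) * (\<Sum>l\<le>n. cesaro_weight \<beta> n l powr s))"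
    unfolding sum_distrib_right[symmetric] sum_wt_powr by simp
  also have "\<dots> \<le> expectation (\<lambda>\<omega>. W \<omega> powr s) *
      (real (Suc m) powr (- \<alpha> * (s - 1)) * real (Suc n) powr (- \<beta> * (s - 1)))"
    using s \<alpha>_pos \<alpha>_le_1 \<beta>_pos \<beta>_le_1
    by (intro mult_left_mono mult_mono sum_cesaro_weight_powr_le) (auto intro!: sum_nonneg)
  finally show ?thesis .
qed

text \<open>In Rosenthal's bound the sum of high moments is summable by
  \<open>tail_moment_sum_finite\<close> for large q. The variance term decays like a power with
  exponent proportional to q, provided that W has a moment of some order s > 1.\<close>

lemma fluct_moment_sum_finite:
  obtains q where "q \<ge> 1"
    "\<And>\<theta> e \<phi> C f \<psi> D. cesaro_sampling \<alpha> \<theta> e \<phi> C \<Longrightarrow> cesaro_sampling \<beta> \<theta> f \<psi> D \<Longrightarrow>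
      (\<integral>\<^sup>+j. \<integral>\<^sup>+i. ennreal (expectation (\<lambda>\<omega>. fluct (e i) (f j) \<omega> ^ (2 * q))) \<partial>counting \<partial>counting) < \<infinity>"
proof -
  \<comment> \<open>The largest order up to 2 for which the moment condition guarantees a finite
    s-th moment; s = 1 exactly when \<alpha> = 1.\<close>
  define s where "s = min 2 (1 / \<alpha>)"
  define Q where "Q q m n = (\<Sum>p\<in>{..m} \<times> {..n}. expectation (\<lambda>\<omega>. (wt m n p * centred p \<omega>) ^ (2 * q)))" for q m n
  define V where "V m n = (\<Sum>p\<in>{..m} \<times> {..n}. expectation (\<lambda>\<omega>. (wt m n p * centred p \<omega>)\<^sup>2))" for m n
  define \<kappa> where "\<kappa> = \<alpha> * (s - 1)"
  have s1: "1 \<le> s" "s \<le> 2" using \<alpha>_pos \<alpha>_le_1 by (auto simp: s_def)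
  \<comment> \<open>The conditions serve, in turn, the counting estimate, the two weight sums of
    order below 1, and the variance term. If \<alpha> = 1, then \<beta> = 1 and \<kappa> = 0, so the
    last condition must be replaced by q = 1.\<close>
  obtain q :: nat where q: "q \<ge> 1" "\<alpha> * real (2 * q) > 1"
    and q\<alpha>: "\<alpha> = 1 \<or> (1 - \<alpha>) * real (2 * q) > 1" and q\<beta>: "\<beta> = 1 \<or> (1 - \<beta>) * real (2 * q) > 1"
    and qV: "(\<alpha> = 1 \<and> q = 1) \<or> \<kappa> * real q > 1"
  proof (cases "\<alpha> = 1")
    case True
    then show ?thesis using that[of 1] \<alpha>_le_\<beta> \<beta>_le_1 by auto
  next
    case False
    then have \<alpha>1: "\<alpha> < 1" using \<alpha>_le_1 by simp
    then have "s > 1" using \<alpha>_pos by (auto simp: s_def)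
    then have \<kappa>_pos: "\<kappa> > 0" using \<alpha>_pos by (simp add: \<kappa>_def)
    \<comment> \<open>A common positive lower bound for all coefficients that q multiplies; 1 -
      \<beta> is left out when it vanishes, in which case no condition on \<beta> is
      required.\<close>
    define d where "d = (if \<beta> = 1 then \<kappa> else min \<kappa> (1 - \<beta>))"
    define d' where "d' = min d (min \<alpha> (1 - \<alpha>))"
    have d': "d' > 0" "d' \<le> \<kappa>" "d' \<le> \<alpha>" "d' \<le> 1 - \<alpha>" "\<beta> = 1 \<or> d' \<le> 1 - \<beta>"
      using \<kappa>_pos \<alpha>1 \<alpha>_pos \<beta>_le_1 by (auto simp: d'_def d_def)
    obtain q0 :: nat where "1 / d' < real q0" using reals_Archimedean2 by blast
    then have q0: "1 < d' * real q0" using d' by (simp add: field_simps)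
    then have "q0 \<noteq> 0" by (intro notI) simp
    have big: "1 < x * real q0" "1 < x * real (2 * q0)" if "d' \<le> x" for x
    proof -
      have "d' * real q0 \<le> x * real q0" using that by (intro mult_right_mono) auto
      then show a: "1 < x * real q0" using q0 by linarith
      moreover have "x * real (2 * q0) = 2 * (x * real q0)" by simp
      ultimately show "1 < x * real (2 * q0)" by linarith
    qed
    show ?thesis
      using that[of q0] big d' \<open>q0 \<noteq> 0\<close> by (metis One_nat_def Suc_leI neq0_conv)
  qed
  obtain R where R: "R \<ge> 0" "\<And>m n. expectation (\<lambda>\<omega>. fluct m n \<omega> ^ (2 * q)) \<le> R * (Q q m n + V m n ^ q)"
    using fluct_moment_le[OF q(1)] unfolding Q_def V_def by blast
  show ?thesis
  proof (rule that[OF q(1)])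
    fix \<theta> e \<phi> C f \<psi> D
    assume S1: "cesaro_sampling \<alpha> \<theta> e \<phi> C" and S2: "cesaro_sampling \<beta> \<theta> f \<psi> D"
    define u v where "u i = real (Suc (e i))" and "v j = real (Suc (f j))" for i j
    have U: "linear_growth u \<phi> C" and V': "linear_growth v \<psi> D"
      unfolding u_def[abs_def] v_def[abs_def]
      by (rule linear_growth_cesaro_sampling[OF S1], rule linear_growth_cesaro_sampling[OF S2])
    have \<phi>1: "\<phi> i \<ge> 1" and \<psi>1: "\<psi> i \<ge> 1" for i
      using S1 S2 by (auto simp: cesaro_sampling_def)
    have u1: "u i \<ge> 1" and v1: "v i \<ge> 1" for i by (auto simp: u_def v_def)
    have "\<exists>K. \<forall>i. (\<Sum>k\<le>e i. cesaro_weight \<alpha> (e i) k powr real (2 * q)) \<le> K * \<phi> i * real (Suc (e i)) powr (- \<alpha> * real (2 * q))"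
      using S1 q\<alpha> unfolding cesaro_sampling_def by blast
    then obtain K where K: "\<And>i. (\<Sum>k\<le>e i. cesaro_weight \<alpha> (e i) k powr real (2 * q)) \<le> K * \<phi> i * u i powr (- \<alpha> * real (2 * q))"
      unfolding u_def by blast
    have "\<exists>K. \<forall>i. (\<Sum>k\<le>f i. cesaro_weight \<beta> (f i) k powr real (2 * q)) \<le> K * \<psi> i * real (Suc (f i)) powr (- \<beta> * real (2 * q))"
      using S2 q\<beta> unfolding cesaro_sampling_def by blast
    then obtain L where L: "\<And>i. (\<Sum>k\<le>f i. cesaro_weight \<beta> (f i) k powr real (2 * q)) \<le> L * \<psi> i * v i powr (- \<beta> * real (2 * q))"
      unfolding v_def by blast
    let ?tm = "\<lambda>i j. tail_moment (real (2 * q)) (u i powr \<alpha> * v j powr \<beta>)"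
    have A: "(\<Sum>k\<le>e i. cesaro_weight \<alpha> (e i) k powr real (2 * q)) * u i powr (\<alpha> * real (2 * q)) \<le> K * \<phi> i" for i
    proof -
      have "(\<Sum>k\<le>e i. cesaro_weight \<alpha> (e i) k powr real (2 * q)) * u i powr (\<alpha> * real (2 * q)) \<le>
        K * \<phi> i * u i powr (- \<alpha> * real (2 * q)) * u i powr (\<alpha> * real (2 * q))"
        by (intro mult_right_mono K) auto
      also have "\<dots> = K * \<phi> i" using u1[of i] by (simp add: mult.assoc powr_add[symmetric])
      finally show ?thesis .
    qed
    have B: "(\<Sum>k\<le>f i. cesaro_weight \<beta> (f i) k powr real (2 * q)) * v i powr (\<beta> * real (2 * q)) \<le> L * \<psi> i" for i
    proof -
      have "(\<Sum>k\<le>f i. cesaro_weight \<beta> (f i) k powr real (2 * q)) * v i powr (\<beta> * real (2 * q)) \<le>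
        L * \<psi> i * v i powr (- \<beta> * real (2 * q)) * v i powr (\<beta> * real (2 * q))"
        by (intro mult_right_mono L) auto
      also have "\<dots> = L * \<psi> i" using v1[of i] by (simp add: mult.assoc powr_add[symmetric])
      finally show ?thesis .
    qed
    have Q_le: "Q q (e i) (f j) \<le> 2 * K * L * (\<phi> i * \<psi> j * ?tm i j)" for i j
    proof -
      have "Q q (e i) (f j) \<le> 2 * ((\<Sum>k\<le>e i. cesaro_weight \<alpha> (e i) k powr real (2 * q)) * u i powr (\<alpha> * real (2 * q))) *
        ((\<Sum>k\<le>f j. cesaro_weight \<beta> (f j) k powr real (2 * q)) * v j powr (\<beta> * real (2 * q))) * ?tm i j"
        using sum_high_moments_le[OF q(1), of "e i" "f j"] unfolding Q_def u_def v_def level_def fst_conv snd_conv .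
      also have "\<dots> \<le> 2 * (K * \<phi> i) * (L * \<psi> j) * ?tm i j"
        using order_trans[OF mult_nonneg_nonneg[OF sum_nonneg] A, of i]
        by (intro mult_right_mono mult_mono A B mult_left_mono tail_moment_nonneg) (auto intro!: sum_nonneg mult_nonneg_nonneg)
      finally show ?thesis by (simp add: mult_ac)
    qed
    have tm_fin: "(\<integral>\<^sup>+j. \<integral>\<^sup>+i. ennreal (\<phi> i * \<psi> j * ?tm i j) \<partial>counting \<partial>counting) < \<infinity>"
      by (rule tail_moment_sum_finite[OF U V' q(2)])
    have tm_nonneg: "\<phi> i * \<psi> j * ?tm i j \<ge> 0" for i j
      using \<phi>1[of i] \<psi>1[of j] tail_moment_nonneg by (intro mult_nonneg_nonneg) auto
    \<comment> \<open>One shape for both cases: a multiple of the summable counting term plus a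
      product of two summable sequences. The case \<alpha> = q = 1 uses the first part only, the
      other case the second only.\<close>
    have Vq: "\<exists>G \<ge> 0. \<exists>x y. (\<forall>i. x i \<ge> 0) \<and> (\<forall>j. y j \<ge> 0) \<and>
      (\<forall>i j. V (e i) (f j) ^ q \<le> G * (\<phi> i * \<psi> j * ?tm i j) + x i * y j) \<and>
      (\<integral>\<^sup>+i. ennreal (x i) \<partial>counting) < \<infinity> \<and> (\<integral>\<^sup>+j. ennreal (y j) \<partial>counting) < \<infinity>"
      using qV
    proof
      assume "\<alpha> = 1 \<and> q = 1"
      \<comment> \<open>For q = 1 the variance sum is literally the high-moment sum, so its lack of
        power decay is harmless.\<close>
      then have "V (e i) (f j) ^ q = Q q (e i) (f j)" for i j by (simp add: V_def Q_def)
      moreover have "Q q (e i) (f j) \<le> \<bar>2 * K * L\<bar> * (\<phi> i * \<psi> j * ?tm i j)" for i j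
        by (rule order_trans[OF Q_le mult_right_mono[OF abs_ge_self tm_nonneg]])
      ultimately show ?thesis
        by (intro exI[of _ "\<bar>2 * K * L\<bar>"] conjI exI[of _ "\<lambda>_. 0"]) auto
    next
      assume \<kappa>q: "\<kappa> * real q > 1"
      define \<kappa>' where "\<kappa>' = \<beta> * (s - 1)"
      have "\<kappa>' * real q \<ge> \<kappa> * real q"
        unfolding \<kappa>'_def \<kappa>_def using \<alpha>_le_\<beta> s1 by (intro mult_right_mono) auto
      then have \<kappa>'q: "\<kappa>' * real q > 1" using \<kappa>q by linarith
      have int_s: "integrable M (\<lambda>\<omega>. W \<omega> powr s)"
      proof (rule Bochner_Integration.integrable_bound)
        show "integrable M (\<lambda>\<omega>. 1 + W \<omega> powr (1 / \<alpha>) * (if \<alpha> = \<beta> then log_plus (W \<omega>) else 1))"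
          using moment by simp
        show "AE \<omega> in M. norm (W \<omega> powr s) \<le>
            norm (1 + W \<omega> powr (1 / \<alpha>) * (if \<alpha> = \<beta> then log_plus (W \<omega>) else 1))"
        proof (rule AE_I2)
          fix \<omega>
          define l where "l = (if \<alpha> = \<beta> then log_plus (W \<omega>) else 1)"
          have l: "l \<ge> 1" using log_plus_ge_1 by (simp add: l_def)
          have "W \<omega> powr s \<le> 1 + W \<omega> powr (1 / \<alpha>)"
          proof (cases "W \<omega> \<le> 1")
            case True
            then have "W \<omega> powr s \<le> 1" using s1 W_nonneg by (intro powr_le1) auto
            then show ?thesis by (simp add: add_increasing2)
          next
            case False
            then have "W \<omega> powr s \<le> W \<omega> powr (1 / \<alpha>)" by (intro powr_mono) (auto simp: s_def)
            then show ?thesis by simp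
          qed
          also have "\<dots> \<le> 1 + W \<omega> powr (1 / \<alpha>) * l"
            using mult_left_mono[OF l, of "W \<omega> powr (1 / \<alpha>)"] by simp
          finally have "W \<omega> powr s \<le> 1 + W \<omega> powr (1 / \<alpha>) * l" .
          then show "norm (W \<omega> powr s) \<le> norm (1 + W \<omega> powr (1 / \<alpha>) * (if \<alpha> = \<beta> then log_plus (W \<omega>) else 1))"
            unfolding l_def[symmetric] by simp
        qed
      qed measurable
      define E where "E = expectation (\<lambda>\<omega>. W \<omega> powr s)"
      have "E \<ge> 0" unfolding E_def by simp
      have pw: "(x powr - a) ^ q = x powr - (a * real q)" if "x \<ge> 1" for x a :: real
        using that by (subst powr_realpow[symmetric]) (auto simp: powr_powr)
      have "V (e i) (f j) ^ q \<le> (E ^ q * u i powr - (\<kappa> * real q)) * v j powr - (\<kappa>' * real q)" for i j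
      proof -
        have "V (e i) (f j) \<le> E * (u i powr - \<kappa> * v j powr - \<kappa>')"
          using sum_variances_le[OF s1 int_s, of "e i" "f j"]
          unfolding V_def E_def u_def v_def \<kappa>_def \<kappa>'_def by simp
        moreover have "V (e i) (f j) \<ge> 0" unfolding V_def by (intro sum_nonneg) simp
        ultimately have "V (e i) (f j) ^ q \<le> (E * (u i powr - \<kappa> * v j powr - \<kappa>')) ^ q"
          by (intro power_mono)
        also have "\<dots> = (E ^ q * u i powr - (\<kappa> * real q)) * v j powr - (\<kappa>' * real q)"
          unfolding power_mult_distrib pw[OF u1] pw[OF v1] by (simp only: mult.assoc)
        finally show ?thesis .
      qed
      moreover obtain K1 where "(\<integral>\<^sup>+i. ennreal (\<phi> i * u i powr - (\<kappa> * real q)) \<partial>counting) \<le> ennreal K1"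
        using linear_growth.nn_integral_powr[OF U \<kappa>q] by blast
      then have "(\<integral>\<^sup>+i. ennreal (E ^ q) * ennreal (\<phi> i * u i powr - (\<kappa> * real q)) \<partial>counting) < \<infinity>"
        by (subst nn_integral_cmult) (auto simp: ennreal_mult_less_top intro: le_less_trans)
      then have "(\<integral>\<^sup>+i. ennreal (E ^ q * u i powr - (\<kappa> * real q)) \<partial>counting) < \<infinity>"
      proof (rule le_less_trans[rotated], intro nn_integral_mono)
        fix i
        \<comment> \<open>The variance bound carries no sampling weight; as \<phi> i \<ge> 1,
          inserting it only enlarges the sum, and the linear-growth estimate becomes
          applicable.\<close>
        have "1 * u i powr - (\<kappa> * real q) \<le> \<phi> i * u i powr - (\<kappa> * real q)"
          using \<phi>1[of i] by (intro mult_right_mono) auto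
        then have "E ^ q * u i powr - (\<kappa> * real q) \<le> E ^ q * (\<phi> i * u i powr - (\<kappa> * real q))"
          using \<open>E \<ge> 0\<close> by (intro mult_left_mono) auto
        then show "ennreal (E ^ q * u i powr - (\<kappa> * real q)) \<le> ennreal (E ^ q) * ennreal (\<phi> i * u i powr - (\<kappa> * real q))"
          using \<open>E \<ge> 0\<close> by (simp add: ennreal_leI flip: ennreal_mult')
      qed
      moreover obtain K2 where "(\<integral>\<^sup>+i. ennreal (\<psi> i * v i powr - (\<kappa>' * real q)) \<partial>counting) \<le> ennreal K2"
        using linear_growth.nn_integral_powr[OF V' \<kappa>'q] by blast
      then have "(\<integral>\<^sup>+i. ennreal (\<psi> i * v i powr - (\<kappa>' * real q)) \<partial>counting) < \<infinity>"
        by (auto intro: le_less_trans)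
      then have "(\<integral>\<^sup>+i. ennreal (v i powr - (\<kappa>' * real q)) \<partial>counting) < \<infinity>"
      proof (rule le_less_trans[rotated], intro nn_integral_mono ennreal_leI)
        fix i
        show "v i powr - (\<kappa>' * real q) \<le> \<psi> i * v i powr - (\<kappa>' * real q)"
          using mult_right_mono[OF \<psi>1[of i], of "v i powr - (\<kappa>' * real q)"] by simp
      qed
      ultimately show ?thesis
        using \<open>E \<ge> 0\<close>
        by (intro exI[of _ 0] conjI exI[of _ "\<lambda>i. E ^ q * u i powr - (\<kappa> * real q)"]
            exI[of _ "\<lambda>j. v j powr - (\<kappa>' * real q)"]) auto
    qed
    then obtain G x y where G: "G \<ge> 0" and xy: "\<And>i. x i \<ge> 0" "\<And>j. y j \<ge> 0"
      and VG: "\<And>i j. V (e i) (f j) ^ q \<le> G * (\<phi> i * \<psi> j * ?tm i j) + x i * y j"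
      and fin: "(\<integral>\<^sup>+i. ennreal (x i) \<partial>counting) < \<infinity>" "(\<integral>\<^sup>+j. ennreal (y j) \<partial>counting) < \<infinity>"
      by blast
    define H where "H = R * (\<bar>2 * K * L\<bar> + G)"
    have H: "H \<ge> 0" using R G by (simp add: H_def)
    have "expectation (\<lambda>\<omega>. fluct (e i) (f j) \<omega> ^ (2 * q)) \<le> H * (\<phi> i * \<psi> j * ?tm i j) + R * (x i * y j)" for i j
    proof -
      have "Q q (e i) (f j) \<le> \<bar>2 * K * L\<bar> * (\<phi> i * \<psi> j * ?tm i j)"
        by (rule order_trans[OF Q_le mult_right_mono[OF abs_ge_self tm_nonneg]])
      with VG[of i j] have "Q q (e i) (f j) + V (e i) (f j) ^ q \<le>
          (\<bar>2 * K * L\<bar> + G) * (\<phi> i * \<psi> j * ?tm i j) + x i * y j"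
        unfolding distrib_right by linarith
      from order_trans[OF R(2) mult_left_mono[OF this R(1)]]
      show ?thesis unfolding H_def mult.assoc by (simp only: distrib_left[of R])
    qed
    then have "(\<integral>\<^sup>+j. \<integral>\<^sup>+i. ennreal (expectation (\<lambda>\<omega>. fluct (e i) (f j) \<omega> ^ (2 * q))) \<partial>counting \<partial>counting) \<le>
      (\<integral>\<^sup>+j. \<integral>\<^sup>+i. ennreal (H * (\<phi> i * \<psi> j * ?tm i j) + R * (x i * y j)) \<partial>counting \<partial>counting)"
      by (intro nn_integral_mono ennreal_leI)
    also have "\<dots> = (\<integral>\<^sup>+j. \<integral>\<^sup>+i. ennreal H * ennreal (\<phi> i * \<psi> j * ?tm i j) + ennreal R * ennreal (x i * y j) \<partial>counting \<partial>counting)"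
    proof (intro nn_integral_cong)
      fix i j
      show "ennreal (H * (\<phi> i * \<psi> j * ?tm i j) + R * (x i * y j)) =
          ennreal H * ennreal (\<phi> i * \<psi> j * ?tm i j) + ennreal R * ennreal (x i * y j)"
        unfolding ennreal_mult[OF H tm_nonneg, symmetric] ennreal_mult[OF R(1) mult_nonneg_nonneg[OF xy], symmetric]
        by (intro ennreal_plus mult_nonneg_nonneg H R tm_nonneg xy)
    qed
    also have "\<dots> = ennreal H * (\<integral>\<^sup>+j. \<integral>\<^sup>+i. ennreal (\<phi> i * \<psi> j * ?tm i j) \<partial>counting \<partial>counting) +
        ennreal R * (\<integral>\<^sup>+j. \<integral>\<^sup>+i. ennreal (x i * y j) \<partial>counting \<partial>counting)"
      by (simp add: nn_integral_add nn_integral_cmult)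
    also have "\<dots> < \<infinity>"
      using tm_fin nn_integral_double_product[OF xy fin] by (simp add: ennreal_mult_less_top ennreal_add_less_top)
    finally show "(\<integral>\<^sup>+j. \<integral>\<^sup>+i. ennreal (expectation (\<lambda>\<omega>. fluct (e i) (f j) \<omega> ^ (2 * q))) \<partial>counting \<partial>counting) < \<infinity>" .
  qed
qed

lemma cesaro_mean_tendsto:
  "AE \<omega> in M. ((\<lambda>(m, n). cesaro_mean \<alpha> \<beta> (\<lambda>k l. Z (k, l) \<omega>) m n) \<longlongrightarrow> expectation W)
     (sequentially \<times>\<^sub>F sequentially)"
proof -
  obtain q where q: "q \<ge> 1"
    "\<And>\<theta> e \<phi> C f \<psi> D. cesaro_sampling \<alpha> \<theta> e \<phi> C \<Longrightarrow> cesaro_sampling \<beta> \<theta> f \<psi> D \<Longrightarrow>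
      (\<integral>\<^sup>+j. \<integral>\<^sup>+i. ennreal (expectation (\<lambda>\<omega>. fluct (e i) (f j) \<omega> ^ (2 * q))) \<partial>counting \<partial>counting) < \<infinity>"
    using fluct_moment_sum_finite by blast
  have bounded_fluct: "bounded_rv (fluct m n)" for m n
    unfolding fluct_eq[abs_def] by (intro bounded_rv_intros bounded_centred)
  let ?T = "\<lambda>\<omega> k l. trunc (k, l) (Z (k, l) \<omega>)"
  let ?ET = "\<lambda>k l. expectation (\<lambda>\<omega>. trunc (k, l) (Z (k, l) \<omega>))"
  \<comment> \<open>The sampling is fixed for each N before \<omega> is chosen, so the exceptional
    set depends on N alone and a countable union of null sets remains.\<close>
  have "AE \<omega> in M. \<exists>e \<phi> C f \<psi> D. cesaro_sampling \<alpha> (1 + 1 / real (Suc N)) e \<phi> C \<and>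
        cesaro_sampling \<beta> (1 + 1 / real (Suc N)) f \<psi> D \<and>
        ((\<lambda>(i, j). cesaro_mean \<alpha> \<beta> (?T \<omega>) (e i) (f j)) \<longlongrightarrow> expectation W) (sequentially \<times>\<^sub>F sequentially)" for N
  proof -
    have \<theta>: "1 + 1 / real (Suc N) > 1" by simp
    obtain e \<phi> C where S1: "cesaro_sampling \<alpha> (1 + 1 / real (Suc N)) e \<phi> C"
      using cesaro_sampling_exists[OF \<alpha>_pos \<alpha>_le_1 \<theta>] by blast
    obtain f \<psi> D where S2: "cesaro_sampling \<beta> (1 + 1 / real (Suc N)) f \<psi> D"
      using cesaro_sampling_exists[OF \<beta>_pos \<beta>_le_1 \<theta>] by blast
    have lim_e: "filterlim e at_top sequentially" and lim_f: "filterlim f at_top sequentially"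
      using S1 S2 by (auto simp: cesaro_sampling_def)
    have "filterlim (\<lambda>p. (e (fst p), f (snd p))) (sequentially \<times>\<^sub>F sequentially) (sequentially \<times>\<^sub>F sequentially)"
      by (intro filterlim_Pair filterlim_compose[OF lim_e filterlim_fst] filterlim_compose[OF lim_f filterlim_snd])
    from filterlim_compose[OF expectation_trunc_tendsto this]
    have lim_E: "((\<lambda>(i, j). cesaro_mean \<alpha> \<beta> ?ET (e i) (f j)) \<longlongrightarrow> expectation W) (sequentially \<times>\<^sub>F sequentially)"
      by (simp add: case_prod_unfold)
    have "(\<integral>\<^sup>+\<omega>. ennreal (fluct m n \<omega> ^ (2 * q)) \<partial>M) = ennreal (expectation (\<lambda>\<omega>. fluct m n \<omega> ^ (2 * q)))" for m n
      by (intro nn_integral_eq_integral bounded_rv_integrable bounded_rv_intros bounded_fluct) simp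
    then have "AE \<omega> in M. (\<integral>\<^sup>+j. \<integral>\<^sup>+i. ennreal (fluct (e i) (f j) \<omega> ^ (2 * q)) \<partial>counting \<partial>counting) < \<infinity>"
      using q(2)[OF S1 S2] by (intro AE_double_count_finite) simp_all
    then show ?thesis
    proof eventually_elim
      case (elim \<omega>)
      have "((\<lambda>(i, j). fluct (e i) (f j) \<omega>) \<longlongrightarrow> 0) (sequentially \<times>\<^sub>F sequentially)"
        by (rule nn_integral_double_tendsto_0[OF elim])
      then have "((\<lambda>(i, j). cesaro_mean \<alpha> \<beta> (?T \<omega>) (e i) (f j) - cesaro_mean \<alpha> \<beta> ?ET (e i) (f j)) \<longlongrightarrow> 0)
          (sequentially \<times>\<^sub>F sequentially)"
        unfolding fluct_def centred_def cesaro_mean_diff .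
      from tendsto_case_prod_cong_diff[OF this lim_E] S1 S2 show ?case by blast
    qed
  qed
  then have "AE \<omega> in M. \<forall>N. \<exists>e \<phi> C f \<psi> D. cesaro_sampling \<alpha> (1 + 1 / real (Suc N)) e \<phi> C \<and>
        cesaro_sampling \<beta> (1 + 1 / real (Suc N)) f \<psi> D \<and>
        ((\<lambda>(i, j). cesaro_mean \<alpha> \<beta> (?T \<omega>) (e i) (f j)) \<longlongrightarrow> expectation W) (sequentially \<times>\<^sub>F sequentially)"
    by (simp add: AE_all_countable)
  with AE_finite_truncated show ?thesis
  proof eventually_elim
    case (elim \<omega>)
    have lim_T: "((\<lambda>(m, n). cesaro_mean \<alpha> \<beta> (?T \<omega>) m n) \<longlongrightarrow> expectation W) (sequentially \<times>\<^sub>F sequentially)"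
      using elim(2) \<alpha>_pos \<beta>_pos
      by (intro cesaro_mean_tendsto_sampling) (auto simp: trunc_nonneg Z_nonneg)
    have "finite {p. Z (fst p, snd p) \<omega> - trunc (fst p, snd p) (Z (fst p, snd p) \<omega>) \<noteq> 0}"
      by (rule finite_subset[OF _ elim(1)]) (auto simp: trunc_def split: if_splits)
    then have "((\<lambda>(m, n). cesaro_mean \<alpha> \<beta> (\<lambda>k l. Z (k, l) \<omega> - ?T \<omega> k l) m n) \<longlongrightarrow> 0) (sequentially \<times>\<^sub>F sequentially)"
      using \<alpha>_pos \<alpha>_le_1 \<beta>_pos \<beta>_le_1 by (intro cesaro_mean_finite_support_tendsto_0)
    then have "((\<lambda>(m, n). cesaro_mean \<alpha> \<beta> (\<lambda>k l. Z (k, l) \<omega>) m n - cesaro_mean \<alpha> \<beta> (?T \<omega>) m n) \<longlongrightarrow> 0) (sequentially \<times>\<^sub>F sequentially)"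
      unfolding cesaro_mean_diff .
    from tendsto_case_prod_cong_diff[OF this lim_T] show ?case .
  qed
qed

end

section \<open>Signed arrays and exceedance probabilities\<close>

context prob_space
begin

text \<open>Injectivity makes the singletons {h p} disjoint blocks of indices; the restrictions to
  them are independent, and evaluation at h p recovers the variables.\<close>

lemma indep_vars_reindex:
  assumes ind: "indep_vars (\<lambda>_. borel) V UNIV" and "inj h"
  shows "indep_vars (\<lambda>_. borel) (\<lambda>p. V (h p)) UNIV"
proof -
  have "indep_vars (\<lambda>p. PiM {h p} (\<lambda>_. borel)) (\<lambda>p \<omega>. restrict (\<lambda>i. V i \<omega>) {h p}) UNIV"
    using \<open>inj h\<close> by (intro indep_vars_restrict[OF ind]) (auto simp: disjoint_family_on_def inj_def)
  from indep_vars_compose2[OF this, of "\<lambda>p f. f (h p)" "\<lambda>_. borel"]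
  show ?thesis by simp
qed

lemma cesaro_mean_tendsto_expectation:
  fixes Y :: "nat \<times> nat \<Rightarrow> 'a \<Rightarrow> real" and X :: "'a \<Rightarrow> real"
  assumes \<alpha>: "0 < \<alpha>" "\<alpha> \<le> \<beta>" "\<beta> \<le> 1"
    and ind: "indep_vars (\<lambda>_. borel) Y UNIV"
    and X [measurable]: "X \<in> borel_measurable M"
    and distr: "\<And>p. distr M borel (Y p) = distr M borel X"
    and int: "integrable M X"
    and moment: "integrable M (\<lambda>\<omega>. \<bar>X \<omega>\<bar> powr (1 / \<alpha>) * (if \<alpha> = \<beta> then log_plus \<bar>X \<omega>\<bar> else 1))"
  shows "AE \<omega> in M. ((\<lambda>(m, n). cesaro_mean \<alpha> \<beta> (\<lambda>k l. Y (k, l) \<omega>) m n) \<longlongrightarrow> expectation X)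
     (sequentially \<times>\<^sub>F sequentially)"
proof -
  have Y [measurable]: "Y p \<in> borel_measurable M" for p
    using ind unfolding indep_vars_def by blast
  \<comment> \<open>The sign s yields the positive and the negative part by the same
    argument.\<close>
  have part: "nonneg_iid_array M (\<lambda>p \<omega>. max 0 (s * Y p \<omega>)) (\<lambda>\<omega>. max 0 (s * X \<omega>)) \<alpha> \<beta>"
    if "s = 1 \<or> s = -1" for s
  proof unfold_locales
    show "indep_vars (\<lambda>_. borel) (\<lambda>p \<omega>. max 0 (s * Y p \<omega>)) UNIV"
      by (rule indep_vars_compose2[OF ind]) measurable
    show "distr M borel (\<lambda>\<omega>. max 0 (s * Y p \<omega>)) = distr M borel (\<lambda>\<omega>. max 0 (s * X \<omega>))" for p
    proof -
      have "distr M borel (\<lambda>\<omega>. max 0 (s * Y p \<omega>)) = distr (distr M borel (Y p)) borel (\<lambda>x. max 0 (s * x))"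
        by (subst distr_distr) (auto simp: comp_def)
      also have "\<dots> = distr M borel (\<lambda>\<omega>. max 0 (s * X \<omega>))"
        unfolding distr by (subst distr_distr) (auto simp: comp_def)
      finally show ?thesis .
    qed
    show "integrable M (\<lambda>\<omega>. max 0 (s * X \<omega>))"
      using int by auto
    show "integrable M (\<lambda>\<omega>. max 0 (s * X \<omega>) powr (1 / \<alpha>) * (if \<alpha> = \<beta> then log_plus (max 0 (s * X \<omega>)) else 1))"
    proof (rule Bochner_Integration.integrable_bound[OF moment])
      show "AE \<omega> in M. norm (max 0 (s * X \<omega>) powr (1 / \<alpha>) * (if \<alpha> = \<beta> then log_plus (max 0 (s * X \<omega>)) else 1))
        \<le> norm (\<bar>X \<omega>\<bar> powr (1 / \<alpha>) * (if \<alpha> = \<beta> then log_plus \<bar>X \<omega>\<bar> else 1))"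
      proof (rule AE_I2)
        fix \<omega>
        show "norm (max 0 (s * X \<omega>) powr (1 / \<alpha>) * (if \<alpha> = \<beta> then log_plus (max 0 (s * X \<omega>)) else 1))
          \<le> norm (\<bar>X \<omega>\<bar> powr (1 / \<alpha>) * (if \<alpha> = \<beta> then log_plus \<bar>X \<omega>\<bar> else 1))"
        proof (cases "s * X \<omega> \<ge> 0")
          case True
          then have "max 0 (s * X \<omega>) = \<bar>X \<omega>\<bar>" using that by (auto simp: max_def)
          then show ?thesis by simp
        next
          \<comment> \<open>Here the power of 0 is 0, so the product vanishes although
            \<open>log_plus 0\<close> is 1.\<close>
          case False
          then have "max 0 (s * X \<omega>) = 0" by simp
          then show ?thesis by simp
        qed
      qed
    qed measurable
  qed (use \<alpha> in \<open>auto\<close>)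
  have "expectation X = expectation (\<lambda>\<omega>. max 0 (1 * X \<omega>) - max 0 (-1 * X \<omega>))"
    by (intro Bochner_Integration.integral_cong) auto
  also have "\<dots> = expectation (\<lambda>\<omega>. max 0 (1 * X \<omega>)) - expectation (\<lambda>\<omega>. max 0 (-1 * X \<omega>))"
    using int by (intro Bochner_Integration.integral_diff) auto
  finally have EX: "expectation (\<lambda>\<omega>. max 0 (1 * X \<omega>)) - expectation (\<lambda>\<omega>. max 0 (-1 * X \<omega>)) = expectation X" ..
  have one: "(1 :: real) = 1 \<or> (1 :: real) = -1" "(-1 :: real) = 1 \<or> (-1 :: real) = -1" by auto
  from nonneg_iid_array.cesaro_mean_tendsto[OF part[OF one(1)]]
    nonneg_iid_array.cesaro_mean_tendsto[OF part[OF one(2)]]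
  show ?thesis
  proof eventually_elim
    case (elim \<omega>)
    have Y_eq: "Y p \<omega> = max 0 (1 * Y p \<omega>) - max 0 (-1 * Y p \<omega>)" for p by auto
    have "((\<lambda>(m, n). cesaro_mean \<alpha> \<beta> (\<lambda>k l. max 0 (1 * Y (k, l) \<omega>)) m n -
        cesaro_mean \<alpha> \<beta> (\<lambda>k l. max 0 (-1 * Y (k, l) \<omega>)) m n) \<longlongrightarrow> expectation X) (sequentially \<times>\<^sub>F sequentially)"
      using tendsto_diff[OF elim] unfolding EX by (simp only: case_prod_unfold)
    then show ?case
      unfolding cesaro_mean_diff[symmetric] Y_eq[symmetric] .
  qed
qed

text \<open>Splitting according to the last index at which an exceedance \<open>A p\<close> occurs makes the
  pieces independent of \<open>B p\<close>, although \<open>A p\<close> and \<open>B q\<close> may be dependent for other pairs.\<close>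

lemma prob_last_exceedance:
  fixes \<rho> :: "'i \<Rightarrow> nat"
  assumes fin: "finite F" and inj: "inj_on \<rho> F"
    and A: "\<And>p. p \<in> F \<Longrightarrow> A p \<in> events" and B: "\<And>p. p \<in> F \<Longrightarrow> B p \<in> events"
    and half: "\<And>p. p \<in> F \<Longrightarrow> prob (B p) \<ge> 1 / 2"
    and indep: "\<And>p. p \<in> F \<Longrightarrow> prob ((A p - (\<Union>q\<in>{q\<in>F. \<rho> p < \<rho> q}. A q)) \<inter> B p) =
       prob (A p - (\<Union>q\<in>{q\<in>F. \<rho> p < \<rho> q}. A q)) * prob (B p)"
    and sub: "\<And>p. p \<in> F \<Longrightarrow> A p \<inter> B p \<subseteq> E" and E: "E \<in> events"
  shows "prob (\<Union>p\<in>F. A p) \<le> 2 * prob E"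
proof -
  define Q where "Q p = A p - (\<Union>q\<in>{q\<in>F. \<rho> p < \<rho> q}. A q)" for p
  have Q: "Q p \<in> events" if "p \<in> F" for p
    unfolding Q_def using fin that by (intro sets.Diff sets.finite_UN A) auto
  have cover: "(\<Union>p\<in>F. A p) \<subseteq> (\<Union>p\<in>F. Q p)"
  proof
    fix x assume "x \<in> (\<Union>p\<in>F. A p)"
    then obtain p0 where p0: "p0 \<in> F \<and> x \<in> A p0" by auto
    have "\<exists>p. (p \<in> F \<and> x \<in> A p) \<and> (\<forall>q. q \<in> F \<and> x \<in> A q \<longrightarrow> \<rho> q \<le> \<rho> p)"
      by (rule ex_has_greatest_nat[where k = p0 and b = "Suc (Max (\<rho> ` F))"])
        (use fin p0 in \<open>auto simp: less_Suc_eq_le\<close>)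
    then show "x \<in> (\<Union>p\<in>F. Q p)" by (auto simp: Q_def not_less)
  qed
  have disj: "disjoint_family_on (\<lambda>p. Q p \<inter> B p) F"
    unfolding disjoint_family_on_def Q_def
  proof (intro ballI impI)
    fix p q assume "p \<in> F" "q \<in> F" "p \<noteq> q"
    then have "\<rho> p < \<rho> q \<or> \<rho> q < \<rho> p" using inj by (metis inj_onD linorder_neqE_nat)
    then show "(A p - (\<Union>q\<in>{q\<in>F. \<rho> p < \<rho> q}. A q)) \<inter> B p \<inter> ((A q - (\<Union>r\<in>{r\<in>F. \<rho> q < \<rho> r}. A r)) \<inter> B q) = {}"
      using \<open>p \<in> F\<close> \<open>q \<in> F\<close> by blast
  qed
  have "prob (\<Union>p\<in>F. A p) \<le> prob (\<Union>p\<in>F. Q p)"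
    using fin Q by (intro finite_measure_mono cover) auto
  also have "\<dots> \<le> (\<Sum>p\<in>F. prob (Q p))"
    using fin Q by (intro finite_measure_subadditive_finite) auto
  \<comment> \<open>Each piece is independent of its B p, which has probability at least 1/2. Since
    the pieces are disjoint, their probabilities then add up inside E without further loss.\<close>
  also have "\<dots> \<le> (\<Sum>p\<in>F. 2 * prob (Q p \<inter> B p))"
  proof (intro sum_mono)
    fix p assume p: "p \<in> F"
    have "prob (Q p) * (1 / 2) \<le> prob (Q p) * prob (B p)"
      using half[OF p] by (intro mult_left_mono) auto
    also have "\<dots> = prob (Q p \<inter> B p)" using indep[OF p] by (simp add: Q_def)
    finally show "prob (Q p) \<le> 2 * prob (Q p \<inter> B p)" by simp
  qed
  also have "\<dots> = 2 * prob (\<Union>p\<in>F. Q p \<inter> B p)"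
    using fin Q B by (subst finite_measure_finite_Union[OF fin _ disj]) (auto simp: sum_distrib_left)
  also have "\<dots> \<le> 2 * prob E"
    using sub by (intro mult_left_mono finite_measure_mono E) (auto simp: Q_def)
  finally show ?thesis .
qed

text \<open>A quantitative second Borel-Cantelli lemma: by independence 1/2 is at most the product
  of the 1 - p_i, hence at most exp of minus the sum of the p_i.\<close>

lemma sum_prob_le_ln_2:
  fixes Y :: "'i \<Rightarrow> 'a \<Rightarrow> real"
  assumes fin: "finite F" and ind: "indep_vars (\<lambda>_. borel) Y F"
    and le: "prob (\<Union>p\<in>F. {\<omega>\<in>space M. c p < \<bar>Y p \<omega>\<bar>}) \<le> 1 / 2"
  shows "(\<Sum>p\<in>F. prob {\<omega>\<in>space M. c p < \<bar>Y p \<omega>\<bar>}) \<le> ln 2"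
proof (cases "F = {}")
  case False
  let ?A = "\<lambda>p. {\<omega>\<in>space M. c p < \<bar>Y p \<omega>\<bar>}"
  have Y: "Y p \<in> borel_measurable M" if "p \<in> F" for p
    using ind that unfolding indep_vars_def by blast
  have A: "?A p \<in> events" if "p \<in> F" for p
    using Y[OF that] by measurable
  have compl: "Y p -` {- c p..c p} \<inter> space M = space M - ?A p" for p by auto
  have "1 / 2 \<le> 1 - prob (\<Union>p\<in>F. ?A p)" using le by simp
  also have "\<dots> = prob (space M - (\<Union>p\<in>F. ?A p))"
    using fin A by (intro prob_compl[symmetric]) auto
  also have "space M - (\<Union>p\<in>F. ?A p) = (\<Inter>p\<in>F. Y p -` {- c p..c p} \<inter> space M)"
    using False unfolding compl by auto
  also have "prob (\<Inter>p\<in>F. Y p -` {- c p..c p} \<inter> space M) = (\<Prod>p\<in>F. prob (Y p -` {- c p..c p} \<inter> space M))"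
    using ind False fin by (intro indep_varsD_finite) auto
  also have "\<dots> = (\<Prod>p\<in>F. 1 - prob (?A p))"
    unfolding compl using A by (intro prod.cong) (auto simp: prob_compl)
  also have "\<dots> \<le> (\<Prod>p\<in>F. exp (- prob (?A p)))"
    using exp_ge_add_one_self[of "- prob (?A p)" for p] by (intro prod_mono) auto
  also have "\<dots> = exp (- (\<Sum>p\<in>F. prob (?A p)))"
    using fin by (simp add: exp_sum[symmetric] sum_negf)
  finally have "ln (1 / 2) \<le> ln (exp (- (\<Sum>p\<in>F. prob (?A p))))"
    by (subst ln_le_cancel_iff) auto
  then show ?thesis by (simp add: ln_div)
qed simp

lemma prob_tail_tendsto_0:
  fixes X :: "'a \<Rightarrow> real"
  assumes [measurable]: "X \<in> borel_measurable M" and c: "filterlim c at_top sequentially"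
  shows "(\<lambda>n. prob {\<omega>\<in>space M. c n < \<bar>X \<omega>\<bar>}) \<longlonglongrightarrow> 0"
proof -
  have "(\<lambda>n. expectation (\<lambda>\<omega>. indicator {\<omega>\<in>space M. c n < \<bar>X \<omega>\<bar>} \<omega>)) \<longlonglongrightarrow> expectation (\<lambda>\<omega>. 0 :: real)"
  proof (rule integral_dominated_convergence[where w = "\<lambda>_. 1"])
    show "AE \<omega> in M. (\<lambda>n. indicator {\<omega>\<in>space M. c n < \<bar>X \<omega>\<bar>} \<omega> :: real) \<longlonglongrightarrow> 0"
    proof (rule AE_I2)
      fix \<omega>
      have "\<forall>\<^sub>F n in sequentially. \<bar>X \<omega>\<bar> \<le> c n" using c by (simp add: filterlim_at_top)
      then have "\<forall>\<^sub>F n in sequentially. indicator {\<omega>\<in>space M. c n < \<bar>X \<omega>\<bar>} \<omega> = (0 :: real)"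
        by eventually_elim (simp add: indicator_def)
      then show "(\<lambda>n. indicator {\<omega>\<in>space M. c n < \<bar>X \<omega>\<bar>} \<omega> :: real) \<longlonglongrightarrow> 0"
        by (rule tendsto_eventually)
    qed
  qed auto
  then show ?thesis by simp
qed

text \<open>The quantifiers over m, n \<ge> N stand inside the event, so that one event of small
  probability catches deviations at all pairs of a box simultaneously. Its indicators tend to 0
  almost surely.\<close>

lemma prob_eventually_deviation:
  fixes T :: "nat \<Rightarrow> nat \<Rightarrow> 'a \<Rightarrow> real"
  assumes [measurable]: "\<And>m n. T m n \<in> borel_measurable M"
    and lim: "AE \<omega> in M. ((\<lambda>(m, n). T m n \<omega>) \<longlongrightarrow> \<mu>) (sequentially \<times>\<^sub>F sequentially)"
    and \<delta>: "\<delta> > 0"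
  shows "(\<lambda>N. prob {\<omega>\<in>space M. \<exists>m\<ge>N. \<exists>n\<ge>N. \<delta> < \<bar>T m n \<omega> - \<mu>\<bar>}) \<longlonglongrightarrow> 0"
proof -
  let ?D = "\<lambda>N. {\<omega>\<in>space M. \<exists>m\<ge>N. \<exists>n\<ge>N. \<delta> < \<bar>T m n \<omega> - \<mu>\<bar>}"
  have D [measurable]: "?D N \<in> events" for N by measurable
  have "(\<lambda>N. expectation (\<lambda>\<omega>. indicator (?D N) \<omega>)) \<longlonglongrightarrow> expectation (\<lambda>\<omega>. 0 :: real)"
  proof (rule integral_dominated_convergence[where w = "\<lambda>_. 1"])
    show "AE \<omega> in M. (\<lambda>N. indicator (?D N) \<omega> :: real) \<longlonglongrightarrow> 0"
      using lim
    proof eventually_elim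
      case (elim \<omega>)
      from tendstoD[OF elim \<delta>] obtain N where N: "\<And>m n. m \<ge> N \<Longrightarrow> n \<ge> N \<Longrightarrow> \<bar>T n m \<omega> - \<mu>\<bar> < \<delta>"
        unfolding eventually_prod_sequentially by (auto simp: dist_real_def)
      have "indicator (?D K) \<omega> = (0 :: real)" if "K \<ge> N" for K
      proof -
        have "\<bar>T m n \<omega> - \<mu>\<bar> < \<delta>" if "m \<ge> K" "n \<ge> K" for m n
          by (rule N) (use that \<open>K \<ge> N\<close> in simp_all)
        then have "\<omega> \<notin> ?D K" by (auto simp: not_less intro: less_imp_le)
        then show ?thesis by simp
      qed
      then have "\<forall>\<^sub>F K in sequentially. indicator (?D K) \<omega> = (0 :: real)"
        unfolding eventually_sequentially by blast
      then show "(\<lambda>N. indicator (?D N) \<omega> :: real) \<longlonglongrightarrow> 0" by (rule tendsto_eventually)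
    qed
  qed auto
  then show ?thesis by simp
qed

text \<open>If the last summand exceeds 1 in modulus while the rest R is within 1/2 of \<mu>, the
  mean deviates by more than 1/4. R fails to be that close only if the mean deviates by more than
  1/4 or the last summand exceeds 1/4, each of probability below 1/4. So exceedances in a box have
  total probability at most 2 * 1/4 = 1/2, as \<open>sum_prob_le_ln_2\<close> requires.\<close>

lemma cesaro_exceedance_sum_bounded:
  fixes Y :: "nat \<times> nat \<Rightarrow> 'a \<Rightarrow> real" and X :: "'a \<Rightarrow> real"
  assumes \<alpha>: "0 < \<alpha>" "\<alpha> \<le> 1" "0 < \<beta>" "\<beta> \<le> 1"
    and ind: "indep_vars (\<lambda>_. borel) Y UNIV"
    and X [measurable]: "X \<in> borel_measurable M"
    and distr: "\<And>p. distr M borel (Y p) = distr M borel X"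
    and lim: "AE \<omega> in M. ((\<lambda>(m, n). cesaro_mean \<alpha> \<beta> (\<lambda>k l. Y (k, l) \<omega>) m n) \<longlongrightarrow> \<mu>)
     (sequentially \<times>\<^sub>F sequentially)"
  obtains N where "\<And>L. (\<Sum>p\<in>{N..L} \<times> {N..L}.
      prob {\<omega>\<in>space M. cesaro_number \<alpha> (fst p) * cesaro_number \<beta> (snd p) < \<bar>X \<omega>\<bar>}) \<le> ln 2"
proof -
  have Y [measurable]: "Y p \<in> borel_measurable M" for p
    using ind unfolding indep_vars_def by blast
  have prob_Y: "prob {\<omega>\<in>space M. c < \<bar>Y p \<omega>\<bar>} = prob {\<omega>\<in>space M. c < \<bar>X \<omega>\<bar>}" for c p
  proof -
    have "prob {\<omega>\<in>space M. c < \<bar>Y p \<omega>\<bar>} = measure (distr M borel (Y p)) {x. c < \<bar>x\<bar>}"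
      by (subst measure_distr) (auto intro!: arg_cong[where f = prob])
    also have "\<dots> = prob {\<omega>\<in>space M. c < \<bar>X \<omega>\<bar>}"
      unfolding distr by (subst measure_distr) (auto intro!: arg_cong[where f = prob])
    finally show ?thesis .
  qed
  define c where "c p = cesaro_number \<alpha> (fst p) * cesaro_number \<beta> (snd p)" for p
  have c_pos: "c p > 0" for p
    using \<alpha> cesaro_number_pos[of \<alpha>] cesaro_number_pos[of \<beta>] by (simp add: c_def)
  define T where "T m n \<omega> = cesaro_mean \<alpha> \<beta> (\<lambda>k l. Y (k, l) \<omega>) m n" for m n \<omega>
  have T_meas [measurable]: "T m n \<in> borel_measurable M" for m n
    unfolding T_def[abs_def] cesaro_mean_eq by measurable
  define S where "S p = {..fst p} \<times> {..snd p} - {p}" for p :: "nat \<times> nat"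
  define w where "w p q = cesaro_weight \<alpha> (fst p) (fst q) * cesaro_weight \<beta> (snd p) (snd q)" for p q
  define R where "R p \<omega> = (\<Sum>q\<in>S p. w p q * Y q \<omega>)" for p \<omega>
  have T_eq: "T (fst p) (snd p) \<omega> = Y p \<omega> / c p + R p \<omega>" for p \<omega>
  proof -
    have "T (fst p) (snd p) \<omega> = (\<Sum>q\<in>{..fst p} \<times> {..snd p}. w p q * Y q \<omega>)"
      by (simp add: T_def cesaro_mean_eq_pairs w_def)
    also have "\<dots> = w p p * Y p \<omega> + R p \<omega>"
      unfolding R_def S_def by (rule sum.remove) (auto simp: mem_Times_iff)
    also have "w p p = 1 / c p" by (simp add: w_def c_def cesaro_weight_def)
    finally show ?thesis by simp
  qed
  let ?D = "\<lambda>N. {\<omega>\<in>space M. \<exists>m\<ge>N. \<exists>n\<ge>N. 1 / 4 < \<bar>T m n \<omega> - \<mu>\<bar>}"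
  have "(\<lambda>N. prob (?D N)) \<longlonglongrightarrow> 0"
    by (rule prob_eventually_deviation[OF T_meas lim[folded T_def]]) simp
  then have ev1: "\<forall>\<^sub>F N in sequentially. prob (?D N) < 1 / 4"
    by (rule order_tendstoD) simp
  have "filterlim (\<lambda>k. 1 / 4 * real (Suc k) powr \<alpha>) at_top sequentially"
    by (rule filterlim_tendsto_pos_mult_at_top[OF tendsto_const])
      (auto intro!: filterlim_compose[OF real_powr_at_top[OF \<alpha>(1)]
          filterlim_compose[OF filterlim_real_sequentially filterlim_Suc]] simp del: of_nat_Suc)
  from prob_tail_tendsto_0[OF X this]
  have ev2: "\<forall>\<^sub>F N in sequentially. prob {\<omega>\<in>space M. 1 / 4 * real (Suc N) powr \<alpha> < \<bar>X \<omega>\<bar>} < 1 / 4"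
    by (rule order_tendstoD) simp
  obtain N where N: "prob (?D N) < 1 / 4" "prob {\<omega>\<in>space M. 1 / 4 * real (Suc N) powr \<alpha> < \<bar>X \<omega>\<bar>} < 1 / 4"
    using eventually_happens'[OF sequentially_bot eventually_conj[OF ev1 ev2]] by blast
  define A where "A p = {\<omega>\<in>space M. c p < \<bar>Y p \<omega>\<bar>}" for p
  define B where "B p = {\<omega>\<in>space M. \<bar>R p \<omega> - \<mu>\<bar> \<le> 1 / 2}" for p
  have R_meas [measurable]: "R p \<in> borel_measurable M" for p
    unfolding R_def[abs_def] by measurable
  have A_meas: "A p \<in> events" and B_meas: "B p \<in> events" for p
    unfolding A_def B_def by measurable
  have half: "prob (B p) \<ge> 1 / 2" if "fst p \<ge> N" "snd p \<ge> N" for p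
  proof -
    let ?G = "{\<omega>\<in>space M. 1 / 4 * c p < \<bar>Y p \<omega>\<bar>}"
    \<comment> \<open>One threshold for all pairs beyond N, so that the single tail probability
      fixed with N controls every last summand.\<close>
    have "real (Suc N) powr \<alpha> * 1 \<le> real (Suc (fst p)) powr \<alpha> * real (Suc (snd p)) powr \<beta>"
      using that \<alpha> by (intro mult_mono powr_mono2 ge_one_powr_ge_zero) auto
    also have "\<dots> \<le> c p"
      unfolding c_def using \<alpha> by (intro mult_mono cesaro_number_ge cesaro_number_nonneg) auto
    finally have "1 / 4 * real (Suc N) powr \<alpha> \<le> 1 / 4 * c p" by simp
    then have "prob {\<omega>\<in>space M. 1 / 4 * c p < \<bar>X \<omega>\<bar>} \<le> prob {\<omega>\<in>space M. 1 / 4 * real (Suc N) powr \<alpha> < \<bar>X \<omega>\<bar>}"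
      by (intro finite_measure_mono) auto
    then have G: "prob ?G < 1 / 4" using N(2) unfolding prob_Y by linarith
    have "space M - B p \<subseteq> ?D N \<union> ?G"
    proof
      fix \<omega> assume \<omega>: "\<omega> \<in> space M - B p"
      show "\<omega> \<in> ?D N \<union> ?G"
      proof (rule ccontr)
        assume "\<omega> \<notin> ?D N \<union> ?G"
        then have "\<bar>T (fst p) (snd p) \<omega> - \<mu>\<bar> \<le> 1 / 4" "\<bar>Y p \<omega>\<bar> \<le> 1 / 4 * c p"
          using \<omega> that by (auto simp: not_less)
        moreover from this(2) have "\<bar>Y p \<omega> / c p\<bar> \<le> 1 / 4"
          using c_pos[of p] by (simp add: abs_divide divide_le_eq)
        ultimately have "\<bar>R p \<omega> - \<mu>\<bar> \<le> 1 / 2" unfolding T_eq by linarith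
        then show False using \<omega> by (simp add: B_def)
      qed
    qed
    then have "prob (space M - B p) \<le> prob (?D N \<union> ?G)"
      by (intro finite_measure_mono) auto
    also have "\<dots> \<le> prob (?D N) + prob ?G"
      by (intro measure_Un_le) auto
    finally show ?thesis
      using N(1) G B_meas[of p] by (simp add: prob_compl)
  qed
  have sub: "A p \<inter> B p \<subseteq> ?D N" if "fst p \<ge> N" "snd p \<ge> N" for p
  proof
    fix \<omega> assume \<omega>: "\<omega> \<in> A p \<inter> B p"
    then have "\<bar>Y p \<omega> / c p\<bar> > 1" using c_pos[of p] by (simp add: A_def abs_divide less_divide_eq)
    moreover have "\<bar>R p \<omega> - \<mu>\<bar> \<le> 1 / 2" using \<omega> by (simp add: B_def)
    ultimately have "1 / 4 < \<bar>T (fst p) (snd p) \<omega> - \<mu>\<bar>" unfolding T_eq by linarith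
    then show "\<omega> \<in> ?D N" using \<omega> that by (auto simp: A_def)
  qed
  show ?thesis
  proof (rule that[of N])
    fix L
    define F where "F = {N..L} \<times> {N..L}"
    \<comment> \<open>The rank of p in the lexicographic order of the box. It extends the product
      order, so all variables entering R p have smaller rank than p.\<close>
    define \<rho> where "\<rho> p = fst p * Suc L + snd p" for p :: "nat \<times> nat"
    have fin: "finite F" by (simp add: F_def)
    have \<rho>_less: "\<rho> q < \<rho> p" if "q \<in> S p" "p \<in> F" for p q
    proof -
      have q: "fst q \<le> fst p" "snd q \<le> snd p" "q \<noteq> p" using that by (auto simp: S_def mem_Times_iff)
      then have "fst q * Suc L \<le> fst p * Suc L" by (intro mult_right_mono) auto
      moreover have "fst q < fst p \<or> snd q < snd p"
        using q by (auto simp: prod_eq_iff)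
      then have "fst q * Suc L < fst p * Suc L \<or> snd q < snd p"
        by (meson mult_less_mono1 zero_less_Suc)
      ultimately show ?thesis using q unfolding \<rho>_def by linarith
    qed
    have \<rho>_inj: "inj_on \<rho> F"
    proof (rule inj_onI)
      fix p q assume pq: "p \<in> F" "q \<in> F" "\<rho> p = \<rho> q"
      then have "snd p < Suc L" "snd q < Suc L" by (auto simp: F_def)
      then have "\<rho> p div Suc L = fst p" "\<rho> q div Suc L = fst q" "\<rho> p mod Suc L = snd p" "\<rho> q mod Suc L = snd q"
        unfolding \<rho>_def by (simp_all del: mult_Suc_right)
      then show "p = q" using pq(3) by (simp add: prod_eq_iff)
    qed
    have indep_event: "prob ((A p - (\<Union>q\<in>{q\<in>F. \<rho> p < \<rho> q}. A q)) \<inter> B p) =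
       prob (A p - (\<Union>q\<in>{q\<in>F. \<rho> p < \<rho> q}. A q)) * prob (B p)" if p: "p \<in> F" for p
    proof -
      define H where "H = {q\<in>F. \<rho> p < \<rho> q}"
      have finH: "finite H" using fin by (simp add: H_def)
      have finS: "finite (S p)" by (simp add: S_def)
      have "q \<notin> S p" if "q \<in> insert p H" for q
      proof
        assume q: "q \<in> S p"
        then have "q \<noteq> p" by (simp add: S_def)
        then show False using that \<rho>_less[OF q p] by (auto simp: H_def)
      qed
      then have "insert p H \<inter> S p = {}" by blast
      \<comment> \<open>The piece for p depends on p and indices of larger rank, and R p on indices
        of smaller rank: two disjoint blocks of the family.\<close>
      then have iv: "indep_var (PiM (insert p H) (\<lambda>_. borel)) (\<lambda>\<omega>. restrict (\<lambda>i. Y i \<omega>) (insert p H))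
          (PiM (S p) (\<lambda>_. borel)) (\<lambda>\<omega>. restrict (\<lambda>i. Y i \<omega>) (S p))"
        by (intro indep_var_restrict[OF ind]) auto
      define Ea where "Ea = {f \<in> space (PiM (insert p H) (\<lambda>_. borel :: real measure)). c p < \<bar>f p\<bar> \<and> (\<forall>q\<in>H. \<bar>f q\<bar> \<le> c q)}"
      define Eb where "Eb = {f \<in> space (PiM (S p) (\<lambda>_. borel :: real measure)). \<bar>(\<Sum>q\<in>S p. w p q * f q) - \<mu>\<bar> \<le> 1 / 2}"
      have Ea: "Ea \<in> sets (PiM (insert p H) (\<lambda>_. borel))"
        unfolding Ea_def using finH by measurable
      have Eb: "Eb \<in> sets (PiM (S p) (\<lambda>_. borel))"
        unfolding Eb_def using finS by measurable
      have a: "(\<lambda>\<omega>. restrict (\<lambda>i. Y i \<omega>) (insert p H)) -` Ea \<inter> space M = A p - (\<Union>q\<in>H. A q)"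
        by (auto simp: Ea_def A_def space_PiM not_less)
      have b: "(\<lambda>\<omega>. restrict (\<lambda>i. Y i \<omega>) (S p)) -` Eb \<inter> space M = B p"
        by (auto simp: Eb_def B_def R_def space_PiM cong: sum.cong)
      have ab: "(\<lambda>\<omega>. (restrict (\<lambda>i. Y i \<omega>) (insert p H), restrict (\<lambda>i. Y i \<omega>) (S p))) -` (Ea \<times> Eb) \<inter> space M =
          (A p - (\<Union>q\<in>H. A q)) \<inter> B p"
        unfolding a[symmetric] b[symmetric] by auto
      show ?thesis
        using indep_varD[OF iv Ea Eb] unfolding a b ab unfolding H_def .
    qed
    have "prob (\<Union>p\<in>F. A p) \<le> 2 * prob (?D N)"
    proof (rule prob_last_exceedance[OF fin \<rho>_inj A_meas B_meas _ indep_event])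
      show "?D N \<in> events" by measurable
      fix p assume p: "p \<in> F"
      show "1 / 2 \<le> prob (B p)" by (rule half) (use p in \<open>auto simp: F_def\<close>)
      show "A p \<inter> B p \<subseteq> ?D N" by (rule sub) (use p in \<open>auto simp: F_def\<close>)
    qed
    also have "\<dots> \<le> 1 / 2" using N(1) by simp
    finally have "prob (\<Union>p\<in>F. {\<omega>\<in>space M. c p < \<bar>Y p \<omega>\<bar>}) \<le> 1 / 2" by (simp add: A_def)
    from sum_prob_le_ln_2[OF fin indep_vars_subset[OF ind] this]
    show "(\<Sum>p\<in>{N..L} \<times> {N..L}.
      prob {\<omega>\<in>space M. cesaro_number \<alpha> (fst p) * cesaro_number \<beta> (snd p) < \<bar>X \<omega>\<bar>}) \<le> ln 2"
      unfolding prob_Y by (simp add: F_def c_def)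
  qed
qed

end

section \<open>Lower bounds for the number of exceedances\<close>

lemma count_indicator_lower_bound:
  fixes x :: real
  assumes "x \<le> real L"
  shows "x - real N - 1 \<le> (\<Sum>m\<in>{N..L}. if real (Suc m) < x then 1 else 0)"
proof (cases "x \<le> real N + 1")
  case True
  then have "x - real N - 1 \<le> 0" by simp
  also have "0 \<le> (\<Sum>m\<in>{N..L}. if real (Suc m) < x then 1 else (0 :: real))"
    by (intro sum_nonneg) auto
  finally show ?thesis .
next
  case False
  \<comment> \<open>The largest integer strictly below x, matching the strict inequality in the
    count.\<close>
  define j where "j = nat (\<lceil>x\<rceil> - 1)"
  have "\<lceil>x\<rceil> - 1 \<ge> 0" using False by linarith
  then have j: "real j = of_int (\<lceil>x\<rceil> - 1)" unfolding j_def by (rule of_nat_nat)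
  have "real j < x" "x \<le> real j + 1" unfolding j by (simp_all, linarith+)
  have "real N < real j + 1" using False \<open>x \<le> real j + 1\<close> by linarith
  then have "N \<le> j" by linarith
  have "j \<le> L" using \<open>real j < x\<close> assms by linarith
  have "x - real N - 1 \<le> real (card {N..<j})" using \<open>x \<le> real j + 1\<close> \<open>N \<le> j\<close> by (simp add: of_nat_diff)
  also have "\<dots> = (\<Sum>m\<in>{N..<j}. 1)" by simp
  also have "\<dots> \<le> (\<Sum>m\<in>{N..<j}. if real (Suc m) < x then 1 else 0)"
  proof (intro sum_mono)
    fix m assume "m \<in> {N..<j}"
    then have "real (Suc m) \<le> real j" by simp
    then show "1 \<le> (if real (Suc m) < x then 1 else (0 :: real))" using \<open>real j < x\<close> by simp
  qed
  also have "\<dots> \<le> (\<Sum>m\<in>{N..L}. if real (Suc m) < x then 1 else 0)"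
    using \<open>j \<le> L\<close> by (intro sum_mono2) auto
  finally show ?thesis .
qed

text \<open>Only the row with second index N is counted. It already has the right order x when the
  double count carries no logarithm.\<close>

lemma double_count_row_lower_bound:
  fixes x \<tau> :: real
  assumes "N \<le> L" "x \<le> real L" "\<tau> \<ge> 0" "x \<ge> 0"
  shows "x / real (Suc N) powr \<tau> - real N - 1 \<le>
    (\<Sum>p\<in>{N..L} \<times> {N..L}. if real (Suc (fst p)) * real (Suc (snd p)) powr \<tau> < x then 1 else 0)"
proof -
  have pos: "real (Suc n) powr \<tau> > 0" for n by simp
  have "real (Suc N) powr \<tau> \<ge> 1" using assms by (intro ge_one_powr_ge_zero) auto
  then have "x / real (Suc N) powr \<tau> \<le> x" using assms by (simp add: divide_le_eq mult_le_cancel_left1 del: of_nat_Suc)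
  then have "x / real (Suc N) powr \<tau> \<le> real L" using assms by linarith
  from count_indicator_lower_bound[OF this, of N]
  have "x / real (Suc N) powr \<tau> - real N - 1 \<le>
      (\<Sum>m\<in>{N..L}. if real (Suc m) < x / real (Suc N) powr \<tau> then 1 else 0)" .
  also have "\<dots> = (\<Sum>p\<in>{N..L} \<times> {N}. if real (Suc (fst p)) * real (Suc (snd p)) powr \<tau> < x then 1 else 0)"
    unfolding pos_less_divide_eq[OF pos]
    by (rule sum.reindex_bij_witness[of _ fst "\<lambda>m. (m, N)"]) auto
  also have "\<dots> \<le> (\<Sum>p\<in>{N..L} \<times> {N..L}. if real (Suc (fst p)) * real (Suc (snd p)) powr \<tau> < x then 1 else 0)"
    using assms by (intro sum_mono2) auto
  finally show ?thesis .
qed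

text \<open>The count for a fixed second index n is at least x/(n + 1) - N - 1. Summed over N \<le>
  n < j with j the integer part of x, the harmonic sum gives x ln x minus N x for its missing first
  terms, and the corrections cost another (N + 1) x. For x < 1 or j < N the left side is at most
  0.\<close>

lemma double_count_log_lower_bound:
  fixes x :: real
  assumes "x \<le> real L" "x \<ge> 0"
  shows "x * max (ln x) 0 - real (2 * N + 1) * x \<le>
    (\<Sum>p\<in>{N..L} \<times> {N..L}. if real (Suc (fst p)) * real (Suc (snd p)) < x then 1 else 0)"
    (is "?lhs \<le> ?rhs")
proof -
  have nonneg: "?rhs \<ge> 0" by (intro sum_nonneg) auto
  define j where "j = nat \<lfloor>x\<rfloor>"
  have j: "real j \<le> x" "x < real j + 1" using assms by (auto simp: j_def)
  show ?thesis
  proof (cases "x < 1 \<or> j < N")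
    case True
    have "x * max (ln x) 0 \<le> real (2 * N + 1) * x"
    proof (cases "x < 1")
      case True
      then have "max (ln x) 0 = 0" using assms by (cases "x = 0") auto
      then show ?thesis using assms by simp
    next
      case False
      then have "real j + 1 \<le> real N" using \<open>x < 1 \<or> j < N\<close> by linarith
      then have "x \<le> real N" using j by linarith
      moreover have "ln x \<le> x" using False ln_le_minus_one[of x] by linarith
      ultimately have "max (ln x) 0 \<le> real (2 * N + 1)" using False by auto
      from mult_left_mono[OF this assms(2)] show ?thesis by (simp only: mult.commute)
    qed
    then show ?thesis using nonneg by linarith
  next
    case False
    then have x1: "x \<ge> 1" and Nj: "N \<le> j" by auto
    have "real j \<le> real L" using j assms by linarith
    then have jL: "j \<le> L" by simp
    have harm: "ln x \<le> (\<Sum>n<j. 1 / real (Suc n))"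
    proof -
      have "(\<Sum>n<k. 1 / real (Suc n)) \<ge> ln (real (Suc k))" for k
      proof (induction k)
        case (Suc k)
        have "ln (real (Suc (Suc k)) / real (Suc k)) \<le> real (Suc (Suc k)) / real (Suc k) - 1"
          by (rule ln_le_minus_one) simp
        also have "\<dots> = 1 / real (Suc k)" by (simp add: field_simps)
        finally have "ln (real (Suc (Suc k))) - ln (real (Suc k)) \<le> 1 / real (Suc k)"
          by (simp add: ln_div)
        then show ?case using Suc by simp
      qed simp
      from this[of j] have "ln (real (Suc j)) \<le> (\<Sum>n<j. 1 / real (Suc n))" .
      moreover have "ln x \<le> ln (real (Suc j))" using x1 j by (subst ln_le_cancel_iff) auto
      ultimately show ?thesis by linarith
    qed
    have split: "(\<Sum>n<j. 1 / real (Suc n)) \<le> real N + (\<Sum>n\<in>{N..<j}. 1 / real (Suc n))"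
    proof -
      have "(\<Sum>n<j. 1 / real (Suc n)) = (\<Sum>n<N. 1 / real (Suc n)) + (\<Sum>n\<in>{N..<j}. 1 / real (Suc n))"
        using Nj by (metis ivl_disj_int_one(2) ivl_disj_un_one(2) finite_lessThan finite_atLeastLessThan sum.union_disjoint)
      moreover have "(\<Sum>n<N. 1 / real (Suc n)) \<le> (\<Sum>n<N. 1)" by (intro sum_mono) simp
      ultimately show ?thesis by simp
    qed
    have "x * ln x - real (2 * N + 1) * x \<le> x * (real N + (\<Sum>n\<in>{N..<j}. 1 / real (Suc n))) - real (2 * N + 1) * x"
      using harm split x1 by (intro diff_right_mono mult_left_mono) auto
    also have "\<dots> = (\<Sum>n\<in>{N..<j}. x / real (Suc n)) - (real N + 1) * x"
      by (simp add: algebra_simps sum_distrib_left)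
    also have "\<dots> \<le> (\<Sum>n\<in>{N..<j}. x / real (Suc n)) - (real N + 1) * real (card {N..<j})"
      using j Nj by (intro diff_left_mono mult_left_mono) auto
    also have "\<dots> = (\<Sum>n\<in>{N..<j}. x / real (Suc n) - real N - 1)"
      by (simp add: sum_subtractf algebra_simps)
    also have "\<dots> \<le> (\<Sum>n\<in>{N..<j}. \<Sum>m\<in>{N..L}. if real (Suc m) < x / real (Suc n) then 1 else 0)"
    proof (intro sum_mono count_indicator_lower_bound)
      fix n
      have "x / real (Suc n) \<le> x" using assms by (simp add: divide_le_eq mult_le_cancel_left1)
      then show "x / real (Suc n) \<le> real L" using assms by linarith
    qed
    also have "\<dots> \<le> (\<Sum>n\<in>{N..L}. \<Sum>m\<in>{N..L}. if real (Suc m) < x / real (Suc n) then 1 else 0)"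
      using jL by (intro sum_mono2) (auto intro!: sum_nonneg)
    also have "\<dots> = (\<Sum>m\<in>{N..L}. \<Sum>n\<in>{N..L}. if real (Suc m) < x / real (Suc n) then 1 else 0)"
      by (rule sum.swap)
    also have "\<dots> = ?rhs"
      by (simp add: sum.cartesian_product less_divide_eq case_prod_unfold del: of_nat_Suc)
    finally show ?thesis
      using x1 by (simp only: max_absorb1[OF ln_ge_zero])
  qed
qed

section \<open>The moment condition from exceedance counts\<close>

context prob_space
begin

text \<open>The number of exceedances increases with the box, and its expectation stays below B, so
  by monotone convergence the total count is integrable. This is why L may depend on \<omega> in the
  pointwise comparison.\<close>

lemma integrable_from_box_counts:
  fixes g :: "'a \<Rightarrow> real" and h :: "'a \<Rightarrow> real" and u :: "nat \<times> nat \<Rightarrow> real"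
  assumes [measurable]: "W \<in> borel_measurable M" "g \<in> borel_measurable M" and h: "integrable M h"
    and bound: "\<And>L. (\<Sum>p\<in>{N..L} \<times> {N..L}. prob {\<omega>\<in>space M. u p < W \<omega>}) \<le> B"
    and g_nonneg: "\<And>\<omega>. g \<omega> \<ge> 0" and h_nonneg: "\<And>\<omega>. h \<omega> \<ge> 0"
    and le: "\<And>\<omega>. \<exists>L. g \<omega> \<le> h \<omega> + (\<Sum>p\<in>{N..L} \<times> {N..L}. if u p < W \<omega> then 1 else 0)"
  shows "integrable M g"
proof (rule integrableI_nonneg)
  define S where "S L \<omega> = (\<Sum>p\<in>{N..L} \<times> {N..L}. if u p < W \<omega> then 1 else (0 :: real))" for L \<omega>
  have S_meas [measurable]: "S L \<in> borel_measurable M" for L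
    unfolding S_def[abs_def] by measurable
  have S_nonneg: "S L \<omega> \<ge> 0" for L \<omega> unfolding S_def by (intro sum_nonneg) auto
  have S_mono: "S L \<omega> \<le> S L' \<omega>" if "L \<le> L'" for L L' \<omega>
    unfolding S_def using that by (intro sum_mono2) auto
  have S_int: "(\<integral>\<^sup>+\<omega>. ennreal (S L \<omega>) \<partial>M) \<le> ennreal B" for L
  proof -
    have "(\<integral>\<^sup>+\<omega>. ennreal (S L \<omega>) \<partial>M) = (\<integral>\<^sup>+\<omega>. (\<Sum>p\<in>{N..L} \<times> {N..L}. indicator {\<omega>\<in>space M. u p < W \<omega>} \<omega>) \<partial>M)"
    proof (intro nn_integral_cong)
      fix \<omega> assume "\<omega> \<in> space M"
      then have "S L \<omega> = (\<Sum>p\<in>{N..L} \<times> {N..L}. indicator {\<omega>\<in>space M. u p < W \<omega>} \<omega>)"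
        unfolding S_def by (intro sum.cong) (auto simp: indicator_def)
      then show "ennreal (S L \<omega>) = (\<Sum>p\<in>{N..L} \<times> {N..L}. indicator {\<omega>\<in>space M. u p < W \<omega>} \<omega>)"
        by (simp add: sum_ennreal[symmetric] ennreal_indicator)
    qed
    also have "\<dots> = (\<Sum>p\<in>{N..L} \<times> {N..L}. ennreal (prob {\<omega>\<in>space M. u p < W \<omega>}))"
      by (subst nn_integral_sum) (auto simp: emeasure_eq_measure)
    also have "\<dots> = ennreal (\<Sum>p\<in>{N..L} \<times> {N..L}. prob {\<omega>\<in>space M. u p < W \<omega>})"
      by (rule sum_ennreal) simp
    finally show ?thesis using bound[of L] by (simp add: ennreal_leI)
  qed
  have "(\<integral>\<^sup>+\<omega>. ennreal (g \<omega>) \<partial>M) \<le> (\<integral>\<^sup>+\<omega>. ennreal (h \<omega>) + (SUP L. ennreal (S L \<omega>)) \<partial>M)"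
  proof (intro nn_integral_mono)
    fix \<omega>
    obtain L where "g \<omega> \<le> h \<omega> + S L \<omega>" using le[of \<omega>] unfolding S_def by blast
    then have "ennreal (g \<omega>) \<le> ennreal (h \<omega>) + ennreal (S L \<omega>)"
      using h_nonneg S_nonneg by (simp add: ennreal_leI flip: ennreal_plus)
    also have "\<dots> \<le> ennreal (h \<omega>) + (SUP L. ennreal (S L \<omega>))"
      by (intro add_left_mono SUP_upper) auto
    finally show "ennreal (g \<omega>) \<le> ennreal (h \<omega>) + (SUP L. ennreal (S L \<omega>))" .
  qed
  also have "\<dots> = (\<integral>\<^sup>+\<omega>. ennreal (h \<omega>) \<partial>M) + (\<integral>\<^sup>+\<omega>. (SUP L. ennreal (S L \<omega>)) \<partial>M)"
    using h by (intro nn_integral_add) auto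
  also have "(\<integral>\<^sup>+\<omega>. (SUP L. ennreal (S L \<omega>)) \<partial>M) = (SUP L. \<integral>\<^sup>+\<omega>. ennreal (S L \<omega>) \<partial>M)"
    by (intro nn_integral_monotone_convergence_SUP) (auto simp: incseq_def le_fun_def S_mono ennreal_leI)
  also have "(\<integral>\<^sup>+\<omega>. ennreal (h \<omega>) \<partial>M) = ennreal (expectation h)"
    using h h_nonneg by (intro nn_integral_eq_integral) auto
  finally have "(\<integral>\<^sup>+\<omega>. ennreal (g \<omega>) \<partial>M) \<le> ennreal (expectation h) + (SUP L. \<integral>\<^sup>+\<omega>. ennreal (S L \<omega>) \<partial>M)" .
  also have "\<dots> \<le> ennreal (expectation h) + ennreal B"
    by (intro add_left_mono SUP_least S_int)
  also have "\<dots> < \<infinity>" by simp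
  finally show "(\<integral>\<^sup>+\<omega>. ennreal (g \<omega>) \<partial>M) < \<infinity>" .
qed (use g_nonneg in auto)

lemma cesaro_exceedance_moment:
  assumes \<alpha>: "0 < \<alpha>" "\<alpha> \<le> \<beta>" "\<beta> \<le> 1"
    and X [measurable]: "X \<in> borel_measurable M"
    and bound: "\<And>L. (\<Sum>p\<in>{N..L} \<times> {N..L}.
      prob {\<omega>\<in>space M. cesaro_number \<alpha> (fst p) * cesaro_number \<beta> (snd p) < \<bar>X \<omega>\<bar>}) \<le> B"
  shows "integrable M (\<lambda>\<omega>. \<bar>X \<omega>\<bar> powr (1 / \<alpha>) * (if \<alpha> = \<beta> then log_plus \<bar>X \<omega>\<bar> else 1))"
proof -
  \<comment> \<open>The product of the constants in \<open>cesaro_number_le\<close>. With it W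
    linearises the problem: u p < W forces |X| above the product of the Cesaro numbers.\<close>
  define K where "K = (1 + \<alpha>) * (1 + \<beta>)"
  define \<tau> where "\<tau> = \<beta> / \<alpha>"
  define W where "W \<omega> = (\<bar>X \<omega>\<bar> / K) powr (1 / \<alpha>)" for \<omega>
  define u where "u p = real (Suc (fst p)) * real (Suc (snd p)) powr \<tau>" for p :: "nat \<times> nat"
  have K: "K > 0" using \<alpha> by (simp add: K_def)
  have \<tau>: "\<tau> \<ge> 0" using \<alpha> by (simp add: \<tau>_def)
  have W [measurable]: "W \<in> borel_measurable M" unfolding W_def[abs_def] by measurable
  have W_nonneg: "W \<omega> \<ge> 0" for \<omega> by (simp add: W_def)
  have u_bound: "(\<Sum>p\<in>{N..L} \<times> {N..L}. prob {\<omega>\<in>space M. u p < W \<omega>}) \<le> B" for L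
  proof (rule order_trans[OF sum_mono bound[of L]])
    fix p :: "nat \<times> nat"
    show "prob {\<omega>\<in>space M. u p < W \<omega>} \<le>
        prob {\<omega>\<in>space M. cesaro_number \<alpha> (fst p) * cesaro_number \<beta> (snd p) < \<bar>X \<omega>\<bar>}"
    proof (intro finite_measure_mono Collect_mono_iff[THEN iffD2] allI impI)
      fix \<omega> assume \<omega>: "\<omega> \<in> space M \<and> u p < W \<omega>"
      have "cesaro_number \<alpha> (fst p) * cesaro_number \<beta> (snd p) \<le>
          ((1 + \<alpha>) * real (Suc (fst p)) powr \<alpha>) * ((1 + \<beta>) * real (Suc (snd p)) powr \<beta>)"
        using \<alpha> by (intro mult_mono cesaro_number_le cesaro_number_nonneg) auto
      also have "\<dots> = K * u p powr \<alpha>"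
        using \<alpha> by (simp add: u_def K_def \<tau>_def powr_mult powr_powr)
      also have "\<dots> < K * W \<omega> powr \<alpha>"
        using \<omega> \<alpha> K by (intro mult_strict_left_mono powr_less_mono2) (auto simp: u_def)
      also have "\<dots> = \<bar>X \<omega>\<bar>"
        using \<alpha> K by (simp add: W_def powr_powr)
      finally show "\<omega> \<in> space M \<and> cesaro_number \<alpha> (fst p) * cesaro_number \<beta> (snd p) < \<bar>X \<omega>\<bar>"
        using \<omega> by simp
    qed measurable
  qed
  \<comment> \<open>This settles \<alpha> < \<beta>; for \<alpha> = \<beta> it is needed first,
    because the logarithmic lower bound has an error term that is a multiple of W.\<close>
  have "integrable M (\<lambda>\<omega>. W \<omega> / real (Suc N) powr \<tau>)"
  proof (rule integrable_from_box_counts[OF W _ _ u_bound])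
    show "integrable M (\<lambda>_. real N + 1)" by simp
    fix \<omega>
    obtain L where L: "W \<omega> \<le> real L" using real_arch_simple by blast
    then have "W \<omega> \<le> real (max N L)" by simp
    from double_count_row_lower_bound[OF _ this \<tau> W_nonneg, of N]
    show "\<exists>L. W \<omega> / real (Suc N) powr \<tau> \<le> real N + 1 + (\<Sum>p\<in>{N..L} \<times> {N..L}. if u p < W \<omega> then 1 else 0)"
      unfolding u_def by (intro exI[of _ "max N L"]) (simp del: of_nat_Suc)
  qed (auto simp: W_nonneg)
  from integrable_mult_right[OF this, of "real (Suc N) powr \<tau>"]
  have W_int: "integrable M W" by (simp del: of_nat_Suc)
  have abs_X: "\<bar>X \<omega>\<bar> powr (1 / \<alpha>) = K powr (1 / \<alpha>) * W \<omega>" for \<omega>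
    using K by (simp add: W_def powr_divide)
  show ?thesis
  proof (cases "\<alpha> = \<beta>")
    case False
    then show ?thesis using W_int by (simp add: abs_X)
  next
    case True
    then have "\<tau> = 1" using \<alpha> by (simp add: \<tau>_def)
    then have u: "u p = real (Suc (fst p)) * real (Suc (snd p))" for p by (simp add: u_def)
    have WlnW: "integrable M (\<lambda>\<omega>. W \<omega> * max (ln (W \<omega>)) 0)"
    proof (rule integrable_from_box_counts[OF W _ _ u_bound])
      show "integrable M (\<lambda>\<omega>. real (2 * N + 1) * W \<omega>)" using W_int by (rule integrable_mult_right)
      fix \<omega>
      obtain L where L: "W \<omega> \<le> real L" using real_arch_simple by blast
      from double_count_log_lower_bound[OF this W_nonneg, of N]
      have "W \<omega> * max (ln (W \<omega>)) 0 \<le> real (2 * N + 1) * W \<omega> + (\<Sum>p\<in>{N..L} \<times> {N..L}. if u p < W \<omega> then 1 else 0)"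
        unfolding u by linarith
      then show "\<exists>L. W \<omega> * max (ln (W \<omega>)) 0 \<le> real (2 * N + 1) * W \<omega> + (\<Sum>p\<in>{N..L} \<times> {N..L}. if u p < W \<omega> then 1 else 0)"
        by blast
    qed (auto simp: W_nonneg)
    have dom: "integrable M (\<lambda>\<omega>. K powr (1 / \<alpha>) * ((1 + \<bar>ln K\<bar>) * W \<omega> + W \<omega> * max (ln (W \<omega>)) 0))"
      using W_int WlnW by auto
    show ?thesis
    proof (rule Bochner_Integration.integrable_bound[OF dom])
      show "AE \<omega> in M. norm (\<bar>X \<omega>\<bar> powr (1 / \<alpha>) * (if \<alpha> = \<beta> then log_plus \<bar>X \<omega>\<bar> else 1))
        \<le> norm (K powr (1 / \<alpha>) * ((1 + \<bar>ln K\<bar>) * W \<omega> + W \<omega> * max (ln (W \<omega>)) 0))"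
      proof (rule AE_I2)
        fix \<omega>
        \<comment> \<open>From ln |X| = ln K + \<alpha> ln W and \<alpha> \<le> 1; the additional 1
          covers the truncation of \<open>log_plus\<close> at 1. Where X = 0, also W = 0, so the
          factor W removes the value \<open>log_plus 0 = 1\<close>.\<close>
        have log: "W \<omega> * log_plus \<bar>X \<omega>\<bar> \<le> W \<omega> * (1 + \<bar>ln K\<bar> + max (ln (W \<omega>)) 0)"
        proof (cases "X \<omega> = 0")
          case True
          then show ?thesis by (simp add: W_def)
        next
          case False
          then have "ln (W \<omega>) = (ln \<bar>X \<omega>\<bar> - ln K) / \<alpha>"
            using K by (simp add: W_def ln_powr ln_div)
          then have "ln \<bar>X \<omega>\<bar> = ln K + \<alpha> * ln (W \<omega>)" using \<alpha> by (simp add: field_simps)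
          also have "\<alpha> * ln (W \<omega>) \<le> max (ln (W \<omega>)) 0"
            using \<alpha> mult_right_mono[of \<alpha> 1 "ln (W \<omega>)"] mult_nonneg_nonpos[of \<alpha> "ln (W \<omega>)"]
            by (cases "ln (W \<omega>) \<ge> 0") auto
          finally have "ln \<bar>X \<omega>\<bar> \<le> \<bar>ln K\<bar> + max (ln (W \<omega>)) 0" by linarith
          then have "log_plus \<bar>X \<omega>\<bar> \<le> 1 + \<bar>ln K\<bar> + max (ln (W \<omega>)) 0"
            using False by (auto simp: log_plus_def)
          then show ?thesis by (intro mult_left_mono W_nonneg)
        qed
        have "norm (\<bar>X \<omega>\<bar> powr (1 / \<alpha>) * (if \<alpha> = \<beta> then log_plus \<bar>X \<omega>\<bar> else 1)) =
            K powr (1 / \<alpha>) * (W \<omega> * log_plus \<bar>X \<omega>\<bar>)"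
          unfolding if_P[OF True] abs_X
          using W_nonneg order_trans[OF zero_le_one log_plus_ge_1] by (simp add: abs_mult)
        also have "\<dots> \<le> K powr (1 / \<alpha>) * (W \<omega> * (1 + \<bar>ln K\<bar> + max (ln (W \<omega>)) 0))"
          by (intro mult_left_mono log) auto
        also have "\<dots> = K powr (1 / \<alpha>) * ((1 + \<bar>ln K\<bar>) * W \<omega> + W \<omega> * max (ln (W \<omega>)) 0)"
          by (simp add: algebra_simps)
        finally show "norm (\<bar>X \<omega>\<bar> powr (1 / \<alpha>) * (if \<alpha> = \<beta> then log_plus \<bar>X \<omega>\<bar> else 1))
          \<le> norm (K powr (1 / \<alpha>) * ((1 + \<bar>ln K\<bar>) * W \<omega> + W \<omega> * max (ln (W \<omega>)) 0))"
          by (simp only: real_norm_def) linarith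
      qed
    qed measurable
  qed
qed

lemma integrable_of_moment:
  assumes \<alpha>: "0 < \<alpha>" "\<alpha> \<le> 1" and [measurable]: "X \<in> borel_measurable M"
    and moment: "integrable M (\<lambda>\<omega>. \<bar>X \<omega>\<bar> powr (1 / \<alpha>) * (if b then log_plus \<bar>X \<omega>\<bar> else 1))"
  shows "integrable M X"
proof (rule Bochner_Integration.integrable_bound)
  show "integrable M (\<lambda>\<omega>. 1 + \<bar>X \<omega>\<bar> powr (1 / \<alpha>) * (if b then log_plus \<bar>X \<omega>\<bar> else 1))"
    using moment by simp
  show "AE \<omega> in M. norm (X \<omega>) \<le> norm (1 + \<bar>X \<omega>\<bar> powr (1 / \<alpha>) * (if b then log_plus \<bar>X \<omega>\<bar> else 1))"
  proof (rule AE_I2)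
    fix \<omega>
    define l where "l = (if b then log_plus \<bar>X \<omega>\<bar> else 1)"
    have l: "l \<ge> 1" using log_plus_ge_1 by (simp add: l_def)
    have "\<bar>X \<omega>\<bar> \<le> 1 + \<bar>X \<omega>\<bar> powr (1 / \<alpha>)"
    proof (cases "\<bar>X \<omega>\<bar> \<le> 1")
      case False
      then have "\<bar>X \<omega>\<bar> powr 1 \<le> \<bar>X \<omega>\<bar> powr (1 / \<alpha>)" using \<alpha> by (intro powr_mono) auto
      then show ?thesis by simp
    qed (simp add: add_increasing2)
    also have "\<dots> \<le> 1 + \<bar>X \<omega>\<bar> powr (1 / \<alpha>) * l"
      using mult_left_mono[OF l, of "\<bar>X \<omega>\<bar> powr (1 / \<alpha>)"] by simp
    finally show "norm (X \<omega>) \<le> norm (1 + \<bar>X \<omega>\<bar> powr (1 / \<alpha>) * (if b then log_plus \<bar>X \<omega>\<bar> else 1))"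
      unfolding l_def[symmetric] by simp
  qed
qed measurable

end

theorem theorem5p1:
  fixes M :: "'a measure"
    and X :: "'a \<Rightarrow> real"
    and Y :: "nat \<Rightarrow> nat \<Rightarrow> 'a \<Rightarrow> real"
    and \<alpha> \<beta> \<mu> :: real
  assumes "prob_space M"
    and "0 < \<alpha>" and "\<alpha> \<le> \<beta>" and "\<beta> \<le> 1"
    and "prob_space.iid_with_array M X Y"
  shows "(AE \<omega> in M.
            ((\<lambda>(m, n). cesaro_mean \<alpha> \<beta> (\<lambda>k l. Y k l \<omega>) m n) \<longlongrightarrow> \<mu>)
              (sequentially \<times>\<^sub>F sequentially)) \<longleftrightarrow>
         (integrable M X \<and> prob_space.expectation M X = \<mu>) \<and>
         (\<alpha> < \<beta> \<longrightarrow> integrable M (\<lambda>\<omega>. \<bar>X \<omega>\<bar> powr (1 / \<alpha>))) \<and>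
         (\<alpha> = \<beta> \<longrightarrow> integrable M (\<lambda>\<omega>. \<bar>X \<omega>\<bar> powr (1 / \<alpha>) * log_plus \<bar>X \<omega>\<bar>))"
    (is "?conv \<mu> \<longleftrightarrow> ?mean \<and> ?moments")
proof -
  interpret prob_space M by (rule assms(1))
  let ?V = "case_option X (\<lambda>(k, l). Y k l)"
  let ?Z = "\<lambda>p. Y (fst p) (snd p)"
  have indV: "indep_vars (\<lambda>_. borel) ?V UNIV" and distr: "\<And>k l. distr M borel (Y k l) = distr M borel X"
    using assms(5) by (auto simp: iid_with_array_def)
  have X [measurable]: "X \<in> borel_measurable M"
  proof -
    have "?V None \<in> borel_measurable M"
      using indV unfolding indep_vars_def by blast
    then show ?thesis by simp
  qed
  \<comment> \<open>The array is the part of the joint family indexed by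
    \<open>Some\<close>.\<close>
  have ind: "indep_vars (\<lambda>_. borel) ?Z UNIV"
    using indep_vars_reindex[OF indV, of Some] by (simp add: case_prod_unfold)
  have \<alpha>1: "\<alpha> \<le> 1" and \<beta>0: "0 < \<beta>" using assms by auto
  have moments_iff: "?moments \<longleftrightarrow>
      integrable M (\<lambda>\<omega>. \<bar>X \<omega>\<bar> powr (1 / \<alpha>) * (if \<alpha> = \<beta> then log_plus \<bar>X \<omega>\<bar> else 1))"
    using assms(3) by (cases "\<alpha> = \<beta>") auto
  have suff: "?conv (expectation X)" if "?moments" "integrable M X"
    using cesaro_mean_tendsto_expectation[OF assms(2-4) ind X distr that(2)] that(1)
    unfolding moments_iff by simp
  show ?thesis
  proof
    assume conv: "?conv \<mu>"
    obtain N where "\<And>L. (\<Sum>p\<in>{N..L} \<times> {N..L}.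
      prob {\<omega>\<in>space M. cesaro_number \<alpha> (fst p) * cesaro_number \<beta> (snd p) < \<bar>X \<omega>\<bar>}) \<le> ln 2"
      using cesaro_exceedance_sum_bounded[OF assms(2) \<alpha>1 \<beta>0 assms(4) ind X distr, of \<mu>] conv
      by auto
    then have moment: "integrable M (\<lambda>\<omega>. \<bar>X \<omega>\<bar> powr (1 / \<alpha>) * (if \<alpha> = \<beta> then log_plus \<bar>X \<omega>\<bar> else 1))"
      by (rule cesaro_exceedance_moment[OF assms(2-4) X])
    then have int: "integrable M X"
      by (rule integrable_of_moment[OF assms(2) \<alpha>1 X])
    have nontriv: "sequentially \<times>\<^sub>F sequentially \<noteq> (bot :: (nat \<times> nat) filter)"
      by (simp add: prod_filter_eq_bot)
    \<comment> \<open>Both limits hold on a common set of probability one and agree there, since the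
      product filter is nontrivial. The statement does not involve \<omega>, so on a probability
      space it holds outright.\<close>
    have "AE \<omega> in M. expectation X = \<mu>"
      using conv suff[OF moment[folded moments_iff] int]
      by eventually_elim (rule tendsto_unique[OF nontriv])
    then have "expectation X = \<mu>" by simp
    with int moment show "?mean \<and> ?moments" unfolding moments_iff by blast
  next
    assume "?mean \<and> ?moments"
    then show "?conv \<mu>" using suff by blast
  qed
qed

end
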